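(* Let $T$ be a Calderón-Zygmund operator on $\mathbb{R}^d$ with modulus of continuity $\omega$. There is a constant $C>0$ depending only on $d$ and $T$ (including its kernel constants and $\omega$) such that for every dyadic cube $P\subset\mathbb{R}^d$ and every integrable function $f$ supported on $P$ the following hold. (i) There exist sparse collections $\mathcal{S}_m$, $m\ge 0$, belonging to at most $3^d$ different dyadic grids, such that $$|Tf(x)|\le C\sum_{m=0}^\infty\omega(2^{-m})(m+1)\,\mathcal{A}^0_{\mathcal{S}_m}|f|(x)\qquad\text{for a.e. }x\in P.$$ (ii) If moreover $\omega$ satisfies the logarithmic Dini condition $$\int_0^1\omega(t)\Bigl(1+\log\frac1t\Bigr)\frac{dt}{t}<\infty,$$ then there exist sparse collections $\mathcal{S}_1',\dots,\mathcal{S}_{3^d}'$, belonging to possibly different dyadic grids, such that $$|Tf(x)|\le C\sum_{i=1}^{3^d}\mathcal{A}^0_{\mathcal{S}_i'}|f|(x)\qquad\text{for a.e. }x\in P.$$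
   Context: A dyadic grid is any dyadic lattice of cubes in $\mathbb{R}^d$ with sides parallel to the axes. A collection $\mathcal{S}$ of cubes belonging to the same dyadic grid is sparse if for every $Q\in\mathcal{S}$ there is a measurable $E(Q)\subset Q$ with $|E(Q)|\ge\frac12|Q|$ and $E(Q)\cap E(Q')=\emptyset$ for distinct $Q,Q'\in\mathcal{S}$. With $\langle f\rangle_Q=\frac1{|Q|}\int_Q f$, set $\mathcal{A}^0_{\mathcal{S}}f(x)=\sum_{Q\in\mathcal{S}}\langle f\rangle_Q\mathbb{1}_Q(x)$. A Calderón-Zygmund operator with modulus of continuity $\omega$ is a linear operator $T$ which extends to a bounded operator from $L^q(\mathbb{R}^d)$ to $L^q(\mathbb{R}^d)$ for some $1\le q<\infty$ and such that for appropriate $f$ (e.g. bounded with compact support) $$Tf(x)=\int_{\mathbb{R}^d}K(x,y)f(y)\,dy\qquad\text{for all }x\notin\operatorname{supp}f,$$ where for some constants $A,C_K$ the kernel satisfies $|K(x,y)|\le A|x-y|^{-d}$ and $$|K(x,y)-K(x',y)|\le C_K\,\omega\Bigl(\frac{|x-x'|}{|x-y|}\Bigr)\frac1{|x-y|^d},\qquad |K(x,y)-K(x,y')|\le C_K\,\omega\Bigl(\frac{|y-y'|}{|x-y|}\Bigr)\frac1{|x-y|^d}$$ whenever $|x-x'|\le\frac12|x-y|$, respectively $|y-y'|\le\frac12|x-y|$. Here $\omega:[0,\infty)\to[0,\infty)$ is positive on $(0,\infty)$, nondecreasing, continuous and doubling (there is a constant $D$ with $\omega(2t)\le D\,\omega(t)$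 for $t>0$). *)

theory Defs
  imports "HOL-Analysis.Analysis" "HOL-Library.Disjoint_Sets"
begin

section \<open>Dyadic grids and sparse collections\<close>

definition cube :: "real ^ 'n \<Rightarrow> real \<Rightarrow> (real ^ 'n) set" where
  "cube a l = {x. \<forall>i. a $ i \<le> x $ i \<and> x $ i < a $ i + l}"

text \<open>General dyadic grids: half-open cubes with side lengths \<open>2\<^sup>k\<close>, \<open>k \<in> \<int>\<close>, pairwise nested or
  disjoint, such that the cubes of each generation tile the space.  The corners need not be
  dyadic rationals, so translated and one-third-shifted grids are included.\<close>

definition dyadic_grid :: "(real ^ 'n) set set \<Rightarrow> bool" where
  "dyadic_grid D \<longleftrightarrow>
     (\<forall>Q\<in>D. \<exists>a. \<exists>k::int. Q = cube a (2 powi k)) \<and>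
     (\<forall>Q\<in>D. \<forall>R\<in>D. Q \<inter> R \<in> {Q, R, {}}) \<and>
     (\<forall>k::int. partition_on UNIV {Q \<in> D. \<exists>a. Q = cube a (2 powi k)})"

definition sparse_collection :: "(real ^ 'n) set set \<Rightarrow> bool" where
  "sparse_collection S \<longleftrightarrow>
     (\<exists>D. dyadic_grid D \<and> S \<subseteq> D) \<and>
     (\<exists>E. (\<forall>Q\<in>S. E Q \<in> sets lebesgue \<and> E Q \<subseteq> Q \<and>
              measure lebesgue (E Q) \<ge> 1 / 2 * measure lebesgue Q) \<and>
          disjoint_family_on E S)"

definition average :: "(real ^ 'n \<Rightarrow> real) \<Rightarrow> (real ^ 'n) set \<Rightarrow> real" where
  "average f Q = (LINT x:Q|lebesgue. f x) / measure lebesgue Q"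

text \<open>The operator \<open>\<A>\<^sup>0\<^sub>S\<close>, for nonnegative \<open>f\<close> only (\<open>ennreal\<close> truncates negative averages).  The sum
  over \<open>S\<close> takes values in \<open>[0, \<infinity>]\<close>, so that it always exists.\<close>

definition sparse_operator ::
    "(real ^ 'n) set set \<Rightarrow> (real ^ 'n \<Rightarrow> real) \<Rightarrow> real ^ 'n \<Rightarrow> ennreal" where
  "sparse_operator S f x = (\<Sum>\<^sub>\<infinity>Q\<in>S. ennreal (average f Q) * indicator Q x)"

section \<open>Calderon-Zygmund operators\<close>

definition modulus_of_continuity :: "(real \<Rightarrow> real) \<Rightarrow> bool" where
  "modulus_of_continuity \<omega> \<longleftrightarrow>
     \<omega> 0 \<ge> 0 \<and> (\<forall>t>0. \<omega> t > 0) \<and> mono_on {0..} \<omega> \<and> continuous_on {0..} \<omega> \<and>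
     (\<exists>D. \<forall>t>0. \<omega> (2 * t) \<le> D * \<omega> t)"

definition log_dini :: "(real \<Rightarrow> real) \<Rightarrow> bool" where
  "log_dini \<omega> \<longleftrightarrow> (\<integral>\<^sup>+t\<in>{0<..1}. ennreal (\<omega> t * (1 + ln (1 / t)) / t) \<partial>lborel) < \<infinity>"

definition cz_kernel :: "(real \<Rightarrow> real) \<Rightarrow> (real ^ 'n \<Rightarrow> real ^ 'n \<Rightarrow> complex) \<Rightarrow> bool" where
  "cz_kernel \<omega> K \<longleftrightarrow> (\<exists>A C\<^sub>K.
     (\<forall>x y. x \<noteq> y \<longrightarrow> norm (K x y) \<le> A / norm (x - y) ^ CARD('n)) \<and>
     (\<forall>x x' y. x \<noteq> y \<and> norm (x - x') \<le> 1 / 2 * norm (x - y) \<longrightarrow>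
        norm (K x y - K x' y)
          \<le> C\<^sub>K * \<omega> (norm (x - x') / norm (x - y)) / norm (x - y) ^ CARD('n)) \<and>
     (\<forall>x y y'. x \<noteq> y \<and> norm (y - y') \<le> 1 / 2 * norm (x - y) \<longrightarrow>
        norm (K x y - K x y')
          \<le> C\<^sub>K * \<omega> (norm (y - y') / norm (x - y)) / norm (x - y) ^ CARD('n)))"

definition Lq :: "real \<Rightarrow> (real ^ 'n \<Rightarrow> complex) set" where
  "Lq q = {f \<in> borel_measurable lebesgue. integrable lebesgue (\<lambda>x. norm (f x) powr q)}"

definition Lq_norm :: "real \<Rightarrow> (real ^ 'n \<Rightarrow> complex) \<Rightarrow> real" where
  "Lq_norm q f = (LINT x|lebesgue. norm (f x) powr q) powr (1 / q)"

text \<open>Operators act on representatives.  Linearity is required up to null sets; together with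
  boundedness this makes \<open>T f\<close> depend, up to null sets, only on the class of \<open>f\<close>.\<close>

definition bounded_linear_Lq ::
    "real \<Rightarrow> ((real ^ 'n \<Rightarrow> complex) \<Rightarrow> (real ^ 'n \<Rightarrow> complex)) \<Rightarrow> bool" where
  "bounded_linear_Lq q T \<longleftrightarrow>
     (\<forall>f\<in>Lq q. T f \<in> Lq q) \<and>
     (\<forall>f\<in>Lq q. \<forall>g\<in>Lq q. AE x in lebesgue. T (\<lambda>y. f y + g y) x = T f x + T g x) \<and>
     (\<forall>f\<in>Lq q. \<forall>c. AE x in lebesgue. T (\<lambda>y. c * f y) x = c * T f x) \<and>
     (\<exists>B. \<forall>f\<in>Lq q. Lq_norm q (T f) \<le> B * Lq_norm q f)"

text \<open>Here \<open>T\<close> is the operator after its extension to \<open>L\<^sup>q\<close>.  Its values off the support are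
  classes modulo null sets, hence the kernel representation is stated almost everywhere.\<close>

definition cz_operator ::
    "real \<Rightarrow> (real \<Rightarrow> real) \<Rightarrow> ((real ^ 'n \<Rightarrow> complex) \<Rightarrow> (real ^ 'n \<Rightarrow> complex)) \<Rightarrow> bool" where
  "cz_operator q \<omega> T \<longleftrightarrow>
     1 \<le> q \<and> modulus_of_continuity \<omega> \<and> bounded_linear_Lq q T \<and>
     (\<exists>K. cz_kernel \<omega> K \<and>
        (\<forall>f \<in> borel_measurable lebesgue.
           bounded (range f) \<and> compact (closure {y. f y \<noteq> 0}) \<longrightarrow>
           (AE x in lebesgue. x \<notin> closure {y. f y \<noteq> 0} \<longrightarrow>
              has_bochner_integral lebesgue (\<lambda>y. K x y * f y) (T f x))))"

definition tendsto_in_measure ::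
    "(nat \<Rightarrow> real ^ 'n \<Rightarrow> complex) \<Rightarrow> (real ^ 'n \<Rightarrow> complex) \<Rightarrow> bool" where
  "tendsto_in_measure u g \<longleftrightarrow>
     (\<forall>\<epsilon>>0. (\<lambda>n. emeasure lebesgue {x. norm (u n x - g x) > \<epsilon>}) \<longlonglongrightarrow> 0)"

text \<open>\<open>T f\<close> for \<open>f\<close> in \<open>L\<^sup>q\<close> or \<open>L\<^sup>1\<close>.  For integrable \<open>f\<close> outside \<open>L\<^sup>q\<close> it is the extension of \<open>T\<close> by
  continuity from \<open>L\<^sup>1 \<inter> L\<^sup>q\<close> with the \<open>L\<^sup>1\<close> norm to convergence in measure.  By density the value
  is unique up to null sets; it exists whenever \<open>T\<close> is of weak type (1,1), in particular
  whenever \<open>\<omega>\<close> satisfies the Dini condition.\<close>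

definition extend_L1 ::
    "real \<Rightarrow> ((real ^ 'n \<Rightarrow> complex) \<Rightarrow> (real ^ 'n \<Rightarrow> complex)) \<Rightarrow>
     (real ^ 'n \<Rightarrow> complex) \<Rightarrow> (real ^ 'n \<Rightarrow> complex)" where
  "extend_L1 q T f =
     (if f \<in> Lq q then T f
      else SOME g. g \<in> borel_measurable lebesgue \<and>
        (\<forall>u. (\<forall>n. u n \<in> Lq q \<and> integrable lebesgue (u n)) \<and>
             (\<lambda>n. LINT x|lebesgue. norm (u n x - f x)) \<longlonglongrightarrow> 0 \<longrightarrow>
           tendsto_in_measure (\<lambda>n. T (u n)) g))"

end

theory Submission
  imports Defs
begin

text \<open>If \<open>\<omega>\<close> violates the logarithmic Dini condition, then \<open>\<Sum>\<^sub>m \<omega>(2\<^sup>-\<^sup>m)(m + 1) = \<infinity>\<close>, and (i) holds with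
  every \<open>S\<^sub>m = {P}\<close>, its right-hand side being infinite unless \<open>f = 0\<close>.  Under the condition, (i)
  follows from (ii) by listing the \<open>3\<^sup>d\<close> collections of (ii) as the first \<open>S\<^sub>m\<close>.

  For (ii), the Calderon-Zygmund decomposition gives the weak type (1,1) of \<open>T\<close>, hence its extension
  to integrable functions.  Given a cube \<open>Q\<close>, let \<open>B\<close> be the set where \<open>T(f 1\<^bsub>3Q\<^esub>)\<close>, or an average of
  \<open>|f|\<close> over the triple of a dyadic subcube, is large compared with \<open>\<langle>|f|\<rangle>\<^bsub>3Q\<^esub>\<close>.  Stop at the maximal
  subcubes \<open>Q'\<close> in which \<open>B\<close> has a substantial share.  Kernel smoothness makes \<open>T(f 1\<^bsub>3Q - 3Q'\<^esub>)\<close> almost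
  constant on \<open>Q'\<close>, and it is bounded at the points of \<open>Q'\<close> outside \<open>B\<close> where \<open>T(f 1\<^bsub>3Q'\<^esub>)\<close> is
  moderate; such points exist by the weak type estimate.  This argument replaces the grand maximal
  truncation of \<open>T\<close>.  Iteration bounds \<open>|Tf|\<close> by averages over the triples of a sparse family.

  By the one-third trick the triples lie in comparable cubes of shifted grids.  The resulting
  families satisfy only a Carleson condition; a second stopping time, at cubes where the average has
  quadrupled or which have too many ancestors since the last stop, makes them \<open>1/2\<close>-sparse without
  increasing their number.\<close>

section \<open>Dyadic cells\<close>

text \<open>The obstacle is that \<open>T\<close> is given only on \<open>L^q\<close> and up to null
  sets, with a kernel formula only for bounded functions of bounded support and off the support,
  whereas the stopping argument compares values at single points for functions that are merely
  integrable. Pointwise estimates are therefore proved for truncations, with constants independent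
  of the truncation, and pass to the limit along a subsequence that converges almost everywhere. One
  null set must serve all pairs of points of a cell, since the comparison point is found only
  afterwards.

  Comparing with one good point per stopping cell requires that the exceptional set leave a definite
  part of every stopping cell free. This fixes the selection threshold \<open>2^-(d+1)\<close>: a
  parent that was not selected has a share of at most this, so its child has a share of at most 1/2.

  Several cells may be sent to the same shifted cell by the one-third trick. This loses nothing:
  among the cells through a given point, the generation identifies the cell.\<close>

lemma sets_cube [measurable]: "cube c l \<in> sets borel" for c :: "real ^ 'n"
proof -
  have "cube c l = {x. \<forall>i. c $ i \<le> x $ i} \<inter> {x. \<forall>i. x $ i < c $ i + l}"
    by (auto simp: cube_def)
  moreover have "closed {x :: real ^ 'n. \<forall>i. c $ i \<le> x $ i}"
    by (intro closed_Collect_all closed_Collect_le continuous_intros)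
  moreover have "open (\<Inter>i\<in>UNIV. {x :: real ^ 'n. x $ i < c $ i + l})"
    by (intro open_INT ballI open_Collect_less continuous_intros) auto
  then have "open {x :: real ^ 'n. \<forall>i. x $ i < c $ i + l}"
    by (simp add: Collect_all_eq)
  ultimately show ?thesis by (simp add: borel_closed borel_open sets.Int)
qed

lemma sets_lebesgue_cube [measurable]: "cube c l \<in> sets lebesgue"
  using sets_cube[of c l] by simp

lemma prod_Basis_vec: "(\<Prod>b\<in>Basis. ((\<chi> i. u $ i + l) - u) \<bullet> b) = l ^ CARD('n)"
  for u :: "real ^ 'n"
proof -
  have "(\<Prod>b\<in>Basis. ((\<chi> i. u $ i + l) - u) \<bullet> b) = (\<Prod>b\<in>(Basis :: (real ^ 'n) set). l)"
    by (rule prod.cong) (auto simp: Basis_vec_def inner_axis)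
  then show ?thesis by simp
qed

lemma emeasure_cube:
  fixes c :: "real ^ 'n"
  assumes "l \<ge> 0"
  shows "emeasure lebesgue (cube c l) = ennreal (l ^ CARD('n))"
proof -
  let ?d = "\<chi> i. c $ i + l"
  have le: "\<And>b. b \<in> Basis \<Longrightarrow> c \<bullet> b \<le> ?d \<bullet> b"
    using assms by (auto simp: Basis_vec_def inner_axis)
  have "emeasure lebesgue (box c ?d) = ennreal (l ^ CARD('n))"
    using emeasure_lborel_box[OF le] by (simp add: prod_Basis_vec)
  moreover have "emeasure lebesgue (cbox c ?d) = ennreal (l ^ CARD('n))"
    using emeasure_lborel_cbox[OF le] by (simp add: prod_Basis_vec)
  moreover have "emeasure lebesgue (box c ?d) \<le> emeasure lebesgue (cube c l)"
    by (rule emeasure_mono) (auto simp: cube_def mem_box_cart less_imp_le)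
  moreover have "emeasure lebesgue (cube c l) \<le> emeasure lebesgue (cbox c ?d)"
    by (rule emeasure_mono) (auto simp: cube_def mem_box_cart less_imp_le)
  ultimately show ?thesis by (metis order_antisym)
qed

lemma measure_cube: "l \<ge> 0 \<Longrightarrow> measure lebesgue (cube c l) = l ^ CARD('n)" for c :: "real ^ 'n"
  unfolding measure_def by (subst emeasure_cube) auto

text \<open>A cell is addressed by its generation \<open>k\<close> and the integer coordinates of its corner relative
  to the offset \<open>a k\<close> of the lattice of that generation.\<close>

definition index :: "(int \<Rightarrow> real ^ 'n) \<Rightarrow> int \<Rightarrow> real ^ 'n \<Rightarrow> int \<times> ('n \<Rightarrow> int)" where
  "index a k x = (k, \<lambda>i. \<lfloor>(x $ i - a k $ i) / 2 powi k\<rfloor>)"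

text \<open>Through the index, the cells of one generation partition the space by construction;
  \<open>cell_eq_cube\<close> recovers the half-open cubes.\<close>

definition cell :: "(int \<Rightarrow> real ^ 'n) \<Rightarrow> int \<times> ('n \<Rightarrow> int) \<Rightarrow> (real ^ 'n) set" where
  "cell a p = {x. index a (fst p) x = p}"

text \<open>Counting by indices makes the passage to parents in \<open>triple_mono\<close> an
  integer computation.\<close>

definition triple :: "(int \<Rightarrow> real ^ 'n) \<Rightarrow> int \<times> ('n \<Rightarrow> int) \<Rightarrow> (real ^ 'n) set" where
  "triple a p = {x. \<forall>i. \<bar>snd (index a (fst p) x) i - snd p i\<bar> \<le> 1}"

definition vol :: "int \<times> ('n \<Rightarrow> int) \<Rightarrow> real" where
  "vol p = (2 powi fst p) ^ CARD('n)"

definition maximal_cells ::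
    "(int \<Rightarrow> real ^ 'n) \<Rightarrow> (int \<times> ('n \<Rightarrow> int)) set \<Rightarrow> (int \<times> ('n \<Rightarrow> int)) set" where
  "maximal_cells a A = {p \<in> A. \<forall>q\<in>A. cell a p \<subseteq> cell a q \<longrightarrow> q = p}"

lemma vol_pos [simp]: "vol p > 0"
  by (simp add: vol_def)

lemma vol_nonneg [simp]: "vol p \<ge> 0"
  by (simp add: vol_def)

lemma vol_nonzero [simp]: "vol p \<noteq> 0"
  by (simp add: vol_def)

lemma fst_index [simp]: "fst (index a k x) = k"
  by (simp add: index_def)

lemma mem_cell_index [simp]: "x \<in> cell a (index a k x)"
  by (simp add: cell_def)

lemma cell_index_eq: "x \<in> cell a p \<Longrightarrow> index a (fst p) x = p"
  by (simp add: cell_def)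

lemma floor_eq_iff_bounds:
  fixes s :: real
  assumes "s > 0"
  shows "\<lfloor>t / s\<rfloor> = n \<longleftrightarrow> s * of_int n \<le> t \<and> t < s * of_int n + s"
  using assms by (simp add: floor_eq_iff field_simps)

lemma cell_eq_cube:
  "cell a p = cube (\<chi> i. a (fst p) $ i + 2 powi fst p * of_int (snd p i)) (2 powi fst p)"
proof -
  have "x \<in> cell a p \<longleftrightarrow> (\<forall>i. \<lfloor>(x $ i - a (fst p) $ i) / 2 powi fst p\<rfloor> = snd p i)" for x
    by (auto simp: cell_def index_def prod_eq_iff fun_eq_iff)
  then show ?thesis
    by (auto simp: floor_eq_iff_bounds cube_def algebra_simps)
qed

lemma floor_near_iff_bounds:
  fixes s :: real
  assumes "s > 0"
  shows "\<bar>\<lfloor>t / s\<rfloor> - n\<bar> \<le> 1 \<longleftrightarrow> s * of_int (n - 1) \<le> t \<and> t < s * of_int (n - 1) + 3 * s"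
proof -
  have "\<bar>\<lfloor>t / s\<rfloor> - n\<bar> \<le> 1 \<longleftrightarrow> n - 1 \<le> \<lfloor>t / s\<rfloor> \<and> \<lfloor>t / s\<rfloor> < n + 2" by auto
  also have "\<dots> \<longleftrightarrow> of_int (n - 1) \<le> t / s \<and> t / s < of_int (n + 2)"
    by (simp add: le_floor_iff floor_less_iff)
  finally show ?thesis using assms by (simp add: field_simps)
qed

lemma triple_eq_cube:
  "triple a p = cube (\<chi> i. a (fst p) $ i + 2 powi fst p * of_int (snd p i - 1)) (3 * 2 powi fst p)"
proof -
  have "x \<in> triple a p \<longleftrightarrow> (\<forall>i. \<bar>\<lfloor>(x $ i - a (fst p) $ i) / 2 powi fst p\<rfloor> - snd p i\<bar> \<le> 1)" for x
    by (auto simp: triple_def index_def)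
  then have "x \<in> triple a p \<longleftrightarrow> (\<forall>i. 2 powi fst p * of_int (snd p i - 1) \<le> x $ i - a (fst p) $ i \<and>
      x $ i - a (fst p) $ i < 2 powi fst p * of_int (snd p i - 1) + 3 * 2 powi fst p)" for x
    by (subst (asm) floor_near_iff_bounds) auto
  then show ?thesis
    by (auto simp: cube_def algebra_simps)
qed

lemma sets_cell [measurable, simp]: "cell a p \<in> sets lebesgue"
  by (simp add: cell_eq_cube)

lemma sets_triple [measurable, simp]: "triple a p \<in> sets lebesgue"
  by (simp add: triple_eq_cube)

lemma emeasure_cell: "emeasure lebesgue (cell a p) = ennreal (vol p)"
  unfolding cell_eq_cube vol_def by (rule emeasure_cube) simp

lemma measure_cell: "measure lebesgue (cell a p) = vol p"
  unfolding measure_def emeasure_cell by simp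

lemma cell_nonempty: "cell a p \<noteq> {}"
proof
  assume "cell a p = {}"
  then show False using measure_cell[of a p] vol_pos[of p] by simp
qed

lemma cell_subset_triple: "cell a p \<subseteq> triple a p"
  by (auto simp: cell_def triple_def)

lemma cell_dist:
  assumes "x \<in> cell a p" "y \<in> cell a p" shows "\<bar>x $ i - y $ i\<bar> < 2 powi fst p"
proof -
  define c where "c = a (fst p) $ i + 2 powi fst p * of_int (snd p i)"
  have "c \<le> x $ i \<and> x $ i < c + 2 powi fst p" "c \<le> y $ i \<and> y $ i < c + 2 powi fst p"
    using assms by (simp_all add: cell_eq_cube cube_def c_def)
  then show ?thesis by linarith
qed

lemma mem_triple_of_dist:
  assumes "x \<in> cell a p" "\<And>i. \<bar>y $ i - x $ i\<bar> < 2 powi fst p"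
  shows "y \<in> triple a p"
proof -
  have "a (fst p) $ i + 2 powi fst p * of_int (snd p i - 1) \<le> y $ i \<and>
      y $ i < a (fst p) $ i + 2 powi fst p * of_int (snd p i - 1) + 3 * 2 powi fst p" for i
  proof -
    define c where "c = a (fst p) $ i + 2 powi fst p * of_int (snd p i)"
    have "c \<le> x $ i \<and> x $ i < c + 2 powi fst p"
      using assms(1) by (simp add: cell_eq_cube cube_def c_def)
    moreover have "a (fst p) $ i + 2 powi fst p * of_int (snd p i - 1) = c - 2 powi fst p"
      by (simp add: c_def right_diff_distrib)
    ultimately show ?thesis using assms(2)[of i] by linarith
  qed
  then show ?thesis by (simp add: triple_eq_cube cube_def)
qed

lemma power_int_2_inject: "(2::real) powi k = 2 powi l \<Longrightarrow> k = l"
  using power_int_strict_increasing[of k l "2::real"] power_int_strict_increasing[of l k "2::real"]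
  by (metis less_irrefl linorder_neqE one_less_numeral_iff semiring_norm(76))

lemma inj_cell: "inj (cell a)"
proof (rule injI)
  fix p q :: "int \<times> ('a \<Rightarrow> int)" assume eq: "cell a p = cell a q"
  then have "vol p = vol q" by (metis measure_cell)
  then have "(2::real) powi fst p = 2 powi fst q"
    unfolding vol_def by (subst (asm) power_eq_iff_eq_base) auto
  then have "fst p = fst q" by (rule power_int_2_inject)
  moreover obtain x where "x \<in> cell a p" using cell_nonempty by blast
  ultimately show "p = q" using eq by (metis cell_index_eq)
qed

lemma vol_mono: "fst p \<le> fst q \<Longrightarrow> vol (p :: int \<times> ('n \<Rightarrow> int)) \<le> vol (q :: int \<times> ('n \<Rightarrow> int))"
  unfolding vol_def by (intro power_mono power_int_increasing) auto

lemma cell_subset_level: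
  assumes "cell a p \<subseteq> cell a q" shows "fst p \<le> fst q"
proof -
  have "emeasure lebesgue (cell a p) \<le> emeasure lebesgue (cell a q)"
    using assms by (intro emeasure_mono) auto
  then have "vol p \<le> vol q" by (simp add: emeasure_cell)
  then have "(2::real) powi fst p \<le> 2 powi fst q"
    unfolding vol_def by (subst (asm) power_mono_iff) auto
  then show ?thesis using power_int_strict_increasing[of "fst q" "fst p" "2::real"] by (force simp: not_le[symmetric])
qed

text \<open>The corners of generation \<open>k + 1\<close> are among the corners of generation
  \<open>k\<close>; this makes every coarser cell a union of finer ones.\<close>

locale grid =
  fixes a :: "int \<Rightarrow> real ^ 'n"
  assumes offsets: "\<exists>m::int. a k $ i - a (k + 1) $ i = of_int m * 2 powi k"
begin

text \<open>The order of the quantifiers matters: one \<open>m\<close> serves all points, so the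
  index of a point at generation \<open>k\<close> determines its index at
  \<open>k + 1\<close>.\<close>

lemma floor_parent:
  "\<exists>m::int. \<forall>x. \<lfloor>(x $ i - a (k + 1) $ i) / 2 powi (k + 1)\<rfloor> = (\<lfloor>(x $ i - a k $ i) / 2 powi k\<rfloor> + m) div 2"
proof -
  obtain m :: int where m: "a k $ i - a (k + 1) $ i = of_int m * 2 powi k" using offsets by blast
  have "\<lfloor>(x $ i - a (k + 1) $ i) / 2 powi (k + 1)\<rfloor> = (\<lfloor>(x $ i - a k $ i) / 2 powi k\<rfloor> + m) div 2" for x :: "real ^ 'n"
  proof -
    have "(x $ i - a (k + 1) $ i) / 2 powi (k + 1) = ((x $ i - a k $ i) / 2 powi k + of_int m) / 2"
      using m by (simp add: power_int_add field_simps)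
    also have "\<lfloor>\<dots>\<rfloor> = \<lfloor>(x $ i - a k $ i) / 2 powi k + of_int m\<rfloor> div 2"
      by (rule floor_divide_real_eq_div[where b = 2, simplified])
    finally show ?thesis by simp
  qed
  then show ?thesis by blast
qed

lemma index_Suc_eq: "index a k x = index a k y \<Longrightarrow> index a (k + 1) x = index a (k + 1) y"
  using floor_parent[of _ k] by (auto simp: index_def fun_eq_iff) metis

lemma index_eq_mono:
  assumes "index a k x = index a k y" "k \<le> l" shows "index a l x = index a l y"
  using assms(2) by (induction l rule: int_ge_induct) (auto intro: assms index_Suc_eq)

lemma cell_subset:
  assumes "x \<in> cell a p" "x \<in> cell a q" "fst p \<le> fst q" shows "cell a p \<subseteq> cell a q"
proof
  fix y assume "y \<in> cell a p"
  then have "index a (fst p) y = index a (fst p) x" using assms by (simp add: cell_def)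
  then have "index a (fst q) y = index a (fst q) x" using assms(3) by (rule index_eq_mono)
  then show "y \<in> cell a q" using assms(2) by (simp add: cell_def)
qed

lemma cell_eq_of_level: "x \<in> cell a p \<Longrightarrow> x \<in> cell a q \<Longrightarrow> fst p = fst q \<Longrightarrow> p = q"
  by (metis cell_index_eq)

lemma psubset_level: "cell a p \<subset> cell a q \<Longrightarrow> fst p < fst q"
  by (metis cell_subset_level cell_eq_of_level cell_nonempty ex_in_conv order_le_less psubset_imp_subset subset_iff less_irrefl)

text \<open>Passing to the parent shifts all indices by the same integer and halves them, and
  integers at distance at most 1 stay at distance at most 1 under halving. The general case climbs
  one generation at a time.\<close>

lemma triple_mono:
  assumes "cell a p \<subseteq> cell a q" shows "triple a p \<subseteq> triple a q"
proof -
  obtain x where x: "x \<in> cell a p" using cell_nonempty by blast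
  have "p = index a (fst p) x" "q = index a (fst q) x" using x assms by (auto simp: cell_def)
  moreover have "triple a (index a k x) \<subseteq> triple a (index a l x)" if "k \<le> l" for k l
    using that
  proof (induction l rule: int_ge_induct)
    case (step l)
    have "triple a (index a l x) \<subseteq> triple a (index a (l + 1) x)"
    proof
      fix y assume y: "y \<in> triple a (index a l x)"
      show "y \<in> triple a (index a (l + 1) x)"
        unfolding triple_def mem_Collect_eq fst_index
      proof
        fix i
        obtain m where m: "\<And>x. \<lfloor>(x $ i - a (l + 1) $ i) / 2 powi (l + 1)\<rfloor> =
            (\<lfloor>(x $ i - a l $ i) / 2 powi l\<rfloor> + m) div 2" using floor_parent by blast
        have "\<bar>\<lfloor>(y $ i - a l $ i) / 2 powi l\<rfloor> - \<lfloor>(x $ i - a l $ i) / 2 powi l\<rfloor>\<bar> \<le> 1"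
          using y by (simp add: triple_def index_def)
        then show "\<bar>snd (index a (l + 1) y) i - snd (index a (l + 1) x) i\<bar> \<le> 1"
          unfolding index_def snd_conv m by presburger
      qed
    qed
    with step show ?case by blast
  qed simp
  ultimately show ?thesis using cell_subset_level[OF assms] by metis
qed

lemma dyadic_grid: "dyadic_grid (range (cell a))"
  unfolding dyadic_grid_def
proof (intro conjI ballI allI)
  fix Q assume "Q \<in> range (cell a)"
  then show "\<exists>c k. Q = cube c (2 powi k)" by (auto simp: cell_eq_cube)
next
  fix Q R assume "Q \<in> range (cell a)" "R \<in> range (cell a)"
  then obtain p q where "Q = cell a p" "R = cell a q" by auto
  then have "Q \<inter> R = {} \<or> Q \<subseteq> R \<or> R \<subseteq> Q"
    using cell_subset[of _ p q] cell_subset[of _ q p] linear[of "fst p" "fst q"] by blast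
  then show "Q \<inter> R \<in> {Q, R, {}}" by auto
next
  fix k :: int
  \<comment> \<open>The measure of a cube determines its side, so a cell that equals some cube of
    side \<open>2 powi k\<close> has generation \<open>k\<close>.\<close>
  have eq: "{Q \<in> range (cell a). \<exists>c. Q = cube c (2 powi k)} = cell a ` {p. fst p = k}"
  proof (intro equalityI subsetI)
    fix Q assume "Q \<in> {Q \<in> range (cell a). \<exists>c. Q = cube c (2 powi k)}"
    then obtain p c where "Q = cell a p" and c: "cell a p = cube c (2 powi k)" by auto
    moreover have "fst p = k"
    proof -
      have "vol p = (2 powi k) ^ CARD('n)"
        unfolding measure_cell[of a p, symmetric] c by (rule measure_cube) simp
      then have "(2::real) powi fst p = 2 powi k"
        unfolding vol_def by (subst (asm) power_eq_iff_eq_base) auto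
      then show ?thesis by (rule power_int_2_inject)
    qed
    ultimately show "Q \<in> cell a ` {p. fst p = k}" by auto
  qed (auto simp: cell_eq_cube)
  show "partition_on UNIV {Q \<in> range (cell a). \<exists>c. Q = cube c (2 powi k)}"
    unfolding eq
  proof (rule partition_onI)
    have "x \<in> cell a (index a k x) \<and> index a k x \<in> {p. fst p = k}" for x by simp
    then show "\<Union> (cell a ` {p. fst p = k}) = UNIV" by blast
    show "{} \<notin> cell a ` {p. fst p = k}" using cell_nonempty by auto
    fix Q R assume QR: "Q \<in> cell a ` {p. fst p = k}" "R \<in> cell a ` {p. fst p = k}" "Q \<noteq> R"
    obtain p where p: "Q = cell a p" "p \<in> {p. fst p = k}" using QR(1) by (rule imageE)
    obtain q where q: "R = cell a q" "q \<in> {p. fst p = k}" using QR(2) by (rule imageE)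
    have "p \<noteq> q" using QR(3) p q by metis
    moreover have "fst p = fst q" using p q by simp
    ultimately have "x \<notin> Q \<or> x \<notin> R" for x using cell_eq_of_level[of x p q] p(1) q(1) by metis
    then show "disjnt Q R" unfolding disjnt_def by blast
  qed
qed

text \<open>Above a given cell there is one cell per generation, so a bound on the generations
  leaves finitely many candidates, and the coarsest of them is maximal.\<close>

lemma maximal_cells_cover:
  assumes "\<And>q. q \<in> A \<Longrightarrow> fst q \<le> K" "p \<in> A"
  obtains q where "q \<in> maximal_cells a A" "cell a p \<subseteq> cell a q"
proof -
  let ?L = "fst ` {q \<in> A. cell a p \<subseteq> cell a q}"
  have "?L \<subseteq> {fst p..K}" using assms(1) cell_subset_level[of a p] by fastforce
  then have fin: "finite ?L" by (rule finite_subset) simp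
  have "?L \<noteq> {}" using assms(2) by blast
  then have "Max ?L \<in> ?L" using fin by (rule Max_in[rotated])
  then obtain q where q: "q \<in> A" "cell a p \<subseteq> cell a q" "fst q = Max ?L" by auto
  have "r = q" if r: "r \<in> A" "cell a q \<subseteq> cell a r" for r
  proof -
    have "fst r \<in> ?L" using r q by auto
    then have "fst r \<le> fst q" using fin q(3) by simp
    moreover have "fst q \<le> fst r" using r(2) by (rule cell_subset_level)
    moreover obtain x where "x \<in> cell a q" using cell_nonempty by blast
    ultimately show ?thesis using cell_eq_of_level r(2) by (metis order_antisym subset_iff)
  qed
  then show ?thesis using that[of q] q by (auto simp: maximal_cells_def)
qed

lemma maximal_cells_disjoint: "disjoint_family_on (cell a) (maximal_cells a A)"
  unfolding disjoint_family_on_def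
proof (intro ballI impI)
  fix p q assume *: "p \<in> maximal_cells a A" "q \<in> maximal_cells a A" "p \<noteq> q"
  show "cell a p \<inter> cell a q = {}"
  proof (rule ccontr)
    assume "cell a p \<inter> cell a q \<noteq> {}"
    then obtain x where "x \<in> cell a p" "x \<in> cell a q" by auto
    then have "cell a p \<subseteq> cell a q \<or> cell a q \<subseteq> cell a p" using cell_subset by (metis linear)
    then show False using * by (auto simp: maximal_cells_def)
  qed
qed

lemma maximal_cells_subset: "maximal_cells a A \<subseteq> A"
  by (auto simp: maximal_cells_def)

lemma Union_maximal_cells:
  assumes "\<And>q. q \<in> A \<Longrightarrow> fst q \<le> K"
  shows "\<Union> (cell a ` maximal_cells a A) = \<Union> (cell a ` A)"
proof -
  have "cell a p \<subseteq> \<Union> (cell a ` maximal_cells a A)" if "p \<in> A" for p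
    using maximal_cells_cover[OF assms that] by (metis UN_upper subset_trans)
  then show ?thesis using maximal_cells_subset[of A] by blast
qed

end

section \<open>Measure comparison and differentiation along a grid\<close>

declare emeasure_completion [simp del]

text \<open>Averages enter through density measures: the integral over a union of disjoint cells is
  the measure of the union, so an inequality known cell by cell adds up. The density takes the place
  of \<open>N\<close> in one application and of \<open>M\<close> in others.\<close>

lemma emeasure_UN_mono_disjoint:
  assumes "countable I" "disjoint_family_on X I" "sets N = sets M" "\<And>i. i \<in> I \<Longrightarrow> X i \<in> sets M"
    and le: "\<And>i. i \<in> I \<Longrightarrow> b * emeasure N (X i) \<le> c * emeasure M (X i)"
  shows "b * emeasure N (\<Union>(X ` I)) \<le> c * emeasure M (\<Union>(X ` I))"
proof -
  have "b * emeasure N (\<Union>(X ` I)) = (\<integral>\<^sup>+i. b * emeasure N (X i) \<partial>count_space I)"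
    using assms by (subst emeasure_UN_countable) (auto simp: nn_integral_cmult)
  also have "\<dots> \<le> (\<integral>\<^sup>+i. c * emeasure M (X i) \<partial>count_space I)"
    by (rule nn_integral_mono) (use le in auto)
  also have "\<dots> = c * emeasure M (\<Union>(X ` I))"
    using assms by (subst emeasure_UN_countable) (auto simp: nn_integral_cmult)
  finally show ?thesis .
qed

lemma norm_le_of_components:
  fixes x :: "real ^ 'n"
  assumes "\<And>i. \<bar>x $ i\<bar> \<le> r" shows "norm x \<le> real CARD('n) * r"
proof -
  have "norm x \<le> (\<Sum>i\<in>UNIV. \<bar>x $ i\<bar>)" by (rule norm_le_l1_cart)
  also have "\<dots> \<le> real CARD('n) * r" by (rule sum_bounded_above[of UNIV, simplified]) (use assms in auto)
  finally show ?thesis .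
qed

lemma power_int_2_small:
  fixes e :: real assumes "e > 0"
  obtains k :: int where "k \<le> K" "2 powi k < e"
proof -
  obtain n where n: "(1 / 2) ^ n < e" using real_arch_pow_inv[of e "1/2"] assms by auto
  have "(2::real) powi min K (- int n) \<le> 2 powi (- int n)" by (intro power_int_increasing) auto
  also have "\<dots> < e" using n by (simp add: power_int_minus power_one_over field_simps)
  finally show ?thesis using that by (metis min.cobounded1)
qed

lemma measurable_Union_cells: "\<Union> (cell a ` I) \<in> sets lebesgue"
  by (rule sets.countable_UN') auto

context grid
begin

lemma small_cell_in_open:
  assumes "open U" "x \<in> U"
  obtains k where "k \<le> K" "cell a (index a k x) \<subseteq> U"
proof -
  obtain e where e: "e > 0" "ball x e \<subseteq> U" using assms openE by blast
  obtain k where k: "k \<le> K" "2 powi k < e / real CARD('n)"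
    using power_int_2_small[of "e / real CARD('n)"] e by auto
  have "cell a (index a k x) \<subseteq> ball x e"
  proof
    fix y assume y: "y \<in> cell a (index a k x)"
    have "norm (x - y) \<le> real CARD('n) * 2 powi k"
      using cell_dist[OF mem_cell_index y] by (intro norm_le_of_components) (auto intro: less_imp_le)
    also have "\<dots> < e" using k(2) by (simp add: field_simps)
    finally show "y \<in> ball x e" by (simp add: dist_norm)
  qed
  then show ?thesis using that[OF k(1)] e(2) by blast
qed

text \<open>Half of the Lebesgue differentiation theorem along a grid.  Cover the set where the
  conclusion fails by maximal cells inside an open set of almost the same measure.\<close>

lemma AE_le_of_cell_averages:
  fixes h :: "real ^ 'n \<Rightarrow> ennreal"
  assumes [measurable]: "h \<in> borel_measurable lebesgue" and c: "c < top"
  shows "AE x in lebesgue.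
    (\<forall>k\<le>K. (\<integral>\<^sup>+y\<in>cell a (index a k x). h y \<partial>lebesgue) \<le> c * emeasure lebesgue (cell a (index a k x)))
      \<longrightarrow> h x \<le> c"
proof -
  define Bad where "Bad = {p. fst p \<le> K \<and>
    \<not> (\<integral>\<^sup>+y\<in>cell a p. h y \<partial>lebesgue) \<le> c * emeasure lebesgue (cell a p)}"
  \<comment> \<open>Describing the set by cells makes it measurable, and every cell of generation at
    most \<open>K\<close> that meets it has an average of at most \<open>c\<close>.\<close>
  define N where "N = - \<Union> (cell a ` Bad)"
  have [measurable]: "N \<in> sets lebesgue"
    unfolding N_def using measurable_Union_cells by (metis Compl_in_sets_lebesgue)
  have N_iff: "x \<in> N \<longleftrightarrow> (\<forall>k\<le>K. (\<integral>\<^sup>+y\<in>cell a (index a k x). h y \<partial>lebesgue)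
      \<le> c * emeasure lebesgue (cell a (index a k x)))" for x
  proof -
    have "x \<in> \<Union> (cell a ` Bad) \<longleftrightarrow> (\<exists>k. index a k x \<in> Bad)"
      by (metis UN_E UN_I cell_index_eq mem_cell_index)
    then show ?thesis unfolding N_def Bad_def by auto
  qed
  let ?\<nu> = "density lebesgue h"
  have "AE x in lebesgue. x \<in> N \<inter> ball 0 (real n) \<longrightarrow> h x \<le> c" for n :: nat
  proof -
    \<comment> \<open>The ball keeps the measure finite, as the strict comparison of integrals below
      requires.\<close>
    define M where "M = N \<inter> ball 0 (real n) \<inter> {x. c < h x}"
    have [measurable]: "M \<in> sets lebesgue"
    proof -
      have "{x \<in> space lebesgue. c < h x} \<in> sets lebesgue" by measurable
      then show ?thesis unfolding M_def by (intro sets.Int) auto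
    qed
    have fin: "emeasure lebesgue M < \<infinity>"
    proof -
      have "emeasure lebesgue M \<le> emeasure lebesgue (ball 0 (real n) :: (real ^ 'n) set)"
        by (rule emeasure_mono) (auto simp: M_def)
      also have "\<dots> < \<infinity>"
        using emeasure_lborel_ball_finite[of 0 "real n"] by (simp add: emeasure_completion less_top)
      finally show ?thesis .
    qed
    have approx: "emeasure ?\<nu> M \<le> c * emeasure lebesgue M + ennreal e" if "e > 0" for e
    proof -
      \<comment> \<open>Small enough that \<open>c * e'\<close> stays below \<open>e\<close>; the
        added 1 covers \<open>c = 0\<close>.\<close>
      define e' where "e' = e / (enn2real c + 1)"
      have e': "e' > 0" using that by (simp add: e'_def add_nonneg_pos)
      obtain U where U: "open U" "M \<subseteq> U" "emeasure lebesgue (U - M) < ennreal e'" "U - M \<in> lmeasurable"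
        using sets_lebesgue_outer_open[OF _ e'] \<open>M \<in> sets lebesgue\<close> by metis
      have [measurable]: "U \<in> sets lebesgue" using U(1) by auto
      define A where "A = {p. fst p \<le> K \<and> cell a p \<subseteq> U \<and> cell a p \<inter> N \<noteq> {}}"
      have Mc: "M \<subseteq> \<Union> (cell a ` A)"
      proof
        fix x assume x: "x \<in> M"
        obtain k where "k \<le> K" "cell a (index a k x) \<subseteq> U" using small_cell_in_open U x by blast
        moreover have "x \<in> cell a (index a k x) \<inter> N" using x by (simp add: M_def)
        ultimately have "index a k x \<in> A" unfolding A_def by (metis (mono_tags, lifting) emptyE fst_index mem_Collect_eq)
        then show "x \<in> \<Union> (cell a ` A)" by (metis UN_I mem_cell_index)
      qed
      have eq: "\<Union> (cell a ` maximal_cells a A) = \<Union> (cell a ` A)"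
        by (rule Union_maximal_cells[of _ K]) (auto simp: A_def)
      have "1 * emeasure ?\<nu> (\<Union> (cell a ` maximal_cells a A))
          \<le> c * emeasure lebesgue (\<Union> (cell a ` maximal_cells a A))"
      proof (rule emeasure_UN_mono_disjoint)
        fix p assume "p \<in> maximal_cells a A"
        then have "p \<in> A" using maximal_cells_subset by blast
        then obtain x where x: "x \<in> cell a p" "x \<in> N" "fst p \<le> K" by (auto simp: A_def)
        then have "index a (fst p) x = p" by (simp add: cell_def)
        then show "1 * emeasure ?\<nu> (cell a p) \<le> c * emeasure lebesgue (cell a p)"
          using x N_iff by (subst emeasure_density) auto
      qed (auto simp: maximal_cells_disjoint)
      also have "\<dots> \<le> c * emeasure lebesgue U"
        unfolding eq by (intro mult_left_mono emeasure_mono) (auto simp: A_def)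
      also have "emeasure lebesgue U = emeasure lebesgue M + emeasure lebesgue (U - M)"
        using U(2) by (subst plus_emeasure) (auto simp: Un_absorb1)
      also have "c * \<dots> \<le> c * emeasure lebesgue M + c * ennreal e'"
        using U(3) by (simp add: distrib_left mult_left_mono)
      also have "c * ennreal e' \<le> ennreal e"
      proof -
        have "c = ennreal (enn2real c)" using c by simp
        then have "c * ennreal e' = ennreal (enn2real c * e')"
          by (metis e' enn2real_nonneg ennreal_mult less_imp_le)
        also have "enn2real c * e' \<le> (enn2real c + 1) * e'" using e' by (simp add: distrib_right)
        also have "(enn2real c + 1) * e' = e"
          unfolding e'_def using enn2real_nonneg[of c] by (simp add: add_nonneg_pos less_imp_neq[symmetric])
        finally show ?thesis by (simp add: ennreal_leI)
      qed
      finally have "emeasure ?\<nu> (\<Union> (cell a ` A)) \<le> c * emeasure lebesgue M + ennreal e"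
        unfolding eq by simp
      moreover have "emeasure ?\<nu> M \<le> emeasure ?\<nu> (\<Union> (cell a ` A))"
        using Mc measurable_Union_cells by (intro emeasure_mono) auto
      ultimately show ?thesis by (rule order_trans[rotated])
    qed
    have le: "emeasure ?\<nu> M \<le> c * emeasure lebesgue M"
      by (rule ennreal_le_epsilon) (rule approx)
    \<comment> \<open>Since \<open>c < h\<close> on \<open>M\<close>, a set \<open>M\<close> of
      positive measure would make the integral of \<open>h\<close> over it strictly larger than
      \<open>c\<close> times its measure, against \<open>le\<close>.\<close>
    have "AE x in lebesgue. h x * indicator M x \<le> c * indicator M x"
    proof (rule ccontr)
      assume neg: "\<not> ?thesis"
      have "(\<integral>\<^sup>+x. c * indicator M x \<partial>lebesgue) < (\<integral>\<^sup>+x. h x * indicator M x \<partial>lebesgue)"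
      proof (rule nn_integral_less)
        show "(\<integral>\<^sup>+x. c * indicator M x \<partial>lebesgue) \<noteq> \<infinity>"
          using c fin by (simp add: nn_integral_cmult_indicator ennreal_mult_eq_top_iff less_top)
        show "AE x in lebesgue. c * indicator M x \<le> h x * indicator M x"
          by (rule AE_I2) (auto simp: M_def indicator_def)
      qed (use neg in auto)
      then show False using le by (simp add: nn_integral_cmult_indicator emeasure_density)
    qed
    then show ?thesis
      by eventually_elim (auto simp: M_def indicator_def not_less[symmetric])
  qed
  then have "AE x in lebesgue. \<forall>n::nat. x \<in> N \<inter> ball 0 (real n) \<longrightarrow> h x \<le> c"
    unfolding AE_all_countable by blast
  then show ?thesis
  proof eventually_elim
    case (elim x)
    show ?case
    proof
      assume "\<forall>k\<le>K. (\<integral>\<^sup>+y\<in>cell a (index a k x). h y \<partial>lebesgue) \<le> c * emeasure lebesgue (cell a (index a k x))"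
      then have "x \<in> N" using N_iff by blast
      moreover obtain n :: nat where "norm x < real n" using reals_Archimedean2 by blast
      ultimately show "h x \<le> c" using elim by auto
    qed
  qed
qed

section \<open>Dyadic maximal function and selection of stopping cells\<close>

lemma parent_cell:
  fixes p :: "int \<times> ('n \<Rightarrow> int)"
  obtains q where "cell a p \<subseteq> cell a q" "fst q = fst p + 1" "vol q = 2 ^ CARD('n) * vol p"
proof -
  obtain x where x: "x \<in> cell a p" using cell_nonempty by blast
  let ?q = "index a (fst p + 1) x"
  have "cell a p \<subseteq> cell a ?q" using x by (intro cell_subset) auto
  moreover have "vol ?q = 2 ^ CARD('n) * vol p"
    by (simp add: vol_def power_int_add power_mult_distrib mult.commute)
  ultimately show ?thesis using that[of ?q] by simp
qed

text \<open>Source of the factors \<open>2 ^ CARD('n)\<close>: a maximal cell is controlled by its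
  parent, which fails the selection condition and is larger by this factor.\<close>

lemma parent_not_in_of_maximal:
  assumes "p \<in> maximal_cells a A" "cell a p \<subseteq> cell a q" "fst q = fst p + 1"
  shows "q \<notin> A"
  using assms by (auto simp: maximal_cells_def)

text \<open>The union of these cells is the set where the dyadic maximal function of
  \<open>h\<close> exceeds \<open>t\<close>.\<close>

definition heavy :: "(real ^ 'n \<Rightarrow> ennreal) \<Rightarrow> ennreal \<Rightarrow> (int \<times> ('n \<Rightarrow> int)) set" where
  "heavy h t = {p. t * emeasure lebesgue (cell a p) < (\<integral>\<^sup>+y\<in>cell a p. h y \<partial>lebesgue)}"

text \<open>A cell of measure above \<open>I / t\<close>, with \<open>I\<close> the total mass,
  cannot have an average above \<open>t\<close>. The bound is what makes maximal heavy cells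
  exist.\<close>

lemma heavy_level_bound:
  assumes "(\<integral>\<^sup>+y. h y \<partial>lebesgue) < \<infinity>" "t > 0"
  obtains K where "\<And>p. p \<in> heavy h (ennreal t) \<Longrightarrow> fst p \<le> K"
proof -
  obtain I where I: "(\<integral>\<^sup>+y. h y \<partial>lebesgue) = ennreal I" "I \<ge> 0"
    using assms(1) by (cases "\<integral>\<^sup>+y. h y \<partial>lebesgue") auto
  obtain n :: nat where n: "I / t < 2 ^ n" using real_arch_pow[of 2 "I/t"] by auto
  have "fst p \<le> int n" if p: "p \<in> heavy h (ennreal t)" for p
  proof (rule ccontr)
    assume "\<not> fst p \<le> int n"
    then have "(2::real) ^ n \<le> 2 powi fst p"
      using power_int_increasing[of "int n" "fst p" "2::real"] by simp
    moreover from this have "2 powi fst p \<le> vol p"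
      unfolding vol_def by (intro self_le_power) (auto intro: order_trans[OF one_le_power[of 2 n]])
    ultimately have "2 ^ n \<le> vol p" by linarith
    then have "I < t * vol p" using n assms(2) by (simp add: field_simps) (smt (verit) mult_left_mono)
    moreover have "ennreal (t * vol p) < ennreal I"
    proof -
      have "ennreal (t * vol p) < (\<integral>\<^sup>+y\<in>cell a p. h y \<partial>lebesgue)"
        using p assms(2) by (simp add: heavy_def emeasure_cell ennreal_mult)
      also have "\<dots> \<le> ennreal I"
        unfolding I(1)[symmetric] by (rule nn_integral_mono) (auto simp: indicator_def)
      finally show ?thesis .
    qed
    ultimately show False using I(2) by (auto simp: ennreal_less_iff)
  qed
  then show ?thesis using that by blast
qed

text \<open>Weak type (1,1) of the dyadic maximal function with constant 1: the maximal heavy cells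
  are disjoint, cover all heavy cells, and each carries mass at least \<open>t\<close> times its
  measure.\<close>

lemma emeasure_heavy:
  assumes [measurable]: "h \<in> borel_measurable lebesgue"
    and fin: "(\<integral>\<^sup>+y. h y \<partial>lebesgue) < \<infinity>" "t > 0"
  shows "ennreal t * emeasure lebesgue (\<Union> (cell a ` heavy h (ennreal t))) \<le> (\<integral>\<^sup>+y. h y \<partial>lebesgue)"
proof -
  let ?A = "heavy h (ennreal t)"
  obtain K where "\<And>p. p \<in> ?A \<Longrightarrow> fst p \<le> K" using heavy_level_bound fin by blast
  then have eq: "\<Union> (cell a ` maximal_cells a ?A) = \<Union> (cell a ` ?A)" by (rule Union_maximal_cells)
  have "ennreal t * emeasure lebesgue (\<Union> (cell a ` maximal_cells a ?A))
      \<le> 1 * emeasure (density lebesgue h) (\<Union> (cell a ` maximal_cells a ?A))"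
  proof (rule emeasure_UN_mono_disjoint)
    fix p assume "p \<in> maximal_cells a ?A"
    then have "p \<in> ?A" using maximal_cells_subset by blast
    then show "ennreal t * emeasure lebesgue (cell a p) \<le> 1 * emeasure (density lebesgue h) (cell a p)"
      by (subst emeasure_density) (auto simp: heavy_def)
  qed (auto simp: maximal_cells_disjoint)
  also have "\<dots> \<le> (\<integral>\<^sup>+y. h y \<partial>lebesgue)"
    using measurable_Union_cells
    by (subst emeasure_density) (auto intro!: nn_integral_mono simp: indicator_def)
  finally show ?thesis unfolding eq .
qed

text \<open>The children are the maximal subcells in which \<open>B\<close> has a share above
  \<beta>. Their total measure is at most that of \<open>B\<close> inside \<open>p\<close> divided
  by \<beta>, which is half of \<open>vol p\<close>. The parent of a child was not selected, so the
  share of \<open>B\<close> in the child is at most \<open>2 ^ CARD('n) * \<beta> = 1 / 2\<close>.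
  Off the children all shares are at most \<beta>, so almost no point of \<open>B\<close>
  remains.\<close>

lemma stopping_cells:
  fixes p :: "int \<times> ('n \<Rightarrow> int)"
  defines "\<beta> \<equiv> (1 / 2) ^ (CARD('n) + 1) :: real"
  assumes [measurable]: "B \<in> sets lebesgue"
    and small: "emeasure lebesgue (B \<inter> cell a p) \<le> ennreal (\<beta> / 2 * vol p)"
  obtains ch where "\<And>q. q \<in> ch \<Longrightarrow> fst q < fst p \<and> cell a q \<subseteq> cell a p"
    "disjoint_family_on (cell a) ch"
    "emeasure lebesgue (\<Union> (cell a ` ch)) \<le> ennreal (vol p / 2)"
    "\<And>q. q \<in> ch \<Longrightarrow> emeasure lebesgue (B \<inter> cell a q) \<le> ennreal (vol q / 2)"
    "AE x in lebesgue. x \<in> cell a p - \<Union> (cell a ` ch) \<longrightarrow> x \<notin> B"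
proof -
  have \<beta>: "\<beta> > 0" "\<beta> < 1" unfolding \<beta>_def using power_strict_decreasing[of 0 "CARD('n) + 1" "1 / 2 :: real"] by auto
  define A where "A = {q. cell a q \<subseteq> cell a p \<and> ennreal (\<beta> * vol q) < emeasure lebesgue (B \<inter> cell a q)}"
  define ch where "ch = maximal_cells a A"
  have pA: "p \<notin> A"
  proof
    assume "p \<in> A"
    then have "ennreal (\<beta> * vol p) < ennreal (\<beta> / 2 * vol p)" using small by (auto simp: A_def)
    then show False using \<beta> by (simp add: ennreal_less_iff mult_less_0_iff)
  qed
  have chA: "ch \<subseteq> A" by (auto simp: ch_def maximal_cells_def)
  have lev: "fst q < fst p" "cell a q \<subset> cell a p" if "q \<in> A" for q
  proof -
    have "cell a q \<noteq> cell a p" using pA that inj_cell[of a] by (metis injD)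
    then show "cell a q \<subset> cell a p" using that by (auto simp: A_def)
    then show "fst q < fst p" by (rule psubset_level)
  qed
  have eq: "\<Union> (cell a ` ch) = \<Union> (cell a ` A)"
    unfolding ch_def by (rule Union_maximal_cells[of _ "fst p"]) (use lev in fastforce)
  have disj: "disjoint_family_on (cell a) ch" unfolding ch_def by (rule maximal_cells_disjoint)
  show ?thesis
  proof (rule that)
    show "fst q < fst p \<and> cell a q \<subseteq> cell a p" if "q \<in> ch" for q using lev that chA by blast
    show "disjoint_family_on (cell a) ch" by (rule disj)
    have "ennreal \<beta> * emeasure lebesgue (\<Union> (cell a ` ch)) \<le> 1 * emeasure (density lebesgue (indicator B)) (\<Union> (cell a ` ch))"
    proof (rule emeasure_UN_mono_disjoint)
      fix q assume "q \<in> ch"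
      then have "q \<in> A" using chA by blast
      then have "ennreal (\<beta> * vol q) \<le> emeasure lebesgue (B \<inter> cell a q)" by (simp add: A_def less_imp_le)
      moreover have "ennreal (\<beta> * vol q) = ennreal \<beta> * emeasure lebesgue (cell a q)"
        using \<beta> by (simp add: emeasure_cell ennreal_mult)
      moreover have "emeasure (density lebesgue (indicator B)) (cell a q) = emeasure lebesgue (B \<inter> cell a q)"
        by (rule emeasure_restricted) auto
      ultimately show "ennreal \<beta> * emeasure lebesgue (cell a q) \<le> 1 * emeasure (density lebesgue (indicator B)) (cell a q)"
        by simp
    qed (use disj in auto)
    also have "\<dots> = emeasure lebesgue (B \<inter> \<Union> (cell a ` ch))"
      using measurable_Union_cells by (simp add: emeasure_restricted)
    also have "\<dots> \<le> emeasure lebesgue (B \<inter> cell a p)"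
    proof (rule emeasure_mono)
      have "\<Union> (cell a ` ch) \<subseteq> cell a p" using chA lev by blast
      then show "B \<inter> \<Union> (cell a ` ch) \<subseteq> B \<inter> cell a p" by blast
    qed auto
    also have "\<dots> \<le> ennreal \<beta> * ennreal (vol p / 2)"
      using small \<beta> by (simp add: ennreal_mult'[symmetric])
    finally show "emeasure lebesgue (\<Union> (cell a ` ch)) \<le> ennreal (vol p / 2)"
      using \<beta> by (subst (asm) ennreal_mult_le_mult_iff) auto
    show "emeasure lebesgue (B \<inter> cell a q) \<le> ennreal (vol q / 2)" if q: "q \<in> ch" for q
    proof -
      obtain r where r: "cell a q \<subseteq> cell a r" "fst r = fst q + 1" "vol r = 2 ^ CARD('n) * vol q"
        by (rule parent_cell)
      have "r \<notin> A" using parent_not_in_of_maximal[of q A r] q r by (simp add: ch_def)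
      \<comment> \<open>As \<open>q\<close> is strictly finer than \<open>p\<close>, its parent
        still lies inside \<open>p\<close> and was a candidate for selection.\<close>
      moreover have "cell a r \<subseteq> cell a p"
      proof -
        obtain x where "x \<in> cell a q" using cell_nonempty by blast
        moreover have "fst q < fst p" "cell a q \<subseteq> cell a p" using lev q chA by blast+
        ultimately show ?thesis using r by (intro cell_subset[of x]) auto
      qed
      ultimately have "emeasure lebesgue (B \<inter> cell a r) \<le> ennreal (\<beta> * vol r)" by (auto simp: A_def)
      also have "\<beta> * vol r = vol q / 2" unfolding r(3) \<beta>_def by (simp add: power_one_over)
      finally show ?thesis
        using r(1) by (elim order_trans[rotated]) (auto intro!: emeasure_mono)
    qed
    \<comment> \<open>Differentiation for the indicator of \<open>B\<close>: where all averages are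
      at most \<open>\<beta> < 1\<close>, the indicator is below 1 and hence 0.\<close>
    have "AE x in lebesgue. (\<forall>k\<le>fst p. (\<integral>\<^sup>+y\<in>cell a (index a k x). indicator B y \<partial>lebesgue)
        \<le> ennreal \<beta> * emeasure lebesgue (cell a (index a k x))) \<longrightarrow> indicator B x \<le> ennreal \<beta>"
      by (rule AE_le_of_cell_averages) auto
    then show "AE x in lebesgue. x \<in> cell a p - \<Union> (cell a ` ch) \<longrightarrow> x \<notin> B"
    proof eventually_elim
      case (elim x)
      show ?case
      proof (intro impI notI)
        assume x: "x \<in> cell a p - \<Union> (cell a ` ch)" "x \<in> B"
        have "(\<integral>\<^sup>+y\<in>cell a (index a k x). indicator B y \<partial>lebesgue)
            \<le> ennreal \<beta> * emeasure lebesgue (cell a (index a k x))" if "k \<le> fst p" for k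
        proof -
          have "cell a (index a k x) \<subseteq> cell a p" using x that by (intro cell_subset[of x]) auto
          moreover have "index a k x \<notin> A" using x unfolding eq by (metis DiffD2 UN_I mem_cell_index)
          ultimately have "emeasure lebesgue (B \<inter> cell a (index a k x)) \<le> ennreal (\<beta> * vol (index a k x))"
            by (auto simp: A_def)
          moreover have "(\<integral>\<^sup>+y\<in>cell a (index a k x). indicator B y \<partial>lebesgue)
              = emeasure lebesgue (B \<inter> cell a (index a k x))"
            unfolding indicator_inter_arith[symmetric] by (rule nn_integral_indicator) auto
          ultimately show ?thesis using \<beta> by (simp add: emeasure_cell ennreal_mult')
        qed
        then have "(1::ennreal) \<le> ennreal \<beta>" using elim x by auto
        then show False using \<beta> by (metis ennreal_1 ennreal_le_iff2 less_le_not_le not_less one_le_numeral zero_less_one)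
      qed
    qed
  qed
qed

end

section \<open>Stopping time trees\<close>

lemma summable_on_ennreal_any [simp]: "f summable_on A" for f :: "'a \<Rightarrow> ennreal"
  by (rule nonneg_summable_on_complete) simp

lemma infsum_ennreal_mono:
  fixes f g :: "'a \<Rightarrow> ennreal"
  assumes "\<And>x. x \<in> A \<Longrightarrow> f x \<noteq> 0 \<Longrightarrow> x \<in> B \<and> f x \<le> g x"
  shows "infsum f A \<le> infsum g B"
proof (rule infsum_mono_neutral)
  show "f x \<le> g x" if "x \<in> A \<inter> B" for x using assms[of x] that by (cases "f x = 0") auto
  show "f x \<le> 0" if "x \<in> A - B" for x using assms[of x] that by auto
qed auto

lemma infsum_ennreal_cmult_le:
  fixes f :: "'a \<Rightarrow> ennreal"
  shows "(\<Sum>\<^sub>\<infinity>x\<in>A. c * f x) \<le> c * infsum f A"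
proof (rule infsum_le_finite_sums)
  fix F assume F: "finite F" "F \<subseteq> A"
  have "(\<Sum>x\<in>F. c * f x) = c * infsum f F" using F by (simp add: sum_distrib_left)
  also have "\<dots> \<le> c * infsum f A" using F by (intro mult_left_mono infsum_ennreal_mono) auto
  finally show "(\<Sum>x\<in>F. c * f x) \<le> c * infsum f A" .
qed simp

context grid
begin

text \<open>The families \<open>ch p\<close> halve the measure, so almost every point leaves the tree after finitely
  many generations and the estimate for \<open>u\<close> can be iterated to its end.\<close>

lemma stopping_tree:
  fixes u :: "int \<times> ('n \<Rightarrow> int) \<Rightarrow> real ^ 'n \<Rightarrow> ennreal" and c :: "int \<times> ('n \<Rightarrow> int) \<Rightarrow> ennreal"
  assumes roots: "R \<subseteq> U" "disjoint_family_on (cell a) R" "emeasure lebesgue (\<Union> (cell a ` R)) < \<infinity>"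
    and ch_U: "\<And>p. p \<in> U \<Longrightarrow> ch p \<subseteq> U"
    and ch_sub: "\<And>p q. p \<in> U \<Longrightarrow> q \<in> ch p \<Longrightarrow> cell a q \<subseteq> cell a p"
    and ch_level: "\<And>p q. p \<in> U \<Longrightarrow> q \<in> ch p \<Longrightarrow> fst q < fst p"
    and ch_disj: "\<And>p. p \<in> U \<Longrightarrow> disjoint_family_on (cell a) (ch p)"
    and ch_half: "\<And>p. p \<in> U \<Longrightarrow> emeasure lebesgue (\<Union> (cell a ` ch p)) \<le> ennreal (vol p / 2)"
    and est: "AE x in lebesgue. \<forall>p\<in>U. x \<in> cell a p \<longrightarrow>
      ((\<forall>q\<in>ch p. x \<notin> cell a q) \<longrightarrow> u p x \<le> c p) \<and> (\<forall>q\<in>ch p. x \<in> cell a q \<longrightarrow> u p x \<le> c p + u q x)"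
  obtains F E where "F \<subseteq> U"
    "\<And>p. p \<in> F \<Longrightarrow> E p \<in> sets lebesgue \<and> E p \<subseteq> cell a p \<and> vol p / 2 \<le> measure lebesgue (E p)"
    "disjoint_family_on E F"
    "\<And>p. p \<in> F \<Longrightarrow> cell a p \<subseteq> \<Union> (cell a ` R)"
    "AE x in lebesgue. \<forall>r\<in>R. x \<in> cell a r \<longrightarrow> u r x \<le> (\<Sum>\<^sub>\<infinity>p\<in>F. c p * indicator (cell a p) x)"
proof -
  define gen where "gen n = ((\<lambda>A. \<Union> (ch ` A)) ^^ n) R" for n
  have gen_0: "gen 0 = R" and gen_Suc: "gen (Suc n) = \<Union> (ch ` gen n)" for n
    by (simp_all add: gen_def)
  define F where "F = (\<Union>n. gen n)"
  \<comment> \<open>The part of a cell that no child covers; by \<open>ch_half\<close> at least half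
    of it.\<close>
  define E where "E p = cell a p - \<Union> (cell a ` ch p)" for p
  define V where "V n = \<Union> (cell a ` gen n)" for n
  have gen_U: "gen n \<subseteq> U" for n
  proof (induction n)
    case (Suc n)
    then show ?case unfolding gen_Suc using ch_U by blast
  qed (use roots gen_0 in auto)
  have gen_disj: "disjoint_family_on (cell a) (gen n)" for n
  proof (induction n)
    case (Suc n)
    show ?case unfolding disjoint_family_on_def
    proof (intro ballI impI)
      fix p q assume "p \<in> gen (Suc n)" "q \<in> gen (Suc n)" and pq: "p \<noteq> q"
      then obtain p' q' where p': "p' \<in> gen n" "p \<in> ch p'" and q': "q' \<in> gen n" "q \<in> ch q'"
        unfolding gen_Suc by blast
      show "cell a p \<inter> cell a q = {}"
      proof (cases "p' = q'")
        case True
        then show ?thesis using ch_disj[of p'] p' q' pq gen_U[of n]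
          unfolding disjoint_family_on_def by blast
      next
        case False
        then have "cell a p' \<inter> cell a q' = {}" using Suc p' q' unfolding disjoint_family_on_def by blast
        moreover have "cell a p \<subseteq> cell a p'" "cell a q \<subseteq> cell a q'"
          using p' q' gen_U[of n] ch_sub by blast+
        ultimately show ?thesis by blast
      qed
    qed
  qed (use roots gen_0 in auto)
  have V_sets [measurable]: "V n \<in> sets lebesgue" for n
    unfolding V_def by (rule measurable_Union_cells)
  have V_Suc: "2 * emeasure lebesgue (V (Suc n)) \<le> emeasure lebesgue (V n)" for n
  proof -
    let ?Y = "\<lambda>p. \<Union> (cell a ` ch p)"
    have Y_sub: "?Y p \<subseteq> cell a p" if "p \<in> gen n" for p using that gen_U[of n] ch_sub by blast
    have disjY: "disjoint_family_on ?Y (gen n)"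
      unfolding disjoint_family_on_def
    proof (intro ballI impI)
      fix p q assume *: "p \<in> gen n" "q \<in> gen n" "p \<noteq> q"
      then have "cell a p \<inter> cell a q = {}" using gen_disj[of n] by (auto simp: disjoint_family_on_def)
      then show "?Y p \<inter> ?Y q = {}" using Y_sub[OF *(1)] Y_sub[OF *(2)] by blast
    qed
    have VY: "V (Suc n) = \<Union> (?Y ` gen n)" unfolding V_def gen_Suc by blast
    have "2 * emeasure lebesgue (V (Suc n)) = (\<integral>\<^sup>+p. 2 * emeasure lebesgue (?Y p) \<partial>count_space (gen n))"
      unfolding VY using disjY measurable_Union_cells
      by (subst emeasure_UN_countable) (auto simp: nn_integral_cmult)
    also have "\<dots> \<le> (\<integral>\<^sup>+p. emeasure lebesgue (cell a p) \<partial>count_space (gen n))"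
    proof (rule nn_integral_mono)
      fix p assume "p \<in> space (count_space (gen n))"
      then have "p \<in> U" using gen_U[of n] by auto
      then have "2 * emeasure lebesgue (?Y p) \<le> 2 * ennreal (vol p / 2)"
        by (intro mult_left_mono ch_half) auto
      also have "\<dots> = emeasure lebesgue (cell a p)"
        unfolding emeasure_cell ennreal_numeral[symmetric] by (subst ennreal_mult[symmetric]) auto
      finally show "2 * emeasure lebesgue (?Y p) \<le> emeasure lebesgue (cell a p)" .
    qed
    also have "\<dots> = emeasure lebesgue (V n)"
      unfolding V_def using gen_disj[of n] by (subst emeasure_UN_countable) auto
    finally show ?thesis .
  qed
  define m where "m = enn2real (emeasure lebesgue (V 0))"
  have m: "emeasure lebesgue (V 0) = ennreal m" "m \<ge> 0"
    using roots(3) by (auto simp: m_def V_def gen_0)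
  have V_le: "emeasure lebesgue (V n) \<le> ennreal ((1 / 2) ^ n * m)" for n
  proof (induction n)
    case (Suc n)
    have "2 * emeasure lebesgue (V (Suc n)) \<le> ennreal ((1 / 2) ^ n * m)" using V_Suc Suc by (rule order_trans)
    also have "\<dots> = 2 * ennreal ((1 / 2) ^ Suc n * m)"
      unfolding ennreal_numeral[symmetric] using m(2) by (subst ennreal_mult[symmetric]) auto
    finally show ?case by (subst (asm) ennreal_mult_le_mult_iff) auto
  qed (use m in simp)
  have escape: "AE x in lebesgue. \<exists>n. x \<notin> V n"
  proof -
    have "emeasure lebesgue (\<Inter>n. V n) \<le> 0"
    proof (rule LIMSEQ_le_const)
      have "(\<lambda>n. ennreal ((1 / 2) ^ n * m)) \<longlonglongrightarrow> ennreal (0 * m)"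
        by (intro tendsto_ennrealI tendsto_mult tendsto_const LIMSEQ_realpow_zero) auto
      then show "(\<lambda>n. ennreal ((1 / 2) ^ n * m)) \<longlonglongrightarrow> 0" by simp
      have "emeasure lebesgue (\<Inter>n. V n) \<le> ennreal ((1 / 2) ^ n * m)" for n
        by (rule order_trans[OF emeasure_mono V_le]) auto
      then show "\<exists>N. \<forall>n\<ge>N. emeasure lebesgue (\<Inter>n. V n) \<le> ennreal ((1 / 2) ^ n * m)" by blast
    qed
    then have "(\<Inter>n. V n) \<in> null_sets lebesgue" by (intro null_setsI) auto
    then show ?thesis by (rule AE_I') auto
  qed
  \<comment> \<open>A cell of a later generation is traced back to generation \<open>i\<close>; if
    it is strictly later, the point also lies in a child of the cell found there.\<close>
  have chain: "\<exists>p\<in>gen i. x \<in> cell a p \<and> (j > 0 \<longrightarrow> x \<in> \<Union> (cell a ` ch p))"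
    if "q \<in> gen (i + j)" "x \<in> cell a q" for i j q x
    using that
  proof (induction j arbitrary: q)
    case (Suc j)
    then obtain q' where q': "q' \<in> gen (i + j)" "q \<in> ch q'" by (auto simp: gen_Suc)
    then have "x \<in> cell a q'" using Suc.prems gen_U[of "i + j"] ch_sub by blast
    then obtain p where p: "p \<in> gen i" "x \<in> cell a p" "j > 0 \<longrightarrow> x \<in> \<Union> (cell a ` ch p)"
      using Suc.IH q' by blast
    have "x \<in> \<Union> (cell a ` ch p)"
    proof (cases "j > 0")
      case False
      then have "p = q'" using p q' \<open>x \<in> cell a q'\<close> gen_disj[of i] by (auto simp: disjoint_family_on_def)
      then show ?thesis using q' Suc.prems by blast
    qed (use p in blast)
    then show ?case using p by blast
  qed auto
  \<comment> \<open>A point of \<open>E p\<close> lies in no child of \<open>p\<close> and so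
    reaches no later generation. This is the disjointness of the sets \<open>E p\<close>.\<close>
  have key: "p = q" if h: "p \<in> gen i" "q \<in> gen (i + j)" "x \<in> E p" "x \<in> cell a q" for p q i j x
  proof -
    obtain p' where p': "p' \<in> gen i" "x \<in> cell a p'" "j > 0 \<longrightarrow> x \<in> \<Union> (cell a ` ch p')"
      using chain[OF h(2,4)] by blast
    have "x \<in> cell a p" using h by (simp add: E_def)
    then have "p' = p" using p' h gen_disj[of i] by (auto simp: disjoint_family_on_def)
    then have "j = 0" using p' h by (auto simp: E_def)
    then show ?thesis using h gen_disj[of i] \<open>x \<in> cell a p\<close> by (auto simp: disjoint_family_on_def)
  qed
  show ?thesis
  proof (rule that[of F E])
    show "F \<subseteq> U" using gen_U by (auto simp: F_def)
    then show "E p \<in> sets lebesgue \<and> E p \<subseteq> cell a p \<and> vol p / 2 \<le> measure lebesgue (E p)" if "p \<in> F" for p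
    proof -
      have pU: "p \<in> U" using that \<open>F \<subseteq> U\<close> by blast
      have sub: "\<Union> (cell a ` ch p) \<subseteq> cell a p" using ch_sub[OF pU] by blast
      have fm: "cell a p \<in> lmeasurable" by (simp add: fmeasurable_def emeasure_cell)
      have "\<Union> (cell a ` ch p) \<in> lmeasurable"
        using fm sub measurable_Union_cells by (rule fmeasurableI2)
      then have "measure lebesgue (E p) = vol p - measure lebesgue (\<Union> (cell a ` ch p))"
        unfolding E_def measure_cell[of a p, symmetric]
        by (intro measurable_measure_Diff fm sub measurable_Union_cells)
      moreover have "measure lebesgue (\<Union> (cell a ` ch p)) \<le> vol p / 2"
        unfolding measure_def using ch_half[OF pU] by (intro enn2real_leI) auto
      ultimately show ?thesis using measurable_Union_cells by (auto simp: E_def)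
    qed
    show "disjoint_family_on E F"
      unfolding disjoint_family_on_def
    proof (intro ballI impI)
      fix p q assume "p \<in> F" "q \<in> F" and pq: "p \<noteq> q"
      then obtain i j where ij: "p \<in> gen i" "q \<in> gen j" by (auto simp: F_def)
      have "False" if x: "x \<in> E p" "x \<in> E q" for x
      proof (cases "i \<le> j")
        case True
        then show False using key[of p i q "j - i" x] ij x pq by (auto simp: E_def)
      next
        case False
        then show False using key[of q j p "i - j" x] ij x pq by (auto simp: E_def)
      qed
      then show "E p \<inter> E q = {}" by blast
    qed
    show "cell a p \<subseteq> \<Union> (cell a ` R)" if p: "p \<in> F" for p
    proof
      fix x assume x: "x \<in> cell a p"
      obtain n where "p \<in> gen (0 + n)" using p by (auto simp: F_def)
      then show "x \<in> \<Union> (cell a ` R)" using chain x gen_0 by blast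
    qed
    show "AE x in lebesgue. \<forall>r\<in>R. x \<in> cell a r \<longrightarrow> u r x \<le> (\<Sum>\<^sub>\<infinity>p\<in>F. c p * indicator (cell a p) x)"
      using est escape
    proof eventually_elim
      case (elim x)
      \<comment> \<open>Restricting the sum to cells below \<open>p\<close> lets the induction add
        the term \<open>c p\<close> without counting it twice: a child is strictly finer and cannot
        contain \<open>p\<close>.\<close>
      define S where "S p = (\<Sum>\<^sub>\<infinity>q | q \<in> F \<and> cell a q \<subseteq> cell a p. c q * indicator (cell a q) x)" for p
      obtain N where N: "x \<notin> V N" using elim by blast
      \<comment> \<open>The induction starts at generation \<open>N\<close>, which \<open>x\<close>
        has left, and works back to the roots.\<close>
      have "u p x \<le> S p" if "p \<in> gen (N - m)" "m \<le> N" "x \<in> cell a p" for p m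
        using that
      proof (induction m arbitrary: p)
        case 0
        then show ?case using N by (auto simp: V_def)
      next
        case (Suc m)
        have pU: "p \<in> U" using Suc.prems gen_U by blast
        have pF: "p \<in> F" using Suc.prems by (auto simp: F_def)
        have single: "infsum (\<lambda>q. c q * indicator (cell a q) x) {p} = c p" using Suc.prems by simp
        show ?case
        proof (cases "\<exists>q\<in>ch p. x \<in> cell a q")
          case True
          then obtain q where q: "q \<in> ch p" "x \<in> cell a q" by blast
          then have "q \<in> gen (Suc (N - Suc m))" unfolding gen_Suc using Suc.prems by blast
          then have "q \<in> gen (N - m)" using Suc.prems by (simp add: Suc_diff_Suc)
          then have "u q x \<le> S q" using Suc.IH Suc.prems q by simp
          moreover have "u p x \<le> c p + u q x" using elim(1) pU q Suc.prems by blast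
          ultimately have "u p x \<le> c p + S q" by (metis add_left_mono order_trans)
          also have "\<dots> = infsum (\<lambda>q. c q * indicator (cell a q) x) ({p} \<union> {q'. q' \<in> F \<and> cell a q' \<subseteq> cell a q})"
          proof -
            have "\<not> cell a p \<subseteq> cell a q" using ch_level[OF pU q(1)] cell_subset_level by (metis not_less)
            then show ?thesis unfolding S_def
              by (subst infsum_Un_disjoint) (auto simp: single)
          qed
          also have "\<dots> \<le> S p"
            unfolding S_def using pF ch_sub[OF pU q(1)] by (intro infsum_ennreal_mono) auto
          finally show ?thesis .
        next
          case False
          then have "u p x \<le> c p" using elim(1) pU Suc.prems by blast
          also have "\<dots> = infsum (\<lambda>q. c q * indicator (cell a q) x) {p}" by (simp add: single)
          also have "\<dots> \<le> S p" unfolding S_def using pF by (intro infsum_ennreal_mono) auto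
          finally show ?thesis .
        qed
      qed
      from this[of _ N] have "u r x \<le> S r" if "r \<in> R" "x \<in> cell a r" for r using that gen_0 by simp
      moreover have "S r \<le> (\<Sum>\<^sub>\<infinity>p\<in>F. c p * indicator (cell a p) x)" for r
        unfolding S_def by (intro infsum_ennreal_mono) auto
      ultimately show ?case by (meson order_trans)
    qed
  qed
qed

end

section \<open>From Carleson families to sparse families\<close>

lemma cell_lmeasurable: "cell a p \<in> lmeasurable"
  by (simp add: fmeasurable_def emeasure_cell)

lemma set_integrable_lebesgue:
  fixes g :: "real ^ 'n \<Rightarrow> 'b::{banach,second_countable_topology}"
  shows "integrable lebesgue g \<Longrightarrow> A \<in> sets lebesgue \<Longrightarrow> set_integrable lebesgue A g"
  unfolding set_integrable_def by (rule integrable_mult_indicator)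

lemma average_nonneg: "(\<And>x. g x \<ge> 0) \<Longrightarrow> average g Q \<ge> 0"
  unfolding average_def set_lebesgue_integral_def by (intro divide_nonneg_nonneg integral_nonneg_AE) auto

lemma nn_integral_eq_average:
  assumes "integrable lebesgue g" "\<And>x. g x \<ge> 0"
  shows "(\<integral>\<^sup>+y\<in>cell a p. ennreal (g y) \<partial>lebesgue) = ennreal (average g (cell a p) * vol p)"
proof -
  have "(\<integral>\<^sup>+y\<in>cell a p. ennreal (g y) \<partial>lebesgue) = (\<integral>\<^sup>+y. ennreal (indicator (cell a p) y *\<^sub>R g y) \<partial>lebesgue)"
    by (rule nn_integral_cong) (auto simp: indicator_def)
  also have "\<dots> = ennreal (LINT y:cell a p|lebesgue. g y)"
    unfolding set_lebesgue_integral_def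
    using set_integrable_lebesgue[OF assms(1) sets_cell] assms(2)
    by (intro nn_integral_eq_integral) (auto simp: set_integrable_def)
  also have "(LINT y:cell a p|lebesgue. g y) = average g (cell a p) * vol p"
    by (simp add: average_def measure_cell)
  finally show ?thesis .
qed

context grid
begin

lemma sparse_sum_ge_card:
  assumes "finite A" "A \<subseteq> B" "\<And>q. q \<in> A \<Longrightarrow> x \<in> cell a q"
  shows "of_nat (card A) \<le> (\<integral>\<^sup>+q. indicator (cell a q) x \<partial>count_space B)"
proof -
  have "of_nat (card A) = (\<integral>\<^sup>+q. indicator A q \<partial>count_space B)"
    using assms by (subst nn_integral_count_space'[of A]) (auto simp: indicator_def)
  also have "\<dots> \<le> (\<integral>\<^sup>+q. indicator (cell a q) x \<partial>count_space B)"
    using assms by (intro nn_integral_mono) (auto simp: indicator_def)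
  finally show ?thesis .
qed

text \<open>Stop at the cells whose average has quadrupled or which lie below more than \<open>N\<close> cells of the
  family; in between the stopping cells the sum at a point has at most \<open>N\<close> comparable terms.\<close>

lemma sparse_of_carleson:
  fixes F :: "(int \<times> ('n \<Rightarrow> int)) set" and g :: "real ^ 'n \<Rightarrow> real"
  assumes g: "integrable lebesgue g" "\<And>x. g x \<ge> 0"
    and level: "\<And>p. p \<in> F \<Longrightarrow> fst p \<le> K"
    and E: "\<And>p. p \<in> F \<Longrightarrow> E p \<in> sets lebesgue \<and> E p \<subseteq> cell a p \<and> ennreal (\<eta> * vol p) \<le> emeasure lebesgue (E p)"
    and E_disj: "disjoint_family_on E F"
    and fin: "emeasure lebesgue (\<Union> (cell a ` F)) < \<infinity>"
    and \<eta>: "\<eta> > 0" and N: "4 \<le> real N * \<eta>"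
  obtains F' where "sparse_collection (cell a ` F')"
    "AE x in lebesgue. (\<Sum>\<^sub>\<infinity>p\<in>F. ennreal (average g (cell a p)) * indicator (cell a p) x)
      \<le> ennreal (4 * real N) * sparse_operator (cell a ` F') g x"
proof -
  define av where "av p = average g (cell a p)" for p
  have av_nonneg: "av p \<ge> 0" for p unfolding av_def by (rule average_nonneg) (rule g)
  define below where "below r = {q \<in> F. cell a q \<subseteq> cell a r}" for r
  define between where "between q r = {s \<in> F. cell a q \<subseteq> cell a s \<and> cell a s \<subseteq> cell a r}" for q r
  \<comment> \<open>The factor 4 makes these cells take at most a quarter of the measure, by the
    weak type estimate. The condition \<open>4 \<le> real N * \<eta>\<close> gives
    \<open>stop2\<close> another quarter, and together they stay within half.\<close>
  define stop1 where "stop1 r = {q \<in> F. cell a q \<subset> cell a r \<and> 4 * av r < av q}" for r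
  define stop2 where "stop2 r = {q \<in> F. cell a q \<subset> cell a r \<and> N < card (between q r)}" for r
  define stop where "stop r = stop1 r \<union> stop2 r" for r
  define ch where "ch r = maximal_cells a (stop r)" for r
  define u where "u r x = (\<Sum>\<^sub>\<infinity>q\<in>below r. ennreal (av q) * indicator (cell a q) x)" for r x
  define c where "c r = ennreal (4 * real N * av r)" for r
  have N0: "N > 0" using N by (cases N) auto
  have stop_F: "stop r \<subseteq> F" and stop_sub: "q \<in> stop r \<Longrightarrow> cell a q \<subset> cell a r" for q r
    by (auto simp: stop_def stop1_def stop2_def)
  have stop_level: "fst q \<le> fst r" if "q \<in> stop r" for q r
    using psubset_level[OF stop_sub[OF that]] by simp
  have ch_stop: "ch r \<subseteq> stop r" for r unfolding ch_def by (rule maximal_cells_subset)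
  have cover: "\<exists>c\<in>ch r. cell a q \<subseteq> cell a c" if "q \<in> stop r" for q r
    using maximal_cells_cover[OF stop_level that] unfolding ch_def by metis
  have Union_ch: "\<Union> (cell a ` ch r) = \<Union> (cell a ` stop r)" for r
    unfolding ch_def using stop_level by (rule Union_maximal_cells)
  have fin_between: "finite (between q r)" for q r
  proof -
    obtain x where x: "x \<in> cell a q" using cell_nonempty by blast
    have "between q r \<subseteq> (\<lambda>k. index a k x) ` {fst q..fst r}"
    proof
      fix s assume s: "s \<in> between q r"
      then have "fst q \<le> fst s" "fst s \<le> fst r" by (auto simp: between_def cell_subset_level)
      moreover have "index a (fst s) x = s" using s x by (auto simp: between_def cell_index_eq)
      ultimately show "s \<in> (\<lambda>k. index a k x) ` {fst q..fst r}" by force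
    qed
    then show ?thesis by (rule finite_subset) simp
  qed
  have half: "emeasure lebesgue (\<Union> (cell a ` ch r)) \<le> ennreal (vol r / 2)" if r: "r \<in> F" for r
  proof -
    have "emeasure lebesgue (\<Union> (cell a ` stop1 r)) \<le> ennreal (vol r / 4)"
    proof (cases "av r = 0")
      case True
      \<comment> \<open>A vanishing average offers no positive level for
        \<open>emeasure_heavy\<close>, but then all averages below it vanish as well.\<close>
      have "stop1 r = {}"
      proof (rule ccontr)
        assume "stop1 r \<noteq> {}"
        then obtain q where q: "cell a q \<subseteq> cell a r" "0 < av q" using True by (auto simp: stop1_def)
        have "ennreal (av q * vol q) \<le> ennreal (av r * vol r)"
          unfolding av_def nn_integral_eq_average[OF g, symmetric]
          by (rule nn_set_integral_set_mono[OF q(1)])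
        then show False using True q(2) by (simp add: ennreal_eq_0_iff mult_le_0_iff)
          (metis not_le vol_pos mult_le_0_iff)
      qed
      then show ?thesis by simp
    next
      case False
      then have pos: "av r > 0" using av_nonneg[of r] by simp
      \<comment> \<open>Cutting off to the cell of \<open>r\<close> reduces the total mass in the
        weak type estimate to \<open>av r * vol r\<close>.\<close>
      let ?h = "\<lambda>y. ennreal (g y) * indicator (cell a r) y"
      have m: "?h \<in> borel_measurable lebesgue" using g by (intro borel_measurable_times_ennreal) auto
      have I: "(\<integral>\<^sup>+y. ?h y \<partial>lebesgue) = ennreal (av r * vol r)"
        unfolding av_def by (rule nn_integral_eq_average[OF g])
      have sub: "stop1 r \<subseteq> heavy ?h (ennreal (4 * av r))"
      proof
        fix q assume q: "q \<in> stop1 r"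
        then have "(\<integral>\<^sup>+y\<in>cell a q. ?h y \<partial>lebesgue) = (\<integral>\<^sup>+y\<in>cell a q. ennreal (g y) \<partial>lebesgue)"
          by (intro nn_integral_cong) (auto simp: stop1_def indicator_def)
        also have "\<dots> = ennreal (av q * vol q)" unfolding av_def by (rule nn_integral_eq_average[OF g])
        finally have "(\<integral>\<^sup>+y\<in>cell a q. ?h y \<partial>lebesgue) = ennreal (av q * vol q)" .
        moreover have "ennreal (4 * av r) * emeasure lebesgue (cell a q) = ennreal (4 * av r * vol q)"
          using pos by (simp add: emeasure_cell ennreal_mult)
        moreover have "4 * av r * vol q < av q * vol q" using q by (simp add: stop1_def)
        ultimately show "q \<in> heavy ?h (ennreal (4 * av r))"
          using pos by (simp add: heavy_def ennreal_less_iff)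
      qed
      have "ennreal (4 * av r) * emeasure lebesgue (\<Union> (cell a ` stop1 r))
          \<le> ennreal (4 * av r) * emeasure lebesgue (\<Union> (cell a ` heavy ?h (ennreal (4 * av r))))"
        using sub measurable_Union_cells by (intro mult_left_mono emeasure_mono) auto
      also have "\<dots> \<le> (\<integral>\<^sup>+y. ?h y \<partial>lebesgue)"
        by (rule emeasure_heavy) (use m I pos in auto)
      also have "\<dots> = ennreal (4 * av r) * ennreal (vol r / 4)"
        unfolding I using pos by (subst ennreal_mult[symmetric]) auto
      finally show ?thesis using pos by (subst (asm) ennreal_mult_le_mult_iff) auto
    qed
    moreover have "emeasure lebesgue (\<Union> (cell a ` stop2 r)) \<le> ennreal (vol r / 4)"
    proof -
      let ?V = "\<Union> (cell a ` stop2 r)"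
      have below_F: "below r \<subseteq> F" by (auto simp: below_def)
      have V: "?V \<in> sets lebesgue" by (rule measurable_Union_cells)
      \<comment> \<open>The number of cells of \<open>below r\<close> through a point is at least
        \<open>N\<close> on the union of \<open>stop2 r\<close>. Integrated, it is the sum of their
        volumes, and the disjoint sets \<open>E q\<close> inside \<open>r\<close> bound this sum by
        \<open>vol r / \<eta>\<close>.\<close>
      have ptw: "of_nat N * indicator ?V x \<le> (\<integral>\<^sup>+q. indicator (cell a q) x \<partial>count_space (below r))" for x
      proof (cases "x \<in> ?V")
        case True
        then obtain q where q: "q \<in> stop2 r" "x \<in> cell a q" by blast
        have "of_nat N \<le> (of_nat (card (between q r)) :: ennreal)" using q by (auto simp: stop2_def)
        also have "\<dots> \<le> (\<integral>\<^sup>+q. indicator (cell a q) x \<partial>count_space (below r))"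
          by (rule sparse_sum_ge_card[OF fin_between]) (use q in \<open>auto simp: between_def below_def\<close>)
        finally show ?thesis using True by simp
      qed simp
      have "ennreal \<eta> * (of_nat N * emeasure lebesgue ?V) = ennreal \<eta> * (\<integral>\<^sup>+x. of_nat N * indicator ?V x \<partial>lebesgue)"
        using V by (simp add: nn_integral_cmult_indicator)
      also have "\<dots> \<le> ennreal \<eta> * (\<integral>\<^sup>+x. (\<integral>\<^sup>+q. indicator (cell a q) x \<partial>count_space (below r)) \<partial>lebesgue)"
        by (intro mult_left_mono nn_integral_mono ptw) auto
      also have "\<dots> = ennreal \<eta> * (\<integral>\<^sup>+q. (\<integral>\<^sup>+x. indicator (cell a q) x \<partial>lebesgue) \<partial>count_space (below r))"
        by (subst nn_integral_count_space_nn_integral) auto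
      also have "\<dots> = (\<integral>\<^sup>+q. ennreal (\<eta> * vol q) \<partial>count_space (below r))"
        using \<eta> by (simp add: nn_integral_cmult[symmetric] emeasure_cell ennreal_mult)
      also have "\<dots> \<le> (\<integral>\<^sup>+q. emeasure lebesgue (E q) \<partial>count_space (below r))"
        using E below_F by (intro nn_integral_mono) auto
      also have "\<dots> = emeasure lebesgue (\<Union> (E ` below r))"
        using E E_disj below_F
        by (intro emeasure_UN_countable[symmetric]) (auto intro: disjoint_family_on_mono)
      also have "\<dots> \<le> emeasure lebesgue (cell a r)"
      proof (rule emeasure_mono)
        show "\<Union> (E ` below r) \<subseteq> cell a r" using E unfolding below_def by blast
      qed simp
      finally have le: "ennreal \<eta> * (of_nat N * emeasure lebesgue ?V) \<le> ennreal (vol r)" by (simp add: emeasure_cell)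
      have "4 * emeasure lebesgue ?V \<le> ennreal (real N * \<eta>) * emeasure lebesgue ?V"
        using N by (intro mult_right_mono) (auto simp flip: ennreal_numeral intro: ennreal_leI)
      also have "\<dots> = ennreal \<eta> * (of_nat N * emeasure lebesgue ?V)"
        using \<eta> by (simp add: ennreal_mult ennreal_of_nat_eq_real_of_nat mult_ac)
      also note le
      also have "ennreal (vol r) = 4 * ennreal (vol r / 4)"
        unfolding ennreal_numeral[symmetric] by (subst ennreal_mult[symmetric]) auto
      finally show ?thesis by (subst (asm) ennreal_mult_le_mult_iff) auto
    qed
    moreover have "emeasure lebesgue (\<Union> (cell a ` ch r))
        \<le> emeasure lebesgue (\<Union> (cell a ` stop1 r)) + emeasure lebesgue (\<Union> (cell a ` stop2 r))"
      unfolding Union_ch stop_def image_Un Union_Un_distrib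
      by (intro emeasure_subadditive measurable_Union_cells)
    ultimately have "emeasure lebesgue (\<Union> (cell a ` ch r)) \<le> ennreal (vol r / 4) + ennreal (vol r / 4)"
      by (meson add_mono order_trans)
    also have "\<dots> = ennreal (vol r / 2)" by (subst ennreal_plus[symmetric]) auto
    finally show ?thesis .
  qed
  have step: "u p x \<le> c p + (\<Sum>\<^sub>\<infinity>q\<in>{q \<in> below p. x \<in> cell a q \<and> (\<exists>s\<in>stop p. cell a q \<subseteq> cell a s)}. ennreal (av q))"
    if p: "p \<in> F" "x \<in> cell a p" for p x
  proof -
    define H where "H = {q \<in> below p. x \<in> cell a q \<and> \<not> (\<exists>s\<in>stop p. cell a q \<subseteq> cell a s)}"
    define H' where "H' = {q \<in> below p. x \<in> cell a q \<and> (\<exists>s\<in>stop p. cell a q \<subseteq> cell a s)}"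
    \<comment> \<open>Cells through \<open>x\<close> are nested, so the finest cell of a finite
      selection lies below all the others. If there were more than \<open>N\<close> of them, that
      cell would be in \<open>stop2 p\<close>.\<close>
    have small: "card G \<le> N" if G: "G \<subseteq> H" "finite G" for G
    proof (rule ccontr)
      assume neg: "\<not> card G \<le> N"
      then have ne: "G \<noteq> {}" using N0 by auto
      define q where "q = arg_min_on fst G"
      have q: "q \<in> G" "\<And>s. s \<in> G \<Longrightarrow> fst q \<le> fst s"
        using arg_min_if_finite[OF G(2) ne, of fst] by (auto simp: q_def not_less)
      have "G \<subseteq> between q p"
      proof
        fix s assume s: "s \<in> G"
        then have "cell a q \<subseteq> cell a s" using q G by (intro cell_subset[of x]) (auto simp: H_def)
        then show "s \<in> between q p" using s G by (auto simp: between_def H_def below_def)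
      qed
      then have "card G \<le> card (between q p)" by (intro card_mono fin_between)
      then have big: "N < card (between q p)" using neg by simp
      \<comment> \<open>Here \<open>N > 0\<close> enters: between \<open>p\<close> and
        \<open>p\<close> there is at most the single cell \<open>p\<close>.\<close>
      have "cell a q \<noteq> cell a p"
      proof
        assume "cell a q = cell a p"
        then have "between q p \<subseteq> {p}" using inj_cell[of a] by (auto simp: between_def dest: injD)
        then have "card (between q p) \<le> 1" using card_mono[of "{p}"] by auto
        then show False using big N0 by simp
      qed
      then have "q \<in> stop2 p" using q G big by (auto simp: stop2_def H_def below_def)
      then show False using q G by (auto simp: H_def stop_def)
    qed
    then have H: "finite H" "card H \<le> N"
      using finite_if_finite_subsets_card_bdd[of H N] by auto
    have H_le: "av q \<le> 4 * av p" if q: "q \<in> H" for q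
    proof (cases "cell a q = cell a p")
      case True
      then show ?thesis using av_nonneg[of p] by (simp add: av_def)
    next
      case False
      then have "q \<notin> stop1 p" using q by (auto simp: H_def stop_def)
      then show ?thesis using q False by (auto simp: stop1_def H_def below_def)
    qed
    have "u p x \<le> (\<Sum>\<^sub>\<infinity>q\<in>H \<union> H'. ennreal (av q))"
      unfolding u_def by (rule infsum_ennreal_mono) (auto simp: H_def H'_def indicator_def split: if_splits)
    also have "\<dots> = (\<Sum>q\<in>H. ennreal (av q)) + (\<Sum>\<^sub>\<infinity>q\<in>H'. ennreal (av q))"
      using H(1) by (subst infsum_Un_disjoint) (auto simp: H_def H'_def)
    also have "(\<Sum>q\<in>H. ennreal (av q)) \<le> c p"
    proof -
      have "(\<Sum>q\<in>H. ennreal (av q)) = ennreal (\<Sum>q\<in>H. av q)" using av_nonneg by (simp add: sum_ennreal)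
      also have "(\<Sum>q\<in>H. av q) \<le> real (card H) * (4 * av p)"
        by (rule sum_bounded_above) (rule H_le)
      also have "\<dots> \<le> real N * (4 * av p)" using H(2) av_nonneg[of p] by (intro mult_right_mono) auto
      finally show ?thesis by (simp add: c_def ennreal_leI mult_ac)
    qed
    finally show ?thesis unfolding H'_def by (simp add: add_right_mono)
  qed
  have est: "((\<forall>q\<in>ch p. x \<notin> cell a q) \<longrightarrow> u p x \<le> c p) \<and> (\<forall>q\<in>ch p. x \<in> cell a q \<longrightarrow> u p x \<le> c p + u q x)"
    if p: "p \<in> F" "x \<in> cell a p" for p x
  proof (intro conjI ballI impI)
    assume none: "\<forall>q\<in>ch p. x \<notin> cell a q"
    have "{q \<in> below p. x \<in> cell a q \<and> (\<exists>s\<in>stop p. cell a q \<subseteq> cell a s)} = {}"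
      using none cover[of _ p] by blast
    then show "u p x \<le> c p" using step[OF p] by (metis add_0_right infsum_empty)
  next
    fix r assume r: "r \<in> ch p" "x \<in> cell a r"
    have "(\<Sum>\<^sub>\<infinity>q\<in>{q \<in> below p. x \<in> cell a q \<and> (\<exists>s\<in>stop p. cell a q \<subseteq> cell a s)}. ennreal (av q)) \<le> u r x"
      unfolding u_def
    proof (rule infsum_ennreal_mono)
      fix q assume "q \<in> {q \<in> below p. x \<in> cell a q \<and> (\<exists>s\<in>stop p. cell a q \<subseteq> cell a s)}"
      then obtain s where s: "q \<in> below p" "x \<in> cell a q" "s \<in> stop p" "cell a q \<subseteq> cell a s" by blast
      obtain r' where r': "r' \<in> ch p" "cell a s \<subseteq> cell a r'" using cover[OF s(3)] by blast
      then have "x \<in> cell a r'" using s by blast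
      then have "r' = r" using r r' maximal_cells_disjoint[of "stop p"]
        unfolding ch_def disjoint_family_on_def by blast
      then have "q \<in> below r" using s r' by (auto simp: below_def)
      then show "q \<in> below r \<and> ennreal (av q) \<le> ennreal (av q) * indicator (cell a q) x" using s by simp
    qed
    then show "u p x \<le> c p + u r x" using step[OF p] by (meson add_left_mono order_trans)
  qed
  let ?R = "maximal_cells a F"
  have eqR: "\<Union> (cell a ` ?R) = \<Union> (cell a ` F)" using level by (rule Union_maximal_cells)
  obtain F' E' where F': "F' \<subseteq> F"
    "\<And>p. p \<in> F' \<Longrightarrow> E' p \<in> sets lebesgue \<and> E' p \<subseteq> cell a p \<and> vol p / 2 \<le> measure lebesgue (E' p)"
    "disjoint_family_on E' F'"
    "AE x in lebesgue. \<forall>r\<in>?R. x \<in> cell a r \<longrightarrow> u r x \<le> (\<Sum>\<^sub>\<infinity>p\<in>F'. c p * indicator (cell a p) x)"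
  proof (rule stopping_tree[of ?R F ch u c])
    show "?R \<subseteq> F" by (rule maximal_cells_subset)
    show "disjoint_family_on (cell a) ?R" by (rule maximal_cells_disjoint)
    show "emeasure lebesgue (\<Union> (cell a ` ?R)) < \<infinity>" unfolding eqR by (rule fin)
    show "ch p \<subseteq> F" for p using ch_stop stop_F by blast
    show "cell a q \<subseteq> cell a p" if "q \<in> ch p" for p q using ch_stop stop_sub that by blast
    show "fst q < fst p" if "q \<in> ch p" for p q
      using psubset_level[OF stop_sub[of q p]] ch_stop that by blast
    show "disjoint_family_on (cell a) (ch p)" for p unfolding ch_def by (rule maximal_cells_disjoint)
    show "emeasure lebesgue (\<Union> (cell a ` ch p)) \<le> ennreal (vol p / 2)" if "p \<in> F" for p
      using that by (rule half)
    show "AE x in lebesgue. \<forall>p\<in>F. x \<in> cell a p \<longrightarrow>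
      ((\<forall>q\<in>ch p. x \<notin> cell a q) \<longrightarrow> u p x \<le> c p) \<and> (\<forall>q\<in>ch p. x \<in> cell a q \<longrightarrow> u p x \<le> c p + u q x)"
      using est by (intro AE_I2) blast
  qed blast
  show ?thesis
  proof (rule that[of F'])
    show "sparse_collection (cell a ` F')"
      unfolding sparse_collection_def
    proof (intro conjI exI)
      show "dyadic_grid (range (cell a))" by (rule dyadic_grid)
      show "cell a ` F' \<subseteq> range (cell a)" by blast
      \<comment> \<open>Sparseness is stated for sets, the tree works with addresses; injectivity of
        \<open>cell\<close> carries the witnesses over.\<close>
      have inv: "inv (cell a) (cell a p) = p" for p by (rule inv_f_f[OF inj_cell])
      show "\<forall>Q\<in>cell a ` F'. (E' \<circ> inv (cell a)) Q \<in> sets lebesgue \<and> (E' \<circ> inv (cell a)) Q \<subseteq> Q \<and>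
          1 / 2 * measure lebesgue Q \<le> measure lebesgue ((E' \<circ> inv (cell a)) Q)"
        using F'(2) by (auto simp: inv measure_cell)
      show "disjoint_family_on (E' \<circ> inv (cell a)) (cell a ` F')"
        unfolding disjoint_family_on_def
      proof (intro ballI impI)
        fix P Q assume PQ: "P \<in> cell a ` F'" "Q \<in> cell a ` F'" "P \<noteq> Q"
        obtain p where p: "p \<in> F'" "P = cell a p" using PQ(1) by (rule imageE)
        obtain q where q: "q \<in> F'" "Q = cell a q" using PQ(2) by (rule imageE)
        have "p \<noteq> q" using PQ(3) p q by metis
        then show "(E' \<circ> inv (cell a)) P \<inter> (E' \<circ> inv (cell a)) Q = {}"
          using F'(3) p q by (simp add: inv disjoint_family_on_def)
      qed
    qed
    show "AE x in lebesgue. (\<Sum>\<^sub>\<infinity>p\<in>F. ennreal (average g (cell a p)) * indicator (cell a p) x)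
      \<le> ennreal (4 * real N) * sparse_operator (cell a ` F') g x"
      using F'(4)
    proof eventually_elim
      case (elim x)
      have op: "sparse_operator (cell a ` F') g x = (\<Sum>\<^sub>\<infinity>p\<in>F'. ennreal (av p) * indicator (cell a p) x)"
        unfolding sparse_operator_def av_def
        by (subst infsum_reindex) (auto intro: inj_on_subset[OF inj_cell] simp: o_def)
      have "(\<Sum>\<^sub>\<infinity>p\<in>F'. c p * indicator (cell a p) x)
          = (\<Sum>\<^sub>\<infinity>p\<in>F'. ennreal (4 * real N) * (ennreal (av p) * indicator (cell a p) x))"
        using av_nonneg by (simp add: c_def ennreal_mult mult_ac)
      also have "\<dots> \<le> ennreal (4 * real N) * (\<Sum>\<^sub>\<infinity>p\<in>F'. ennreal (av p) * indicator (cell a p) x)"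
        by (rule infsum_ennreal_cmult_le)
      finally have le: "(\<Sum>\<^sub>\<infinity>p\<in>F'. c p * indicator (cell a p) x) \<le> ennreal (4 * real N) * sparse_operator (cell a ` F') g x"
        unfolding op .
      show ?case
      proof (cases "x \<in> \<Union> (cell a ` F)")
        case True
        then obtain r where r: "r \<in> ?R" "x \<in> cell a r" using eqR by blast
        have "(\<Sum>\<^sub>\<infinity>p\<in>F. ennreal (av p) * indicator (cell a p) x) \<le> u r x"
          unfolding u_def
        proof (rule infsum_ennreal_mono)
          fix q assume q: "q \<in> F" "ennreal (av q) * indicator (cell a q) x \<noteq> 0"
          then have xq: "x \<in> cell a q" by (auto simp: indicator_def split: if_splits)
          obtain r' where r': "r' \<in> ?R" "cell a q \<subseteq> cell a r'" using maximal_cells_cover[OF level q(1)] by metis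
          then have "r' = r" using r xq maximal_cells_disjoint[of F] unfolding disjoint_family_on_def by blast
          then show "q \<in> below r \<and> ennreal (av q) * indicator (cell a q) x \<le> ennreal (av q) * indicator (cell a q) x"
            using r' q by (simp add: below_def)
        qed
        also have "\<dots> \<le> (\<Sum>\<^sub>\<infinity>p\<in>F'. c p * indicator (cell a p) x)" using elim r by blast
        also note le
        finally show ?thesis unfolding av_def .
      next
        case False
        then have "(\<Sum>\<^sub>\<infinity>p\<in>F. ennreal (average g (cell a p)) * indicator (cell a p) x) = 0"
          by (intro infsum_0) auto
        then show ?thesis by simp
      qed
    qed
  qed
qed

end

text \<open>The grid with corner \<open>c\<close>, shifted by a third of the side length in the directions where \<open>s\<close>
  holds.  The sign alternates with the generation because \<open>2\<^sup>k/3 + 2\<^sup>k\<^sup>+\<^sup>1/3 = 2\<^sup>k\<close>.\<close>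

definition shift :: "real ^ 'n \<Rightarrow> ('n \<Rightarrow> bool) \<Rightarrow> int \<Rightarrow> real ^ 'n" where
  "shift c s k = (\<chi> i. c $ i + (if s i then (if even k then 1 else - 1) * 2 powi k / 3 else 0))"

lemma grid_shift: "grid (shift c s)" for c :: "real ^ 'n"
proof
  fix k :: int and i :: 'n
  show "\<exists>m::int. shift c s k $ i - shift c s (k + 1) $ i = of_int m * 2 powi k"
  proof (cases "s i")
    case True
    then have "shift c s k $ i - shift c s (k + 1) $ i = of_int (if even k then 1 else - 1) * 2 powi k"
      by (simp add: shift_def power_int_add field_simps)
    then show ?thesis by blast
  qed (auto simp: shift_def intro: exI[of _ 0])
qed

lemma grid_const: "grid (\<lambda>_. c)"
  by standard (auto intro: exI[of _ 0])

text \<open>An interval of length \<open>3 / 16\<close> that crosses an integer stays within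
  \<open>3 / 16 < 1 / 3\<close> of it, so after a shift by a third in either direction it crosses
  none. The length is that of a triple measured in cells four generations up; three generations
  would give \<open>3 / 8\<close>, which exceeds \<open>1 / 3\<close>.\<close>

lemma one_third_interval:
  fixes t \<sigma> :: real
  assumes \<sigma>: "\<sigma> = 1 \<or> \<sigma> = - 1"
  obtains b n where "\<And>z. t \<le> z \<Longrightarrow> z < t + 3 / 16 \<Longrightarrow> \<lfloor>z - (if b then \<sigma> / 3 else 0)\<rfloor> = n"
proof -
  define n where "n = \<lfloor>t\<rfloor>"
  have n: "real_of_int n \<le> t" "t < real_of_int n + 1" unfolding n_def by linarith+
  show ?thesis
  proof (cases "t + 3 / 16 \<le> real_of_int n + 1")
    case True
    show ?thesis
    proof (rule that[of False n])
      fix z assume "t \<le> z" "z < t + 3 / 16"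
      then show "\<lfloor>z - (if False then \<sigma> / 3 else 0)\<rfloor> = n" using n True by (simp add: floor_eq_iff)
    qed
  next
    case False
    show ?thesis
    proof (rule that[of True "if \<sigma> = 1 then n else n + 1"])
      fix z assume "t \<le> z" "z < t + 3 / 16"
      then show "\<lfloor>z - (if True then \<sigma> / 3 else 0)\<rfloor> = (if \<sigma> = 1 then n else n + 1)"
        using n False \<sigma> by (auto simp: floor_eq_iff)
    qed
  qed
qed

text \<open>Each coordinate decides separately whether to shift, so \<open>2 ^ CARD('n)\<close>
  grids suffice, and the containing cell has \<open>16 ^ CARD('n)\<close> times the volume of
  \<open>p\<close>.\<close>

lemma one_third_trick:
  fixes c :: "real ^ 'n" and p :: "int \<times> ('n::finite \<Rightarrow> int)"
  obtains s r where "fst r = fst p + 4" "triple (\<lambda>_. c) p \<subseteq> cell (shift c s) r"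
proof -
  define k where "k = fst p"
  define L where "L = (2::real) powi (k + 4)"
  have L: "L > 0" "L = 16 * 2 powi k" by (simp_all add: L_def power_int_add)
  define \<sigma> where "\<sigma> = (if even k then 1 else - 1 :: real)"
  have \<sigma>: "\<sigma> = 1 \<or> \<sigma> = - 1" by (simp add: \<sigma>_def)
  have "\<exists>b n. \<forall>y\<in>triple (\<lambda>_. c) p. \<lfloor>(y $ i - (c $ i + (if b then \<sigma> * L / 3 else 0))) / L\<rfloor> = n" for i
  proof -
    define t where "t = 2 powi k * of_int (snd p i - 1) / L"
    obtain b n where bn: "\<And>z. t \<le> z \<Longrightarrow> z < t + 3 / 16 \<Longrightarrow> \<lfloor>z - (if b then \<sigma> / 3 else 0)\<rfloor> = n"
      using one_third_interval[of \<sigma> t] \<sigma> by metis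
    have "\<lfloor>(y $ i - (c $ i + (if b then \<sigma> * L / 3 else 0))) / L\<rfloor> = n" if "y \<in> triple (\<lambda>_. c) p" for y
    proof -
      have y: "2 powi k * of_int (snd p i - 1) \<le> y $ i - c $ i"
        "y $ i - c $ i < 2 powi k * of_int (snd p i - 1) + 3 / 16 * L"
        using that unfolding triple_eq_cube cube_def k_def[symmetric] L(2) by (auto simp: algebra_simps)
      have "t \<le> (y $ i - c $ i) / L" using y(1) L(1) unfolding t_def by (intro divide_right_mono) auto
      moreover have "(y $ i - c $ i) / L < t + 3 / 16"
        using divide_strict_right_mono[OF y(2) L(1)] L(1) unfolding t_def by (simp add: add_divide_distrib)
      ultimately have "\<lfloor>(y $ i - c $ i) / L - (if b then \<sigma> / 3 else 0)\<rfloor> = n" by (rule bn)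
      moreover have "(y $ i - c $ i) / L - (if b then \<sigma> / 3 else 0)
          = (y $ i - (c $ i + (if b then \<sigma> * L / 3 else 0))) / L"
        using L(1) by (simp add: diff_divide_distrib add_divide_distrib)
      ultimately show ?thesis by simp
    qed
    then show ?thesis by blast
  qed
  then obtain s n where sn: "\<And>i y. y \<in> triple (\<lambda>_. c) p \<Longrightarrow> \<lfloor>(y $ i - (c $ i + (if s i then \<sigma> * L / 3 else 0))) / L\<rfloor> = n i"
    by metis
  show ?thesis
  proof (rule that[of "(k + 4, n)" s])
    show "triple (\<lambda>_. c) p \<subseteq> cell (shift c s) (k + 4, n)"
    proof
      fix y assume y: "y \<in> triple (\<lambda>_. c) p"
      have "\<lfloor>(y $ i - shift c s (k + 4) $ i) / 2 powi (k + 4)\<rfloor> = n i" for i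
        using sn[OF y, of i] by (simp add: shift_def \<sigma>_def L_def split: if_splits)
      then show "y \<in> cell (shift c s) (k + 4, n)"
        by (simp add: cell_def index_def)
    qed
  qed (simp add: k_def)
qed

section \<open>Kernel estimates\<close>

text \<open>Balls of the maximum norm compare directly with cells and triples. They are open, so
  that a ball missing the support of a function also misses its closure.\<close>

definition near :: "real \<Rightarrow> real ^ 'n \<Rightarrow> (real ^ 'n) set" where
  "near r x = {y. \<forall>i. \<bar>y $ i - x $ i\<bar> < r}"

lemma open_near: "open (near r x)" for x :: "real ^ 'n"
proof -
  have "near r x = (\<Inter>i\<in>UNIV. {y. \<bar>y $ i - x $ i\<bar> < r})" by (auto simp: near_def)
  moreover have "open (\<Inter>i\<in>UNIV. {y :: real ^ 'n. \<bar>y $ i - x $ i\<bar> < r})"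
    by (intro open_INT ballI open_Collect_less continuous_intros) auto
  ultimately show ?thesis by simp
qed

lemma sets_near [measurable, simp]: "near r x \<in> sets lebesgue"
  using borel_open[OF open_near, of r x] by simp

lemma near_mono: "r \<le> s \<Longrightarrow> near r x \<subseteq> near s x"
  unfolding near_def by (auto intro: less_le_trans)

lemma mem_near_self: "r > 0 \<Longrightarrow> x \<in> near r x"
  by (simp add: near_def)

lemma emeasure_near:
  fixes x :: "real ^ 'n"
  assumes "r \<ge> 0" shows "emeasure lebesgue (near r x) \<le> ennreal ((2 * r) ^ CARD('n))"
proof -
  have "near r x \<subseteq> cube (\<chi> i. x $ i - r) (2 * r)"
  proof
    fix y assume y: "y \<in> near r x"
    have "x $ i - r \<le> y $ i \<and> y $ i < x $ i - r + 2 * r" for i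
      using y unfolding near_def mem_Collect_eq by (smt (verit))
    then show "y \<in> cube (\<chi> i. x $ i - r) (2 * r)" by (simp add: cube_def)
  qed
  then have "emeasure lebesgue (near r x) \<le> emeasure lebesgue (cube (\<chi> i. x $ i - r) (2 * r))"
    by (intro emeasure_mono) auto
  also have "\<dots> = ennreal ((2 * r) ^ CARD('n))" by (rule emeasure_cube) (use assms in simp)
  finally show ?thesis .
qed

lemma norm_ge_of_not_near: "y \<notin> near r x \<Longrightarrow> r \<le> norm (x - y)"
proof -
  assume "y \<notin> near r x"
  then obtain i where "r \<le> \<bar>y $ i - x $ i\<bar>" by (auto simp: near_def not_less)
  also have "\<dots> \<le> norm (x - y)" using component_le_norm_cart[of "x - y" i] by (simp add: abs_minus_commute)
  finally show ?thesis .
qed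

lemma dyadic_annulus:
  fixes x y :: "real ^ 'n"
  assumes "l > 0" "y \<notin> near l x"
  obtains j :: nat where "y \<notin> near (2 ^ j * l) x" "y \<in> near (2 ^ (j + 1) * l) x"
proof -
  let ?P = "\<lambda>j. y \<in> near (2 ^ j * l) x"
  obtain n where n: "norm (x - y) / l < 2 ^ n" using real_arch_pow[of 2 "norm (x - y) / l"] by auto
  have "?P n" using n assms(1) norm_ge_of_not_near[of y "2 ^ n * l" x] by (force simp: field_simps not_less[symmetric])
  then obtain m where m: "?P m" "\<And>k. k < m \<Longrightarrow> \<not> ?P k" using LeastI[of ?P n] not_less_Least[of _ ?P] by metis
  have "m \<noteq> 0" using m(1) assms(2) by (metis mult_1 power_0)
  then obtain j where "m = Suc j" using not0_implies_Suc by blast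
  then show ?thesis using that[of j] m by simp
qed

text \<open>The Dini condition takes the form of summability along the powers of 1/2, which is how
  the dyadic annuli around a point use it.\<close>

locale dini_kernel =
  fixes K :: "real ^ 'n \<Rightarrow> real ^ 'n \<Rightarrow> complex" and A B :: real and w :: "real \<Rightarrow> real"
  assumes A: "A \<ge> 0" and B: "B \<ge> 0"
    and size: "\<And>x y. x \<noteq> y \<Longrightarrow> norm (K x y) \<le> A / norm (x - y) ^ CARD('n)"
    and smooth1: "\<And>x x' y. x \<noteq> y \<Longrightarrow> norm (x - x') \<le> 1 / 2 * norm (x - y) \<Longrightarrow>
      norm (K x y - K x' y) \<le> B * w (norm (x - x') / norm (x - y)) / norm (x - y) ^ CARD('n)"
    and smooth2: "\<And>x y y'. x \<noteq> y \<Longrightarrow> norm (y - y') \<le> 1 / 2 * norm (x - y) \<Longrightarrow>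
      norm (K x y - K x y') \<le> B * w (norm (y - y') / norm (x - y)) / norm (x - y) ^ CARD('n)"
    and w_mono: "\<And>s t. 0 \<le> s \<Longrightarrow> s \<le> t \<Longrightarrow> w s \<le> w t"
    and w_nonneg: "\<And>s. 0 \<le> s \<Longrightarrow> 0 \<le> w s"
    and w_summable: "summable (\<lambda>j. w ((1 / 2) ^ j))"
begin

text \<open>Chosen so that \<open>2 * real CARD('n) \<le> 2 ^ j0\<close>: from annulus
  \<open>j0\<close> on, a displacement of at most \<open>l\<close> in each coordinate is at most
  half the Euclidean distance, as the smoothness estimates demand.\<close>

definition j0 :: nat where "j0 = CARD('n) + 1"

text \<open>To be divided by \<open>(2 ^ j * l) ^ CARD('n)\<close>, the volume of the annulus up to
  a factor. For \<open>j < j0\<close> the smoothness estimates may not apply and the size estimate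
  at distance \<open>l\<close> is used; the power of \<open>2 ^ j\<close> cancels that of the
  divisor.\<close>

definition annulus_coeff :: "nat \<Rightarrow> real" where
  "annulus_coeff j = (if j < j0 then 2 * A * (2 ^ j) ^ CARD('n) else B * w ((1 / 2) ^ (j - j0)))"

definition osc_const :: real where "osc_const = (\<Sum>j. annulus_coeff j)"

lemma j0: "2 * real CARD('n) \<le> 2 ^ j0"
proof -
  have "CARD('n) \<le> 2 ^ CARD('n)" by (rule less_imp_le) (rule less_exp)
  then have "real CARD('n) \<le> 2 ^ CARD('n)" by (metis of_nat_le_iff of_nat_numeral of_nat_power)
  then show ?thesis by (simp add: j0_def)
qed

lemma annulus_coeff_nonneg: "annulus_coeff j \<ge> 0"
  using A B w_nonneg by (simp add: annulus_coeff_def)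

lemma summable_annulus_coeff: "summable annulus_coeff"
proof -
  have "summable (\<lambda>j. annulus_coeff (j + j0))"
    using w_summable by (simp add: annulus_coeff_def summable_mult)
  then show ?thesis by (subst (asm) summable_iff_shift)
qed

lemma osc_const_nonneg: "osc_const \<ge> 0"
  unfolding osc_const_def by (rule suminf_nonneg[OF summable_annulus_coeff annulus_coeff_nonneg])

lemma suminf_annulus_coeff: "(\<Sum>j. ennreal (annulus_coeff j)) = ennreal osc_const"
  unfolding osc_const_def
  by (rule suminf_ennreal2[OF annulus_coeff_nonneg summable_annulus_coeff])

text \<open>Passing from the maximum norm to the Euclidean norm costs a factor
  \<open>CARD('n)\<close>, which \<open>2 ^ j0\<close> absorbs; this is the shift by
  \<open>j0\<close> in the argument of \<open>w\<close>.\<close>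

lemma smooth_arg_bound:
  assumes "l > 0" "j0 \<le> j" "\<And>i. \<bar>(x - x') $ i\<bar> \<le> l" "2 ^ j * l \<le> r"
  shows "norm (x - x' :: real ^ 'n) \<le> 1 / 2 * r" "w (norm (x - x') / r) \<le> w ((1 / 2) ^ (j - j0))"
proof -
  have n: "norm (x - x') \<le> real CARD('n) * l" by (rule norm_le_of_components) (rule assms(3))
  have "2 * real CARD('n) * l \<le> 2 ^ j0 * l" using j0 assms(1) by (intro mult_right_mono) auto
  also have "\<dots> \<le> 2 ^ j * l" using assms by (intro mult_right_mono power_increasing) auto
  finally have "2 * real CARD('n) * l \<le> r" using assms(4) by linarith
  then show "norm (x - x') \<le> 1 / 2 * r" using n by linarith
  have r: "r > 0" using assms(1,4) by (smt (verit) mult_pos_pos zero_less_power)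
  show "w (norm (x - x') / r) \<le> w ((1 / 2) ^ (j - j0))"
  proof (rule w_mono)
    have "real CARD('n) \<le> 2 ^ j0" using j0 by linarith
    then have "real CARD('n) * l \<le> 2 ^ j0 * l" using assms(1) by (intro mult_right_mono) auto
    then have "norm (x - x') \<le> 2 ^ j0 * l" using n by linarith
    then have "norm (x - x') / r \<le> (2 ^ j0 * l) / (2 ^ j * l)"
      using assms(1,4) by (intro frac_le) auto
    also have "\<dots> = (1 / 2) ^ (j - j0)"
      using assms(1,2) by (simp add: power_diff power_one_over field_simps)
    finally show "norm (x - x') / r \<le> (1 / 2) ^ (j - j0)" .
  qed (use r in simp)
qed

text \<open>Both points keep distance \<open>l\<close> from \<open>y\<close>, so for
  \<open>j < j0\<close> the two kernel values are bounded separately; from \<open>j0\<close> on the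
  smoothness in the first variable applies.\<close>

lemma kernel_diff1:
  assumes l: "l > 0" and xx': "\<And>i. \<bar>x $ i - x' $ i\<bar> \<le> l"
    and y: "y \<notin> near (2 ^ j * l) x" "y \<notin> near l x'"
  shows "norm (K x y - K x' y) \<le> annulus_coeff j / (2 ^ j * l) ^ CARD('n)"
proof -
  let ?r = "norm (x - y)"
  have r: "2 ^ j * l \<le> ?r" using y(1) by (rule norm_ge_of_not_near)
  have jl: "2 ^ j * l > 0" using l by simp
  then have xy: "x \<noteq> y" using r by auto
  have pow: "(2 ^ j * l) ^ CARD('n) \<le> ?r ^ CARD('n)" using r jl by (intro power_mono) auto
  show ?thesis
  proof (cases "j < j0")
    case True
    have x'y: "l \<le> norm (x' - y)" using y(2) by (rule norm_ge_of_not_near)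
    then have "x' \<noteq> y" using l by auto
    have "1 * l \<le> 2 ^ j * l" by (rule mult_right_mono) (use l in auto)
    then have jl': "l \<le> ?r" using r by linarith
    have "norm (K x y) \<le> A / ?r ^ CARD('n)" using xy by (rule size)
    also have "\<dots> \<le> A / l ^ CARD('n)"
      using A l jl' by (intro divide_left_mono power_mono mult_pos_pos zero_less_power) auto
    finally have 1: "norm (K x y) \<le> A / l ^ CARD('n)" .
    have "norm (K x' y) \<le> A / norm (x' - y) ^ CARD('n)" using \<open>x' \<noteq> y\<close> by (rule size)
    also have "\<dots> \<le> A / l ^ CARD('n)"
      using A l x'y by (intro divide_left_mono power_mono mult_pos_pos zero_less_power) auto
    finally have "norm (K x y - K x' y) \<le> 2 * (A / l ^ CARD('n))" using 1 norm_triangle_ineq4[of "K x y" "K x' y"] by linarith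
    also have "\<dots> = annulus_coeff j / (2 ^ j * l) ^ CARD('n)"
      using True by (simp add: annulus_coeff_def power_mult_distrib)
    finally show ?thesis .
  next
    case False
    then have j: "j0 \<le> j" by simp
    note sa = smooth_arg_bound[OF l j _ r, of x x']
    have "norm (K x y - K x' y) \<le> B * w (norm (x - x') / ?r) / ?r ^ CARD('n)"
      using xy sa(1) xx' by (intro smooth1) auto
    also have "\<dots> \<le> B * w ((1 / 2) ^ (j - j0)) / (2 ^ j * l) ^ CARD('n)"
      using B sa(2) xx' w_nonneg pow jl by (intro frac_le mult_left_mono mult_nonneg_nonneg zero_less_power) auto
    finally show ?thesis using False by (simp add: annulus_coeff_def)
  qed
qed

text \<open>Used with \<open>c\<close> the centre of a bad piece and \<open>x\<close> outside the
  ball dilated by \<open>2 ^ j0\<close>, so that only annuli with \<open>j0 \<le> j\<close>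
  occur.\<close>

lemma kernel_diff2:
  assumes l: "l > 0" and j: "j0 \<le> j" and cy: "\<And>i. \<bar>c $ i - y $ i\<bar> \<le> l"
    and x: "x \<notin> near (2 ^ j * l) c"
  shows "norm (K x y - K x c) \<le> annulus_coeff j / (2 ^ j * l) ^ CARD('n)"
proof -
  let ?r = "norm (x - c)"
  have r: "2 ^ j * l \<le> ?r" using norm_ge_of_not_near[OF x] by (simp add: norm_minus_commute)
  have jl: "2 ^ j * l > 0" using l by simp
  then have xc: "x \<noteq> c" using r by auto
  have pow: "(2 ^ j * l) ^ CARD('n) \<le> ?r ^ CARD('n)" using r jl by (intro power_mono) auto
  note sa = smooth_arg_bound[OF l j _ r, of c y]
  have "norm (K x c - K x y) \<le> B * w (norm (c - y) / ?r) / ?r ^ CARD('n)"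
    using xc sa(1) cy by (intro smooth2) auto
  also have "\<dots> \<le> B * w ((1 / 2) ^ (j - j0)) / (2 ^ j * l) ^ CARD('n)"
    using B sa(2) cy w_nonneg pow jl by (intro frac_le mult_left_mono mult_nonneg_nonneg zero_less_power) auto
  finally show ?thesis using j by (simp add: annulus_coeff_def norm_minus_commute)
qed

text \<open>A majorant of the kernel variation around \<open>c\<close>, with each annulus enlarged
  to the ball that contains it; this is easily integrated and the coefficients remain
  summable.\<close>

definition tail :: "real ^ 'n \<Rightarrow> real \<Rightarrow> real ^ 'n \<Rightarrow> ennreal" where
  "tail c l x = (\<Sum>j. ennreal (annulus_coeff j / (2 ^ j * l) ^ CARD('n)) * indicator (near (2 ^ (j + 1) * l) c) x)"

lemma tail_measurable [measurable]: "tail c l \<in> borel_measurable lebesgue"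
  unfolding tail_def by measurable

text \<open>Both powers scale alike, so \<open>l\<close> and \<open>2 ^ j\<close> cancel; the factor
  \<open>2 ^ CARD('n)\<close> is the price of the doubled radius.\<close>

lemma coeff_mult_power:
  assumes "l > 0" "b \<ge> 0"
  shows "ennreal (annulus_coeff j / (2 ^ j * l) ^ CARD('n)) * ennreal (b * (2 ^ (j + 1) * l) ^ CARD('n))
    = ennreal (2 ^ CARD('n) * b) * ennreal (annulus_coeff j)"
proof -
  have "annulus_coeff j / (2 ^ j * l) ^ CARD('n) * (b * (2 ^ (j + 1) * l) ^ CARD('n))
      = 2 ^ CARD('n) * b * annulus_coeff j"
    using assms by (simp add: power_mult_distrib field_simps)
  then show ?thesis using assms annulus_coeff_nonneg[of j]
    by (simp add: ennreal_mult[symmetric] del: power_add power_Suc)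
qed

text \<open>The bound does not depend on the scale. One factor \<open>2 ^ CARD('n)\<close> comes
  from the volume of a ball of given radius, the other from the radius
  \<open>2 ^ (j + 1) * l\<close> against the divisor.\<close>

lemma nn_integral_tail:
  assumes l: "l > 0"
  shows "(\<integral>\<^sup>+x. tail c l x \<partial>lebesgue) \<le> ennreal (4 ^ CARD('n) * osc_const)"
proof -
  have "(\<integral>\<^sup>+x. tail c l x \<partial>lebesgue) = (\<Sum>j. ennreal (annulus_coeff j / (2 ^ j * l) ^ CARD('n)) *
      emeasure lebesgue (near (2 ^ (j + 1) * l) c))"
    unfolding tail_def by (subst nn_integral_suminf) (auto simp: nn_integral_cmult_indicator)
  also have "\<dots> \<le> (\<Sum>j. ennreal (2 ^ CARD('n) * 2 ^ CARD('n)) * ennreal (annulus_coeff j))"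
  proof (intro suminf_le allI)
    fix j
    have "emeasure lebesgue (near (2 ^ (j + 1) * l) c) \<le> ennreal (2 ^ CARD('n) * (2 ^ (j + 1) * l) ^ CARD('n))"
      using emeasure_near[of "2 ^ (j + 1) * l" c] l
      by (simp only: power_mult_distrib[of 2 "2 ^ (j + 1) * l", symmetric]) simp
    then have "ennreal (annulus_coeff j / (2 ^ j * l) ^ CARD('n)) * emeasure lebesgue (near (2 ^ (j + 1) * l) c)
      \<le> ennreal (annulus_coeff j / (2 ^ j * l) ^ CARD('n)) * ennreal (2 ^ CARD('n) * (2 ^ (j + 1) * l) ^ CARD('n))"
      by (intro mult_left_mono) auto
    also have "\<dots> = ennreal (2 ^ CARD('n) * 2 ^ CARD('n)) * ennreal (annulus_coeff j)"
      using l by (intro coeff_mult_power) auto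
    finally show "ennreal (annulus_coeff j / (2 ^ j * l) ^ CARD('n)) * emeasure lebesgue (near (2 ^ (j + 1) * l) c)
      \<le> ennreal (2 ^ CARD('n) * 2 ^ CARD('n)) * ennreal (annulus_coeff j)" .
  qed auto
  also have "\<dots> = ennreal (2 ^ CARD('n) * 2 ^ CARD('n)) * ennreal osc_const"
    by (simp add: ennreal_suminf_cmult suminf_annulus_coeff)
  also have "\<dots> = ennreal (4 ^ CARD('n) * osc_const)"
    using osc_const_nonneg by (simp add: ennreal_mult[symmetric] power_mult_distrib[symmetric])
  finally show ?thesis .
qed

text \<open>The mean of \<open>b\<close> vanishes, so the constant \<open>K x c\<close> may be
  subtracted from the kernel under the integral; the difference is controlled by the coefficient of
  the one annulus that contains \<open>x\<close>.\<close>

lemma bad_part_bound: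
  fixes b :: "real ^ 'n \<Rightarrow> complex"
  assumes l: "l > 0" and b: "integrable lebesgue b" "(LINT y|lebesgue. b y) = 0"
    and supp: "\<And>y. b y \<noteq> 0 \<Longrightarrow> y \<in> near l c"
    and x: "x \<notin> near (2 ^ j0 * l) c"
    and I: "has_bochner_integral lebesgue (\<lambda>y. K x y * b y) I"
  shows "ennreal (norm I) \<le> tail c l x * (\<integral>\<^sup>+y. ennreal (norm (b y)) \<partial>lebesgue)"
proof -
  have "x \<notin> near l c" using x near_mono[of l "2 ^ j0 * l" c] l by auto
  then obtain j where j: "x \<notin> near (2 ^ j * l) c" "x \<in> near (2 ^ (j + 1) * l) c"
    using dyadic_annulus[OF l] by metis
  have "j0 \<le> j"
  proof (rule ccontr)
    assume "\<not> j0 \<le> j"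
    then have "2 ^ (j + 1) * l \<le> 2 ^ j0 * l" using l by (intro mult_right_mono power_increasing) auto
    then show False using j(2) x near_mono by blast
  qed
  let ?a = "annulus_coeff j / (2 ^ j * l) ^ CARD('n)"
  have a: "?a \<ge> 0" using annulus_coeff_nonneg[of j] l by simp
  have Kc: "has_bochner_integral lebesgue (\<lambda>y. K x c * b y) (K x c * 0)"
    using b by (intro has_bochner_integral_mult_right) (auto simp: has_bochner_integral_iff)
  have hb: "has_bochner_integral lebesgue (\<lambda>y. K x y * b y - K x c * b y) (I - K x c * 0)"
    by (intro has_bochner_integral_diff I Kc)
  then have "ennreal (norm I) = ennreal (norm (LINT y|lebesgue. K x y * b y - K x c * b y))"
    by (simp add: has_bochner_integral_iff)
  also have "\<dots> \<le> (\<integral>\<^sup>+y. ennreal (norm (K x y * b y - K x c * b y)) \<partial>lebesgue)"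
    using hb by (intro integral_norm_bound_ennreal) (simp add: has_bochner_integral_iff)
  also have "\<dots> \<le> (\<integral>\<^sup>+y. ennreal ?a * ennreal (norm (b y)) \<partial>lebesgue)"
  proof (rule nn_integral_mono)
    fix y
    show "ennreal (norm (K x y * b y - K x c * b y)) \<le> ennreal ?a * ennreal (norm (b y))"
    proof (cases "b y = 0")
      case False
      then have "\<bar>c $ i - y $ i\<bar> \<le> l" for i
        using supp[of y] by (auto simp: near_def abs_minus_commute less_imp_le)
      then have "norm (K x y - K x c) \<le> ?a" using l \<open>j0 \<le> j\<close> j(1) by (intro kernel_diff2) auto
      then have "norm (K x y * b y - K x c * b y) \<le> ?a * norm (b y)"
        unfolding left_diff_distrib[symmetric] norm_mult by (intro mult_right_mono) auto
      then show ?thesis using a by (simp add: ennreal_mult[symmetric] ennreal_leI)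
    qed simp
  qed
  also have "\<dots> = ennreal ?a * (\<integral>\<^sup>+y. ennreal (norm (b y)) \<partial>lebesgue)"
    using b(1) by (intro nn_integral_cmult) auto
  also have "ennreal ?a \<le> tail c l x"
  proof -
    have "ennreal ?a = (\<Sum>i\<in>{j}. ennreal (annulus_coeff i / (2 ^ i * l) ^ CARD('n)) * indicator (near (2 ^ (i + 1) * l) c) x)"
      using j by simp
    also have "\<dots> \<le> tail c l x" unfolding tail_def by (rule sum_le_suminf) auto
    finally show ?thesis .
  qed
  finally show ?thesis by (simp add: mult_right_mono)
qed

text \<open>As \<open>F\<close> vanishes within \<open>l\<close> of both points, the dyadic annuli
  around \<open>x\<close> cover its support. On each of them the bound \<open>t\<close> for the
  averages turns the kernel difference into an annulus coefficient times
  \<open>2 ^ CARD('n) * t\<close>, and the coefficients are summable.\<close>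

lemma oscillation_bound:
  fixes F :: "real ^ 'n \<Rightarrow> complex"
  assumes l: "l > 0" and xx': "\<And>i. \<bar>x $ i - x' $ i\<bar> \<le> l" and t: "t \<ge> 0"
    and F: "F \<in> borel_measurable lebesgue" "\<And>y. y \<in> near l x \<union> near l x' \<Longrightarrow> F y = 0"
    and avg: "\<And>j::nat. (\<integral>\<^sup>+y\<in>near (2 ^ j * l) x. ennreal (norm (F y)) \<partial>lebesgue) \<le> ennreal (t * (2 ^ j * l) ^ CARD('n))"
    and I: "has_bochner_integral lebesgue (\<lambda>y. K x y * F y) I"
    and I': "has_bochner_integral lebesgue (\<lambda>y. K x' y * F y) I'"
  shows "norm (I - I') \<le> 2 ^ CARD('n) * osc_const * t"
proof -
  let ?a = "\<lambda>j. annulus_coeff j / (2 ^ j * l) ^ CARD('n)"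
  have a: "?a j \<ge> 0" for j using annulus_coeff_nonneg[of j] l by simp
  have [measurable]: "(\<lambda>y. ennreal (norm (F y))) \<in> borel_measurable lebesgue" using F(1) by measurable
  have hb: "has_bochner_integral lebesgue (\<lambda>y. K x y * F y - K x' y * F y) (I - I')"
    by (intro has_bochner_integral_diff I I')
  then have "ennreal (norm (I - I')) = ennreal (norm (LINT y|lebesgue. K x y * F y - K x' y * F y))"
    by (simp add: has_bochner_integral_iff)
  also have "\<dots> \<le> (\<integral>\<^sup>+y. ennreal (norm (K x y * F y - K x' y * F y)) \<partial>lebesgue)"
    using hb by (intro integral_norm_bound_ennreal) (simp add: has_bochner_integral_iff)
  also have "\<dots> \<le> (\<integral>\<^sup>+y. (\<Sum>j. ennreal (?a j) * (ennreal (norm (F y)) * indicator (near (2 ^ (j + 1) * l) x) y)) \<partial>lebesgue)"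
  proof (rule nn_integral_mono)
    fix y
    show "ennreal (norm (K x y * F y - K x' y * F y))
      \<le> (\<Sum>j. ennreal (?a j) * (ennreal (norm (F y)) * indicator (near (2 ^ (j + 1) * l) x) y))"
    proof (cases "F y = 0")
      case False
      then have y: "y \<notin> near l x" "y \<notin> near l x'" using F(2)[of y] by blast+
      obtain j where j: "y \<notin> near (2 ^ j * l) x" "y \<in> near (2 ^ (j + 1) * l) x"
        using dyadic_annulus[OF l y(1)] by metis
      have "norm (K x y - K x' y) \<le> ?a j" using l xx' j(1) y(2) by (intro kernel_diff1) auto
      then have "norm (K x y * F y - K x' y * F y) \<le> ?a j * norm (F y)"
        unfolding left_diff_distrib[symmetric] norm_mult by (intro mult_right_mono) auto
      then have "ennreal (norm (K x y * F y - K x' y * F y)) \<le> ennreal (?a j) * ennreal (norm (F y))"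
        using a[of j] by (simp add: ennreal_mult[symmetric] ennreal_leI)
      also have "\<dots> = (\<Sum>i\<in>{j}. ennreal (?a i) * (ennreal (norm (F y)) * indicator (near (2 ^ (i + 1) * l) x) y))"
        using j(2) by simp
      also have "\<dots> \<le> (\<Sum>i. ennreal (?a i) * (ennreal (norm (F y)) * indicator (near (2 ^ (i + 1) * l) x) y))"
        by (rule sum_le_suminf) auto
      finally show ?thesis .
    qed simp
  qed
  also have "\<dots> = (\<Sum>j. ennreal (?a j) * (\<integral>\<^sup>+y\<in>near (2 ^ (j + 1) * l) x. ennreal (norm (F y)) \<partial>lebesgue))"
    by (subst nn_integral_suminf) (auto simp: nn_integral_cmult)
  also have "\<dots> \<le> (\<Sum>j. ennreal (2 ^ CARD('n) * t) * ennreal (annulus_coeff j))"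
  proof (intro suminf_le allI)
    fix j
    have "ennreal (?a j) * (\<integral>\<^sup>+y\<in>near (2 ^ (j + 1) * l) x. ennreal (norm (F y)) \<partial>lebesgue)
      \<le> ennreal (?a j) * ennreal (t * (2 ^ (j + 1) * l) ^ CARD('n))"
      by (intro mult_left_mono avg) auto
    also have "\<dots> = ennreal (2 ^ CARD('n) * t) * ennreal (annulus_coeff j)"
      using l t by (intro coeff_mult_power) auto
    finally show "ennreal (?a j) * (\<integral>\<^sup>+y\<in>near (2 ^ (j + 1) * l) x. ennreal (norm (F y)) \<partial>lebesgue)
      \<le> ennreal (2 ^ CARD('n) * t) * ennreal (annulus_coeff j)" .
  qed auto
  also have "\<dots> = ennreal (2 ^ CARD('n) * t) * ennreal osc_const"
    by (simp add: ennreal_suminf_cmult suminf_annulus_coeff)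
  also have "\<dots> = ennreal (2 ^ CARD('n) * osc_const * t)"
    using osc_const_nonneg t by (simp add: ennreal_mult[symmetric] mult_ac)
  finally show ?thesis
    using osc_const_nonneg t by (subst (asm) ennreal_le_iff) auto
qed

end

section \<open>Weak type estimates\<close>

text \<open>The distribution function, with values in \<open>[0, \<infinity>]\<close>.\<close>

definition superlevel :: "(real ^ 'n \<Rightarrow> complex) \<Rightarrow> real \<Rightarrow> ennreal" where
  "superlevel f t = emeasure lebesgue {x. t < norm (f x)}"

definition power_integral :: "real \<Rightarrow> (real ^ 'n \<Rightarrow> complex) \<Rightarrow> ennreal" where
  "power_integral q f = (\<integral>\<^sup>+x. ennreal (norm (f x) powr q) \<partial>lebesgue)"

text \<open>The functions for which the kernel formula is available; they lie in \<open>L^1\<close>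
  and in \<open>L^q\<close>.\<close>

definition nice :: "(real ^ 'n \<Rightarrow> complex) \<Rightarrow> bool" where
  "nice f \<longleftrightarrow> f \<in> borel_measurable lebesgue \<and> bounded (range f) \<and> bounded {y. f y \<noteq> 0}"

lemma sets_superlevel [measurable]:
  "f \<in> borel_measurable lebesgue \<Longrightarrow> {x. t < norm (f x)} \<in> sets lebesgue"
  for f :: "real ^ 'n \<Rightarrow> complex"
proof -
  assume [measurable]: "f \<in> borel_measurable lebesgue"
  have "{x \<in> space lebesgue. t < norm (f x)} \<in> sets lebesgue" by measurable
  then show ?thesis by simp
qed

lemma superlevel_add:
  assumes [measurable]: "f \<in> borel_measurable lebesgue" "g \<in> borel_measurable lebesgue" "h \<in> borel_measurable lebesgue"
    and eq: "AE x in lebesgue. f x = g x + h x"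
  shows "superlevel f (s + t) \<le> superlevel g s + superlevel h t"
proof -
  have "superlevel f (s + t) \<le> emeasure lebesgue ({x. s < norm (g x)} \<union> {x. t < norm (h x)})"
    unfolding superlevel_def
  proof (rule emeasure_mono_AE)
    show "AE x in lebesgue. x \<in> {x. s + t < norm (f x)} \<longrightarrow> x \<in> {x. s < norm (g x)} \<union> {x. t < norm (h x)}"
      using eq
    proof eventually_elim
      case (elim x)
      then show ?case using norm_triangle_ineq[of "g x" "h x"] by auto
    qed
  qed measurable
  also have "\<dots> \<le> superlevel g s + superlevel h t"
    unfolding superlevel_def by (rule emeasure_subadditive) measurable
  finally show ?thesis .
qed

lemma Lq_iff: "f \<in> Lq q \<longleftrightarrow> f \<in> borel_measurable lebesgue \<and> power_integral q f < \<infinity>"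
proof (cases "f \<in> borel_measurable lebesgue")
  case [measurable]: True
  have "(\<lambda>x. norm (f x) powr q) \<in> borel_measurable lebesgue" by measurable
  then have "integrable lebesgue (\<lambda>x. norm (f x) powr q) \<longleftrightarrow> power_integral q f < \<infinity>"
    unfolding power_integral_def integrable_iff_bounded by simp
  then show ?thesis using True by (simp add: Lq_def)
qed (simp add: Lq_def)

lemma power_integral_Lq:
  assumes "f \<in> Lq q"
  shows "power_integral q f = ennreal (LINT x|lebesgue. norm (f x) powr q)"
  using assms unfolding power_integral_def Lq_def by (intro nn_integral_eq_integral) auto

lemma power_integral_AE_0:
  fixes f :: "real ^ 'n \<Rightarrow> complex"
  assumes "AE x in lebesgue. f x = 0" shows "power_integral q f = 0"
proof -
  have "power_integral q f = (\<integral>\<^sup>+x. 0 \<partial>(lebesgue :: (real ^ 'n) measure))"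
    unfolding power_integral_def using assms by (intro nn_integral_cong_AE) auto
  then show ?thesis by simp
qed

lemma chebyshev_power:
  fixes f :: "real ^ 'n \<Rightarrow> complex"
  assumes [measurable]: "f \<in> borel_measurable lebesgue" and t: "t > 0" "q \<ge> 0"
  shows "ennreal (t powr q) * superlevel f t \<le> power_integral q f"
proof -
  have "ennreal (t powr q) * superlevel f t = (\<integral>\<^sup>+x. ennreal (t powr q) * indicator {x. t < norm (f x)} x \<partial>lebesgue)"
    unfolding superlevel_def by (subst nn_integral_cmult_indicator) auto
  also have "\<dots> \<le> power_integral q f"
    unfolding power_integral_def
    by (rule nn_integral_mono) (use t in \<open>auto simp: indicator_def intro!: ennreal_leI powr_mono2\<close>)
  finally show ?thesis .
qed

lemma nice_Lq:
  fixes f :: "real ^ 'n \<Rightarrow> complex"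
  assumes "nice f" "q > 0" shows "f \<in> Lq q"
proof -
  have [measurable]: "f \<in> borel_measurable lebesgue" using assms by (simp add: nice_def)
  obtain M where M: "\<And>x. norm (f x) \<le> M" using assms by (auto simp: nice_def bounded_iff)
  then have M0: "M \<ge> 0" using norm_ge_zero order_trans by blast
  obtain r where "\<forall>y\<in>{y. f y \<noteq> 0}. norm y \<le> r" using assms unfolding nice_def bounded_iff by blast
  then have r: "{y. f y \<noteq> 0} \<subseteq> cball 0 r" by auto
  have "power_integral q f \<le> (\<integral>\<^sup>+x. ennreal (M powr q) * indicator (cball (0 :: real ^ 'n) r) x \<partial>lebesgue)"
    unfolding power_integral_def
    using M r assms(2) by (intro nn_integral_mono) (auto simp: indicator_def intro!: ennreal_leI powr_mono2)
  also have "\<dots> = ennreal (M powr q) * emeasure lebesgue (cball 0 r :: (real ^ 'n) set)"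
    by (subst nn_integral_cmult_indicator) auto
  also have "\<dots> < \<infinity>"
    using emeasure_lborel_cball_finite[of "0 :: real ^ 'n" r] by (simp add: emeasure_completion ennreal_mult_less_top less_top)
  finally show ?thesis by (simp add: Lq_iff)
qed

lemma nice_integrable:
  assumes "nice f" shows "integrable lebesgue f"
proof -
  have "power_integral 1 f < \<infinity>" using nice_Lq[OF assms, of 1] by (simp add: Lq_iff)
  then show ?thesis using assms by (simp add: power_integral_def integrable_iff_bounded nice_def)
qed

lemma compact_closure_support: "nice f \<Longrightarrow> compact (closure {y. f y \<noteq> 0})"
  by (simp add: nice_def compact_closure)

lemma Lq_add:
  assumes "f \<in> Lq q" "g \<in> Lq q" "q > 0" shows "(\<lambda>y. f y + g y) \<in> Lq q"
proof -
  have [measurable]: "f \<in> borel_measurable lebesgue" "g \<in> borel_measurable lebesgue"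
    using assms by (auto simp: Lq_def)
  have ptw: "norm (f y + g y) powr q \<le> 2 powr q * (norm (f y) powr q) + 2 powr q * (norm (g y) powr q)" for y
  proof -
    have "norm (f y + g y) \<le> 2 * max (norm (f y)) (norm (g y))"
      using norm_triangle_ineq[of "f y" "g y"] by (auto simp: max_def)
    then have "norm (f y + g y) powr q \<le> (2 * max (norm (f y)) (norm (g y))) powr q"
      using assms(3) by (intro powr_mono2) auto
    also have "\<dots> = 2 powr q * max (norm (f y)) (norm (g y)) powr q" by (simp add: powr_mult)
    also have "\<dots> \<le> 2 powr q * (norm (f y) powr q + norm (g y) powr q)"
      by (intro mult_left_mono) (auto simp: max_def)
    finally show ?thesis by (simp add: distrib_left)
  qed
  have "integrable lebesgue (\<lambda>y. 2 powr q * (norm (f y) powr q) + 2 powr q * (norm (g y) powr q))"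
    using assms by (auto simp: Lq_def)
  then have "integrable lebesgue (\<lambda>y. norm (f y + g y) powr q)"
    by (rule Bochner_Integration.integrable_bound) (use ptw in \<open>auto intro!: AE_I2 order_trans[OF ptw] simp: abs_of_nonneg\<close>)
  then show ?thesis by (simp add: Lq_def)
qed

lemma Lq_cmult:
  assumes "f \<in> Lq q" shows "(\<lambda>y. c * f y) \<in> Lq q"
proof -
  have "(\<lambda>y. norm (c * f y) powr q) = (\<lambda>y. norm c powr q * (norm (f y) powr q))"
    by (simp add: norm_mult powr_mult)
  then show ?thesis using assms by (auto simp: Lq_def)
qed

lemma zero_Lq: "(\<lambda>_. 0) \<in> Lq q"
  by (simp add: Lq_def)

text \<open>The kernel formula can be asked for \<open>nice\<close> functions because a bounded set
  has compact closure here.\<close>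

locale cz_lq = dini_kernel K A B w for K :: "real ^ 'n \<Rightarrow> real ^ 'n \<Rightarrow> complex" and A B w +
  fixes T :: "(real ^ 'n \<Rightarrow> complex) \<Rightarrow> (real ^ 'n \<Rightarrow> complex)" and q N :: real
  assumes q: "1 \<le> q" and N: "N \<ge> 0"
    and T_Lq: "\<And>f. f \<in> Lq q \<Longrightarrow> T f \<in> Lq q"
    and T_add: "\<And>f g. f \<in> Lq q \<Longrightarrow> g \<in> Lq q \<Longrightarrow> AE x in lebesgue. T (\<lambda>y. f y + g y) x = T f x + T g x"
    and T_scale: "\<And>f c. f \<in> Lq q \<Longrightarrow> AE x in lebesgue. T (\<lambda>y. c * f y) x = c * T f x"
    and T_norm: "\<And>f. f \<in> Lq q \<Longrightarrow> Lq_norm q (T f) \<le> N * Lq_norm q f"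
    and T_repr: "\<And>f. nice f \<Longrightarrow> AE x in lebesgue. x \<notin> closure {y. f y \<noteq> 0} \<longrightarrow>
      has_bochner_integral lebesgue (\<lambda>y. K x y * f y) (T f x)"
begin

lemma T_measurable: "f \<in> Lq q \<Longrightarrow> T f \<in> borel_measurable lebesgue"
  using T_Lq by (simp add: Lq_def)

lemma power_integral_T:
  assumes "f \<in> Lq q"
  shows "power_integral q (T f) \<le> ennreal (N powr q) * power_integral q f"
proof -
  define I where "I = (LINT x|lebesgue. norm (f x) powr q)"
  define J where "J = (LINT x|lebesgue. norm (T f x) powr q)"
  have nn: "I \<ge> 0" "J \<ge> 0" unfolding I_def J_def by (auto intro!: integral_nonneg_AE)
  have "J powr (1 / q) \<le> N * I powr (1 / q)"
    using T_norm[OF assms] by (simp add: Lq_norm_def I_def J_def)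
  then have "(J powr (1 / q)) powr q \<le> (N * I powr (1 / q)) powr q"
    using q by (intro powr_mono2) auto
  then have "J \<le> N powr q * I" using q nn N by (simp add: powr_powr powr_mult)
  then show ?thesis
    unfolding power_integral_Lq[OF assms] power_integral_Lq[OF T_Lq[OF assms]] I_def[symmetric] J_def[symmetric]
    using nn by (simp add: ennreal_mult[symmetric] ennreal_leI)
qed

lemma superlevel_T_Lq:
  assumes "f \<in> Lq q" "t > 0"
  shows "ennreal (t powr q) * superlevel (T f) t \<le> ennreal (N powr q) * power_integral q f"
  using chebyshev_power[OF T_measurable[OF assms(1)] assms(2), of q] power_integral_T[OF assms(1)] q
  by (meson order_trans zero_le_one)

lemma T_sum:
  assumes "finite J" "\<And>p. p \<in> J \<Longrightarrow> b p \<in> Lq q"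
  shows "(\<lambda>y. \<Sum>p\<in>J. b p y) \<in> Lq q \<and> (AE x in lebesgue. T (\<lambda>y. \<Sum>p\<in>J. b p y) x = (\<Sum>p\<in>J. T (b p) x))"
  using assms
proof (induction J rule: finite_induct)
  case empty
  \<comment> \<open>\<open>T 0 = 0\<close> almost everywhere is obtained by scaling with 0.\<close>
  have "AE x in lebesgue. T (\<lambda>y. 0 * (0 :: complex)) x = 0 * T (\<lambda>_. 0) x"
    by (rule T_scale[OF zero_Lq])
  then show ?case by (simp add: zero_Lq)
next
  case (insert p J)
  then have Lq: "b p \<in> Lq q" "(\<lambda>y. \<Sum>p\<in>J. b p y) \<in> Lq q" by auto
  have "AE x in lebesgue. T (\<lambda>y. \<Sum>p\<in>J. b p y) x = (\<Sum>p\<in>J. T (b p) x)" using insert by auto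
  moreover have "AE x in lebesgue. T (\<lambda>y. b p y + (\<Sum>p\<in>J. b p y)) x = T (b p) x + T (\<lambda>y. \<Sum>p\<in>J. b p y) x"
    by (rule T_add[OF Lq])
  ultimately have "AE x in lebesgue. T (\<lambda>y. \<Sum>p\<in>insert p J. b p y) x = (\<Sum>p\<in>insert p J. T (b p) x)"
    by eventually_elim (use insert.hyps in simp)
  then show ?case using Lq_add[OF Lq] q insert.hyps by simp
qed

text \<open>The dilated balls are paid for by their measure. Outside them every piece is dominated
  by its tail, whose integral is bounded independently of the scale, and Chebyshev's inequality
  applies to the sum of the tails weighted by the masses.\<close>

lemma superlevel_bad_sum:
  fixes b :: "'i \<Rightarrow> real ^ 'n \<Rightarrow> complex"
  assumes J: "finite J" and t: "t > 0"
    and b: "\<And>p. p \<in> J \<Longrightarrow> nice (b p)" "\<And>p. p \<in> J \<Longrightarrow> (LINT y|lebesgue. b p y) = 0"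
    and l: "\<And>p. p \<in> J \<Longrightarrow> l p > 0" and supp: "\<And>p y. p \<in> J \<Longrightarrow> b p y \<noteq> 0 \<Longrightarrow> y \<in> near (l p) (c p)"
    and mass: "\<And>p. p \<in> J \<Longrightarrow> (\<integral>\<^sup>+y. ennreal (norm (b p y)) \<partial>lebesgue) \<le> ennreal (\<beta> p)"
    and \<beta>: "\<And>p. p \<in> J \<Longrightarrow> \<beta> p \<ge> 0"
  shows "ennreal t * superlevel (T (\<lambda>y. \<Sum>p\<in>J. b p y)) t
    \<le> (\<Sum>p\<in>J. ennreal (t * (2 * 2 ^ j0 * l p) ^ CARD('n) + 4 ^ CARD('n) * osc_const * \<beta> p))"
proof -
  have bLq: "b p \<in> Lq q" if "p \<in> J" for p using b that q by (intro nice_Lq) auto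
  define \<Omega> where "\<Omega> = (\<Union>p\<in>J. near (2 ^ j0 * l p) (c p))"
  define S where "S x = (\<Sum>p\<in>J. tail (c p) (l p) x * ennreal (\<beta> p))" for x
  have [measurable]: "\<Omega> \<in> sets lebesgue" unfolding \<Omega>_def using J by (intro sets.finite_UN) auto
  have [measurable]: "S \<in> borel_measurable lebesgue" unfolding S_def by measurable
  have piece: "AE x in lebesgue. x \<notin> \<Omega> \<longrightarrow> ennreal (norm (T (b p) x)) \<le> tail (c p) (l p) x * ennreal (\<beta> p)"
    if p: "p \<in> J" for p
    using T_repr[OF b(1)[OF p]]
  proof eventually_elim
    case (elim x)
    show ?case
    proof
      assume "x \<notin> \<Omega>"
      then have x: "x \<notin> near (2 ^ j0 * l p) (c p)" using p by (auto simp: \<Omega>_def)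
      \<comment> \<open>The closure of the support lies in the closed ball of radius
        \<open>l p\<close>, hence inside the open dilated ball because \<open>2 ^ j0\<close> is at
        least 2.\<close>
      have "x \<notin> closure {y. b p y \<noteq> 0}"
      proof
        assume "x \<in> closure {y. b p y \<noteq> 0}"
        moreover have "{y. b p y \<noteq> 0} \<subseteq> {y. \<forall>i. \<bar>y $ i - c p $ i\<bar> \<le> l p}"
          using supp[OF p] by (auto simp: near_def intro: less_imp_le)
        moreover have "closed {y :: real ^ 'n. \<forall>i. \<bar>y $ i - c p $ i\<bar> \<le> l p}"
          by (intro closed_Collect_all closed_Collect_le continuous_intros)
        ultimately have *: "\<And>i. \<bar>x $ i - c p $ i\<bar> \<le> l p" using closure_minimal by blast
        have "2 ^ 1 * l p \<le> 2 ^ j0 * l p"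
          using l[OF p] by (intro mult_right_mono power_increasing) (auto simp: j0_def)
        then have "l p < 2 ^ j0 * l p" using l[OF p] by simp
        then have "x \<in> near (2 ^ j0 * l p) (c p)" using * by (auto simp: near_def intro: le_less_trans)
        then show False using x by simp
      qed
      then have "has_bochner_integral lebesgue (\<lambda>y. K x y * b p y) (T (b p) x)" using elim by blast
      then have "ennreal (norm (T (b p) x)) \<le> tail (c p) (l p) x * (\<integral>\<^sup>+y. ennreal (norm (b p y)) \<partial>lebesgue)"
        using x l[OF p] b[OF p] supp[OF p] by (intro bad_part_bound nice_integrable) auto
      also have "\<dots> \<le> tail (c p) (l p) x * ennreal (\<beta> p)" by (intro mult_left_mono mass p) auto
      finally show "ennreal (norm (T (b p) x)) \<le> tail (c p) (l p) x * ennreal (\<beta> p)" .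
    qed
  qed
  have "AE x in lebesgue. \<forall>p\<in>J. x \<notin> \<Omega> \<longrightarrow> ennreal (norm (T (b p) x)) \<le> tail (c p) (l p) x * ennreal (\<beta> p)"
    using J piece by (intro AE_finite_allI) auto
  moreover have "AE x in lebesgue. T (\<lambda>y. \<Sum>p\<in>J. b p y) x = (\<Sum>p\<in>J. T (b p) x)" using T_sum[OF J bLq] by simp
  ultimately have "AE x in lebesgue. x \<in> {x. t < norm (T (\<lambda>y. \<Sum>p\<in>J. b p y) x)} \<longrightarrow> x \<in> \<Omega> \<union> {x. ennreal t \<le> S x}"
  proof eventually_elim
    case (elim x)
    show ?case
    proof
      assume big: "x \<in> {x. t < norm (T (\<lambda>y. \<Sum>p\<in>J. b p y) x)}"
      have "ennreal t \<le> S x" if "x \<notin> \<Omega>"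
      proof -
        have "t \<le> norm (\<Sum>p\<in>J. T (b p) x)" using big elim by simp
        also have "\<dots> \<le> (\<Sum>p\<in>J. norm (T (b p) x))" by (rule norm_sum)
        finally have "ennreal t \<le> (\<Sum>p\<in>J. ennreal (norm (T (b p) x)))" by (simp add: sum_ennreal ennreal_leI)
        also have "\<dots> \<le> S x" unfolding S_def using elim that by (intro sum_mono) auto
        finally show ?thesis .
      qed
      then show "x \<in> \<Omega> \<union> {x. ennreal t \<le> S x}" by blast
    qed
  qed
  moreover have SS: "{x. ennreal t \<le> S x} \<in> sets lebesgue"
  proof -
    have "{x \<in> space lebesgue. ennreal t \<le> S x} \<in> sets lebesgue" by measurable
    then show ?thesis by simp
  qed
  ultimately have "superlevel (T (\<lambda>y. \<Sum>p\<in>J. b p y)) t \<le> emeasure lebesgue (\<Omega> \<union> {x. ennreal t \<le> S x})"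
    unfolding superlevel_def by (intro emeasure_mono_AE) auto
  also have "\<dots> \<le> emeasure lebesgue \<Omega> + emeasure lebesgue {x. ennreal t \<le> S x}"
    using SS by (intro emeasure_subadditive) auto
  finally have "ennreal t * superlevel (T (\<lambda>y. \<Sum>p\<in>J. b p y)) t
      \<le> ennreal t * emeasure lebesgue \<Omega> + ennreal t * emeasure lebesgue {x. ennreal t \<le> S x}"
    by (metis distrib_left mult_left_mono zero_le)
  also have "ennreal t * emeasure lebesgue {x. ennreal t \<le> S x} \<le> (\<Sum>p\<in>J. ennreal (4 ^ CARD('n) * osc_const * \<beta> p))"
  proof -
    have "ennreal t * emeasure lebesgue {x. ennreal t \<le> S x} = (\<integral>\<^sup>+x. ennreal t * indicator {x. ennreal t \<le> S x} x \<partial>lebesgue)"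
      using SS by (subst nn_integral_cmult_indicator) auto
    also have "\<dots> \<le> (\<integral>\<^sup>+x. S x \<partial>lebesgue)" by (rule nn_integral_mono) (auto simp: indicator_def)
    also have "\<dots> = (\<Sum>p\<in>J. (\<integral>\<^sup>+x. tail (c p) (l p) x \<partial>lebesgue) * ennreal (\<beta> p))"
      unfolding S_def by (subst nn_integral_sum) (auto simp: nn_integral_multc)
    also have "\<dots> \<le> (\<Sum>p\<in>J. ennreal (4 ^ CARD('n) * osc_const) * ennreal (\<beta> p))"
      by (intro sum_mono mult_right_mono nn_integral_tail l) auto
    also have "\<dots> = (\<Sum>p\<in>J. ennreal (4 ^ CARD('n) * osc_const * \<beta> p))"
      using \<beta> osc_const_nonneg by (intro sum.cong) (auto simp: ennreal_mult[symmetric])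
    finally show ?thesis .
  qed
  also have "ennreal t * emeasure lebesgue \<Omega> \<le> (\<Sum>p\<in>J. ennreal (t * (2 * 2 ^ j0 * l p) ^ CARD('n)))"
  proof -
    have "emeasure lebesgue \<Omega> \<le> (\<Sum>p\<in>J. emeasure lebesgue (near (2 ^ j0 * l p) (c p)))"
      unfolding \<Omega>_def using J by (intro emeasure_subadditive_finite) auto
    also have "\<dots> \<le> (\<Sum>p\<in>J. ennreal ((2 * 2 ^ j0 * l p) ^ CARD('n)))"
    proof (rule sum_mono)
      fix p assume "p \<in> J"
      then show "emeasure lebesgue (near (2 ^ j0 * l p) (c p)) \<le> ennreal ((2 * 2 ^ j0 * l p) ^ CARD('n))"
        using emeasure_near[of "2 ^ j0 * l p" "c p"] l[of p] by (simp add: mult.assoc)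
    qed
    finally have "ennreal t * emeasure lebesgue \<Omega> \<le> ennreal t * (\<Sum>p\<in>J. ennreal ((2 * 2 ^ j0 * l p) ^ CARD('n)))"
      by (intro mult_left_mono) auto
    also have "\<dots> = (\<Sum>p\<in>J. ennreal (t * (2 * 2 ^ j0 * l p) ^ CARD('n)))"
      unfolding sum_distrib_left using t l by (intro sum.cong refl) (simp add: ennreal_mult less_imp_le)
    finally show ?thesis .
  qed
  finally have "ennreal t * superlevel (T (\<lambda>y. \<Sum>p\<in>J. b p y)) t
      \<le> (\<Sum>p\<in>J. ennreal (t * (2 * 2 ^ j0 * l p) ^ CARD('n))) + (\<Sum>p\<in>J. ennreal (4 ^ CARD('n) * osc_const * \<beta> p))"
    by (simp add: add_right_mono)
  also have "\<dots> = (\<Sum>p\<in>J. ennreal (t * (2 * 2 ^ j0 * l p) ^ CARD('n) + 4 ^ CARD('n) * osc_const * \<beta> p))"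
    unfolding sum.distrib[symmetric]
  proof (intro sum.cong refl ennreal_plus[symmetric])
    fix p assume "p \<in> J"
    then show "0 \<le> t * (2 * 2 ^ j0 * l p) ^ CARD('n)" "0 \<le> 4 ^ CARD('n) * osc_const * \<beta> p"
      using t l[of p] \<beta>[of p] osc_const_nonneg by auto
  qed
  finally show ?thesis .
qed


text \<open>The three terms belong to the good part, the dilated cells and the tails of the bad
  part. In the first, \<open>(2 ^ CARD('n)) powr q\<close> comes from the means on the cells and 2
  from the points outside all cells together with the leftover cells. In the last,
  \<open>2 * 2 ^ CARD('n)\<close> is the mass of a bad piece relative to the level times the volume.
  The remaining powers of 2 are due to halving the level, except in the volume factors.\<close>

definition nice_const :: real where
  "nice_const = 2 powr q * N powr q * ((2 ^ CARD('n)) powr q + 2) + (2 * 2 ^ j0) ^ CARD('n)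
     + 2 * 4 ^ CARD('n) * osc_const * (2 * 2 ^ CARD('n))"

lemma nice_const_nonneg: "nice_const \<ge> 0"
  unfolding nice_const_def using osc_const_nonneg by (intro add_nonneg_nonneg mult_nonneg_nonneg) auto

text \<open>The cells outside a finite subfamily of the Calderon-Zygmund cells are left in the good
  part: their union is so small that boundedness of \<open>f\<close> controls it, and the bad part becomes a
  finite sum.\<close>

lemma weak_type_nice:
  assumes f: "nice f" and t: "t > 0"
  shows "ennreal t * superlevel (T f) t \<le> ennreal nice_const * (\<integral>\<^sup>+x. ennreal (norm (f x)) \<partial>lebesgue)"
proof -
  define a :: "int \<Rightarrow> real ^ 'n" where "a = (\<lambda>_. 0)"
  interpret grid a unfolding a_def by (rule grid_const)
  define h where "h = (\<lambda>x. ennreal (norm (f x)))"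
  define d where "d = CARD('n)"
  have q0: "q > 0" "q \<ge> 0" using q by auto
  have fm [measurable]: "f \<in> borel_measurable lebesgue" using f by (simp add: nice_def)
  have [measurable]: "h \<in> borel_measurable lebesgue" unfolding h_def by measurable
  have fint: "integrable lebesgue f" using f by (rule nice_integrable)
  define I where "I = (LINT x|lebesgue. norm (f x))"
  have I: "(\<integral>\<^sup>+x. h x \<partial>lebesgue) = ennreal I" "I \<ge> 0"
    unfolding I_def h_def using fint by (auto intro!: nn_integral_eq_integral integral_nonneg_AE)
  obtain M where M: "\<And>x. norm (f x) \<le> M" using f by (auto simp: nice_def bounded_iff)
  then have M0: "M \<ge> 0" using norm_ge_zero order_trans by blast
  \<comment> \<open>Zero mass is treated apart: it would make the tolerance \<delta> below vanish,
    while the \<open>L^q\<close> bound already gives \<open>T f = 0\<close>.\<close>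
  show ?thesis
  proof (cases "I = 0")
    case True
    then have "(\<integral>\<^sup>+x. h x \<partial>lebesgue) = 0" using I by simp
    then have "AE x in lebesgue. f x = 0"
      by (subst (asm) nn_integral_0_iff_AE) (auto simp: h_def)
    then have "power_integral q f = 0" by (rule power_integral_AE_0)
    then have "ennreal (t powr q) * superlevel (T f) t \<le> 0"
      using superlevel_T_Lq[OF nice_Lq[OF f q0(1)] t] by simp
    then show ?thesis using t by auto
  next
    case False
    then have Ipos: "I > 0" using I by simp
    define H where "H = heavy h (ennreal t)"
    define MM where "MM = maximal_cells a H"
    \<comment> \<open>An exhaustion of the countable family by finite subfamilies, along an
      enumeration of the addresses; \<open>W n\<close> is what \<open>J n\<close> leaves
      out.\<close>
    define J where "J n = {p \<in> MM. to_nat p < n}" for n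
    define W where "W n = \<Union> (cell a ` (MM - J n))" for n
    have fin: "(\<integral>\<^sup>+y. h y \<partial>lebesgue) < \<infinity>" using I by simp
    obtain L where "\<And>p. p \<in> H \<Longrightarrow> fst p \<le> L" unfolding H_def using heavy_level_bound[OF fin t] by blast
    then have Un_eq: "\<Union> (cell a ` MM) = \<Union> (cell a ` H)" unfolding MM_def by (rule Union_maximal_cells)
    have disj: "disjoint_family_on (cell a) MM" unfolding MM_def by (rule maximal_cells_disjoint)
    have H_meas: "ennreal t * emeasure lebesgue (\<Union> (cell a ` MM)) \<le> ennreal I"
      unfolding Un_eq H_def I(1)[symmetric] by (rule emeasure_heavy[OF _ fin t]) measurable
    have MM_fin: "emeasure lebesgue (\<Union> (cell a ` MM)) < \<infinity>"
    proof (rule ccontr)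
      assume "\<not> ?thesis"
      then have "emeasure lebesgue (\<Union> (cell a ` MM)) = top" by (simp add: not_less top_unique)
      then show False using H_meas t by (simp add: ennreal_mult_top top_unique)
    qed
    have finJ: "finite (J n)" for n
    proof -
      have "finite (to_nat ` J n)" by (rule finite_subset[of _ "{..<n}"]) (auto simp: J_def)
      then show ?thesis by (rule finite_imageD) (auto intro: inj_on_subset[OF inj_to_nat])
    qed
    have Wm [measurable]: "W n \<in> sets lebesgue" for n unfolding W_def by (rule measurable_Union_cells)
    have "(\<lambda>n. emeasure lebesgue (W n)) \<longlonglongrightarrow> emeasure lebesgue (\<Inter>n. W n)"
    proof (rule Lim_emeasure_decseq)
      show "range W \<subseteq> sets lebesgue" by auto
      show "decseq W" unfolding decseq_def W_def J_def by fastforce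
      fix n have "emeasure lebesgue (W n) \<le> emeasure lebesgue (\<Union> (cell a ` MM))"
        by (rule emeasure_mono) (auto simp: W_def intro: measurable_Union_cells)
      then show "emeasure lebesgue (W n) \<noteq> \<infinity>" using MM_fin by (auto simp: top_unique)
    qed
    moreover have "(\<Inter>n. W n) = {}"
    proof (rule ccontr)
      assume "(\<Inter>n. W n) \<noteq> {}"
      then obtain x where x: "\<And>n. x \<in> W n" by blast
      obtain p where p: "p \<in> MM" "x \<in> cell a p" using x[of 0] by (auto simp: W_def)
      obtain p' where p': "p' \<in> MM - J (Suc (to_nat p))" "x \<in> cell a p'" using x[of "Suc (to_nat p)"] by (auto simp: W_def)
      then have "p' = p" using p disj unfolding disjoint_family_on_def by blast
      then show False using p p' by (simp add: J_def)
    qed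
    ultimately have Wlim: "(\<lambda>n. emeasure lebesgue (W n)) \<longlonglongrightarrow> 0" by simp
    \<comment> \<open>Small enough that the crude bound \<open>M\<close> on the leftover set
      contributes no more than the points outside all cells; the added 1 covers
      \<open>M = 0\<close>.\<close>
    define \<delta> where "\<delta> = t powr (q - 1) * I / (M powr q + 1)"
    have Mq: "M powr q + 1 > 0" using powr_ge_zero[of M q] by linarith
    have \<delta>: "\<delta> > 0" unfolding \<delta>_def using t Ipos Mq by simp
    obtain n where n: "emeasure lebesgue (W n) < ennreal \<delta>"
      using order_tendstoD(2)[OF Wlim, of "ennreal \<delta>"] \<delta> by (auto simp: eventually_sequentially)
    have MqW: "ennreal (M powr q) * emeasure lebesgue (W n) \<le> ennreal (t powr (q - 1) * I)"
    proof -
      have "ennreal (M powr q) * emeasure lebesgue (W n) \<le> ennreal (M powr q) * ennreal \<delta>"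
        using n by (intro mult_left_mono) auto
      also have "\<dots> = ennreal (M powr q * \<delta>)" using \<delta> by (simp add: ennreal_mult)
      also have "M powr q * \<delta> \<le> (M powr q + 1) * \<delta>" using \<delta> by (intro mult_right_mono) auto
      also have "(M powr q + 1) * \<delta> = t powr (q - 1) * I" unfolding \<delta>_def using Mq by simp
      finally show ?thesis by (simp add: ennreal_leI)
    qed
    define m where "m p = (LINT y:cell a p|lebesgue. f y) /\<^sub>R vol p" for p
    define b where "b p y = indicator (cell a p) y *\<^sub>R (f y - m p)" for p y
    \<comment> \<open>The mean on each cell of \<open>J n\<close>, and \<open>f\<close> itself
      elsewhere, including the leftover cells.\<close>
    define g where "g y = f y - (\<Sum>p\<in>J n. b p y)" for y
    have JM: "J n \<subseteq> MM" by (auto simp: J_def)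
    \<comment> \<open>The parent of a maximal heavy cell is not heavy, whence the factor
      \<open>2 ^ d\<close>.\<close>
    have cell_h: "(\<integral>\<^sup>+y\<in>cell a p. h y \<partial>lebesgue) \<le> ennreal (2 ^ d * t * vol p)" if p: "p \<in> MM" for p
    proof -
      obtain r where r: "cell a p \<subseteq> cell a r" "fst r = fst p + 1" "vol r = 2 ^ CARD('n) * vol p"
        by (rule parent_cell)
      have "r \<notin> H" using parent_not_in_of_maximal[of p H r] p r by (simp add: MM_def)
      then have "(\<integral>\<^sup>+y\<in>cell a r. h y \<partial>lebesgue) \<le> ennreal t * emeasure lebesgue (cell a r)"
        by (simp add: H_def heavy_def not_less)
      also have "\<dots> = ennreal (2 ^ d * t * vol p)"
        using t unfolding emeasure_cell r(3) d_def by (simp add: ennreal_mult[symmetric] mult_ac)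
      finally show ?thesis using nn_set_integral_set_mono[OF r(1)] order_trans by blast
    qed
    have m_le: "norm (m p) \<le> 2 ^ d * t" if p: "p \<in> MM" for p
    proof -
      have i: "integrable lebesgue (\<lambda>y. indicator (cell a p) y *\<^sub>R f y)"
        by (rule integrable_mult_indicator[OF sets_cell fint])
      have "ennreal (norm (LINT y:cell a p|lebesgue. f y)) \<le> (\<integral>\<^sup>+y. norm (indicator (cell a p) y *\<^sub>R f y) \<partial>lebesgue)"
        unfolding set_lebesgue_integral_def by (rule integral_norm_bound_ennreal[OF i])
      also have "\<dots> = (\<integral>\<^sup>+y\<in>cell a p. h y \<partial>lebesgue)"
        by (rule nn_integral_cong) (auto simp: h_def indicator_def)
      also have "\<dots> \<le> ennreal (2 ^ d * t * vol p)" by (rule cell_h[OF p])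
      finally have "norm (LINT y:cell a p|lebesgue. f y) \<le> 2 ^ d * t * vol p"
        using t by (subst (asm) ennreal_le_iff) auto
      then show ?thesis by (simp add: m_def field_simps)
    qed
    have b_meas [measurable]: "b p \<in> borel_measurable lebesgue" for p
    proof -
      have "(\<lambda>y. indicator (cell a p) y *\<^sub>R (f y - m p)) \<in> borel_measurable lebesgue" by measurable
      then show ?thesis by (simp add: b_def[abs_def])
    qed
    have b_nice: "nice (b p)" if "p \<in> MM" for p
      unfolding nice_def
    proof (intro conjI)
      show "bounded (range (b p))"
        unfolding bounded_iff
      proof (intro exI ballI)
        fix z assume "z \<in> range (b p)"
        then obtain y where "z = b p y" by blast
        moreover have "norm (f y - m p) \<le> M + norm (m p)"
          using M[of y] norm_triangle_ineq4[of "f y" "m p"] by linarith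
        moreover have "norm (b p y) \<le> norm (f y - m p)" by (simp add: b_def indicator_def)
        ultimately show "norm z \<le> M + norm (m p)" by simp
      qed
      obtain x where x: "x \<in> cell a p" using cell_nonempty by blast
      have "{y. b p y \<noteq> 0} \<subseteq> cball x (real CARD('n) * 2 powi fst p)"
      proof
        fix y assume "y \<in> {y. b p y \<noteq> 0}"
        then have "y \<in> cell a p" by (auto simp: b_def indicator_def split: if_splits)
        then have "norm (x - y) \<le> real CARD('n) * 2 powi fst p"
          using cell_dist[OF x] by (intro norm_le_of_components) (auto intro: less_imp_le)
        then show "y \<in> cball x (real CARD('n) * 2 powi fst p)" by (simp add: dist_norm)
      qed
      then show "bounded {y. b p y \<noteq> 0}" by (rule bounded_subset[OF bounded_cball])
    qed (rule b_meas)
    have cell_int: "integrable lebesgue (\<lambda>y. indicator (cell a p) y *\<^sub>R c)" for p and c :: complex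
      using emeasure_cell[of a p] by (intro integrable_scaleR_left integrable_real_indicator) auto
    have b_mean: "(LINT y|lebesgue. b p y) = 0" for p
    proof -
      have "(LINT y|lebesgue. b p y) = (LINT y|lebesgue. indicator (cell a p) y *\<^sub>R f y - indicator (cell a p) y *\<^sub>R m p)"
        by (simp add: b_def scaleR_diff_right)
      also have "\<dots> = (LINT y:cell a p|lebesgue. f y) - (LINT y|lebesgue. indicator (cell a p) y *\<^sub>R m p)"
        unfolding set_lebesgue_integral_def
        by (rule Bochner_Integration.integral_diff[OF integrable_mult_indicator[OF sets_cell fint] cell_int])
      also have "(LINT y|lebesgue. indicator (cell a p) y *\<^sub>R m p) = vol p *\<^sub>R m p"
        using emeasure_cell[of a p] measure_cell[of a p] by (subst integral_scaleR_left) auto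
      finally show ?thesis by (simp add: m_def)
    qed
    have b_mass: "(\<integral>\<^sup>+y. ennreal (norm (b p y)) \<partial>lebesgue) \<le> ennreal (2 * 2 ^ d * t * vol p)" if p: "p \<in> MM" for p
    proof -
      have "(\<integral>\<^sup>+y. ennreal (norm (b p y)) \<partial>lebesgue)
          \<le> (\<integral>\<^sup>+y. h y * indicator (cell a p) y + ennreal (2 ^ d * t) * indicator (cell a p) y \<partial>lebesgue)"
      proof (rule nn_integral_mono)
        fix y
        have "norm (f y - m p) \<le> norm (f y) + 2 ^ d * t"
          using norm_triangle_ineq4[of "f y" "m p"] m_le[OF p] by linarith
        then have "ennreal (norm (f y - m p)) \<le> h y + ennreal (2 ^ d * t)"
          unfolding h_def using t by (subst ennreal_plus[symmetric]) (auto intro: ennreal_leI simp del: ennreal_plus)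
        then show "ennreal (norm (b p y)) \<le> h y * indicator (cell a p) y + ennreal (2 ^ d * t) * indicator (cell a p) y"
          by (simp add: b_def indicator_def)
      qed
      also have "\<dots> = (\<integral>\<^sup>+y\<in>cell a p. h y \<partial>lebesgue) + ennreal (2 ^ d * t) * emeasure lebesgue (cell a p)"
        by (subst nn_integral_add) (auto simp: nn_integral_cmult_indicator)
      also have "\<dots> \<le> ennreal (2 ^ d * t * vol p) + ennreal (2 ^ d * t * vol p)"
        using t by (intro add_mono cell_h p) (simp add: emeasure_cell ennreal_mult)
      also have "\<dots> = ennreal (2 * 2 ^ d * t * vol p)"
        using t by (subst ennreal_plus[symmetric]) auto
      finally show ?thesis .
    qed
    have g_in: "g y = m p" if p: "p \<in> J n" "y \<in> cell a p" for p y
    proof -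
      have "(\<Sum>p\<in>J n. b p y) = (\<Sum>p'\<in>{p}. b p' y)"
      proof (rule sum.mono_neutral_right[OF finJ])
        show "\<forall>i\<in>J n - {p}. b i y = 0"
        proof
          fix i assume i: "i \<in> J n - {p}"
          then have "cell a i \<inter> cell a p = {}" using disj p JM unfolding disjoint_family_on_def by blast
          then have "y \<notin> cell a i" using p by blast
          then show "b i y = 0" by (simp add: b_def)
        qed
      qed (use p in auto)
      then show ?thesis using p by (simp add: g_def b_def)
    qed
    have g_out: "g y = f y" if "y \<notin> \<Union> (cell a ` J n)" for y
    proof -
      have "(\<Sum>p\<in>J n. b p y) = 0" using that by (intro sum.neutral) (auto simp: b_def)
      then show ?thesis by (simp add: g_def)
    qed
    have g_meas [measurable]: "g \<in> borel_measurable lebesgue" unfolding g_def[abs_def] by measurable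
    have f_le: "AE y in lebesgue. y \<notin> \<Union> (cell a ` MM) \<longrightarrow> norm (f y) \<le> t"
    proof -
      have "AE x in lebesgue. (\<forall>k\<le>0. (\<integral>\<^sup>+y\<in>cell a (index a k x). h y \<partial>lebesgue)
          \<le> ennreal t * emeasure lebesgue (cell a (index a k x))) \<longrightarrow> h x \<le> ennreal t"
        by (rule AE_le_of_cell_averages) auto
      then show ?thesis
      proof eventually_elim
        case (elim x)
        show ?case
        proof
          assume "x \<notin> \<Union> (cell a ` MM)"
          then have "index a k x \<notin> H" for k unfolding Un_eq by (metis UN_I mem_cell_index)
          then have "h x \<le> ennreal t" using elim by (auto simp: H_def heavy_def not_less)
          then show "norm (f x) \<le> t" using t by (simp add: h_def)
        qed
      qed
    qed
    \<comment> \<open>Three regions: \<open>2 ^ d * t\<close> bounds the means on the cells of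
      \<open>J n\<close>, \<open>M\<close> bounds \<open>f\<close> on \<open>W n\<close>, and
      \<open>t\<close> bounds \<open>f\<close> almost everywhere outside all cells. Each contributes
      a multiple of \<open>t powr (q - 1) * I\<close>.\<close>
    have g_pow: "power_integral q g \<le> ennreal (((2 ^ d) powr q + 2) * t powr (q - 1) * I)"
    proof -
      have "power_integral q g \<le> (\<integral>\<^sup>+y. ennreal ((2 ^ d * t) powr q) * indicator (\<Union> (cell a ` MM)) y
          + (ennreal (t powr (q - 1)) * h y + ennreal (M powr q) * indicator (W n) y) \<partial>lebesgue)"
        unfolding power_integral_def
      proof (rule nn_integral_mono_AE)
        show "AE y in lebesgue. ennreal (norm (g y) powr q) \<le> ennreal ((2 ^ d * t) powr q) * indicator (\<Union> (cell a ` MM)) y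
          + (ennreal (t powr (q - 1)) * h y + ennreal (M powr q) * indicator (W n) y)"
          using f_le
        proof eventually_elim
          case (elim y)
          consider (J) "y \<in> \<Union> (cell a ` J n)" | (W) "y \<notin> \<Union> (cell a ` J n)" "y \<in> W n" | (out) "y \<notin> \<Union> (cell a ` MM)"
            using JM by (auto simp: W_def)
          then show ?case
          proof cases
            case J
            then obtain p where p: "p \<in> J n" "y \<in> cell a p" by blast
            then have "norm (g y) \<le> 2 ^ d * t" using g_in m_le JM by fastforce
            then have "norm (g y) powr q \<le> (2 ^ d * t) powr q" using q0 by (intro powr_mono2) auto
            moreover have "y \<in> \<Union> (cell a ` MM)" using J JM by blast
            ultimately show ?thesis by (auto intro!: ennreal_leI add_increasing2)
          next
            case W
            then have "norm (g y) powr q \<le> M powr q" using q0 M g_out by (auto intro: powr_mono2)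
            then show ?thesis using W by (auto intro!: ennreal_leI add_increasing)
          next
            case out
            then have gf: "g y = f y" "norm (f y) \<le> t" using g_out JM elim by blast+
            have "norm (f y) powr q \<le> t powr (q - 1) * norm (f y)"
            proof (cases "f y = 0")
              case False
              then have "norm (f y) powr q = norm (f y) powr (q - 1) * norm (f y)"
                using powr_add[of "norm (f y)" "q - 1" 1] by simp
              also have "\<dots> \<le> t powr (q - 1) * norm (f y)"
                using gf q by (intro mult_right_mono powr_mono2) auto
              finally show ?thesis .
            qed simp
            then have "ennreal (norm (g y) powr q) \<le> ennreal (t powr (q - 1)) * h y"
              unfolding h_def gf using t by (simp add: ennreal_mult[symmetric] ennreal_leI)
            then show ?thesis by (intro add_increasing add_increasing2) auto
          qed
        qed
      qed
      also have "\<dots> = ennreal ((2 ^ d * t) powr q) * emeasure lebesgue (\<Union> (cell a ` MM))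
          + (ennreal (t powr (q - 1)) * ennreal I + ennreal (M powr q) * emeasure lebesgue (W n))"
        using measurable_Union_cells[of a MM]
        by (simp add: nn_integral_add nn_integral_cmult nn_integral_cmult_indicator I)
      also have "\<dots> \<le> ennreal ((2 ^ d) powr q * t powr (q - 1) * I)
          + (ennreal (t powr (q - 1) * I) + ennreal (t powr (q - 1) * I))"
      proof (intro add_mono MqW)
        have "(2 ^ d * t) powr q = (2 ^ d) powr q * t powr (q - 1) * t"
          using t powr_add[of t "q - 1" 1] by (simp add: powr_mult)
        then have "ennreal ((2 ^ d * t) powr q) * emeasure lebesgue (\<Union> (cell a ` MM))
            = ennreal ((2 ^ d) powr q * t powr (q - 1)) * (ennreal t * emeasure lebesgue (\<Union> (cell a ` MM)))"
          using t by (simp add: ennreal_mult mult.assoc)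
        also have "\<dots> \<le> ennreal ((2 ^ d) powr q * t powr (q - 1)) * ennreal I"
          by (intro mult_left_mono H_meas) auto
        also have "\<dots> = ennreal ((2 ^ d) powr q * t powr (q - 1) * I)"
          using I by (simp add: ennreal_mult[symmetric])
        finally show "ennreal ((2 ^ d * t) powr q) * emeasure lebesgue (\<Union> (cell a ` MM))
            \<le> ennreal ((2 ^ d) powr q * t powr (q - 1) * I)" .
        show "ennreal (t powr (q - 1)) * ennreal I \<le> ennreal (t powr (q - 1) * I)"
          using I by (simp add: ennreal_mult)
      qed
      also have "\<dots> = ennreal (((2 ^ d) powr q + 2) * t powr (q - 1) * I)"
        using I t by (simp add: ennreal_plus[symmetric] algebra_simps del: ennreal_plus)
      finally show ?thesis .
    qed
    have gLq: "g \<in> Lq q" using g_pow by (auto simp: Lq_iff intro: le_less_trans)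
    have bLq: "b p \<in> Lq q" if "p \<in> J n" for p using b_nice JM that q0 by (blast intro: nice_Lq)
    let ?b = "\<lambda>y. \<Sum>p\<in>J n. b p y"
    have bsLq: "?b \<in> Lq q" using T_sum[of "J n" b] finJ bLq by blast
    have "AE x in lebesgue. T (\<lambda>y. g y + ?b y) x = T g x + T ?b x" by (rule T_add[OF gLq bsLq])
    then have "superlevel (T f) (t / 2 + t / 2) \<le> superlevel (T g) (t / 2) + superlevel (T ?b) (t / 2)"
      using gLq bsLq nice_Lq[OF f q0(1)] by (intro superlevel_add T_measurable) (auto simp: g_def)
    then have "ennreal t * superlevel (T f) t \<le> ennreal t * superlevel (T g) (t / 2) + ennreal t * superlevel (T ?b) (t / 2)"
      by (simp add: distrib_left[symmetric] mult_left_mono)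
    also have "ennreal t * superlevel (T g) (t / 2) \<le> ennreal (2 powr q * N powr q * ((2 ^ d) powr q + 2) * I)"
    proof -
      \<comment> \<open>The last factor is used up by Chebyshev's inequality at level
        \<open>t / 2\<close>; \<open>t powr (1 - q)\<close> cancels against the power of
        \<open>t\<close> in \<open>g_pow\<close>.\<close>
      have tq: "t = 2 powr q * t powr (1 - q) * (t / 2) powr q"
        using t powr_add[of t "1 - q" q] by (simp add: powr_divide)
      have "ennreal t * superlevel (T g) (t / 2)
          = ennreal (2 powr q * t powr (1 - q)) * (ennreal ((t / 2) powr q) * superlevel (T g) (t / 2))"
        by (subst tq) (simp add: ennreal_mult mult.assoc)
      also have "\<dots> \<le> ennreal (2 powr q * t powr (1 - q)) * (ennreal (N powr q) * power_integral q g)"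
        using t by (intro mult_left_mono superlevel_T_Lq gLq) auto
      also have "\<dots> \<le> ennreal (2 powr q * t powr (1 - q)) * (ennreal (N powr q) * ennreal (((2 ^ d) powr q + 2) * t powr (q - 1) * I))"
        by (intro mult_left_mono g_pow) auto
      also have "\<dots> = ennreal (2 powr q * t powr (1 - q) * (N powr q * (((2 ^ d) powr q + 2) * t powr (q - 1) * I)))"
        using I by (simp add: ennreal_mult[symmetric])
      also have "2 powr q * t powr (1 - q) * (N powr q * (((2 ^ d) powr q + 2) * t powr (q - 1) * I))
          = 2 powr q * N powr q * ((2 ^ d) powr q + 2) * I * (t powr (1 - q) * t powr (q - 1))"
        by (simp add: mult_ac)
      also have "t powr (1 - q) * t powr (q - 1) = 1" using t by (simp add: powr_add[symmetric])
      finally show ?thesis by simp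
    qed
    also have "ennreal t * superlevel (T ?b) (t / 2)
      \<le> ennreal ((2 * 2 ^ j0) ^ d * I + 2 * 4 ^ d * osc_const * (2 * 2 ^ d) * I)"
    proof -
      \<comment> \<open>Any point of a cell serves as centre: the cell lies in the ball around it
        whose radius is the side length.\<close>
      define c where "c p = (SOME x. x \<in> cell a p)" for p
      have c: "c p \<in> cell a p" for p unfolding c_def using cell_nonempty[of a p] by (auto intro: someI_ex)
      have "ennreal (t / 2) * superlevel (T ?b) (t / 2)
        \<le> (\<Sum>p\<in>J n. ennreal (t / 2 * (2 * 2 ^ j0 * 2 powi fst p) ^ CARD('n) + 4 ^ CARD('n) * osc_const * (2 * 2 ^ d * t * vol p)))"
      proof (rule superlevel_bad_sum[where c = c])
        show "y \<in> near (2 powi fst p) (c p)" if "p \<in> J n" "b p y \<noteq> 0" for p y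
        proof -
          have "y \<in> cell a p" using that by (auto simp: b_def indicator_def split: if_splits)
          then show ?thesis using cell_dist[OF _ c] by (auto simp: near_def)
        qed
        show "nice (b p)" if "p \<in> J n" for p using b_nice JM that by blast
        show "(\<integral>\<^sup>+y. ennreal (norm (b p y)) \<partial>lebesgue) \<le> ennreal (2 * 2 ^ d * t * vol p)" if "p \<in> J n" for p
          using b_mass JM that by blast
      qed (use t finJ b_mean in auto)
      also have "\<dots> = (\<Sum>p\<in>J n. ennreal (((2 * 2 ^ j0) ^ d / 2 + 4 ^ d * osc_const * (2 * 2 ^ d)) * t) * emeasure lebesgue (cell a p))"
      proof (rule sum.cong)
        fix p assume "p \<in> J n"
        have "t / 2 * (2 * 2 ^ j0 * 2 powi fst p) ^ CARD('n) + 4 ^ CARD('n) * osc_const * (2 * 2 ^ d * t * vol p)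
          = ((2 * 2 ^ j0) ^ d / 2 + 4 ^ d * osc_const * (2 * 2 ^ d)) * t * vol p"
          unfolding vol_def d_def[symmetric] power_mult_distrib by (simp add: algebra_simps)
        then show "ennreal (t / 2 * (2 * 2 ^ j0 * 2 powi fst p) ^ CARD('n) + 4 ^ CARD('n) * osc_const * (2 * 2 ^ d * t * vol p))
          = ennreal (((2 * 2 ^ j0) ^ d / 2 + 4 ^ d * osc_const * (2 * 2 ^ d)) * t) * emeasure lebesgue (cell a p)"
          using t osc_const_nonneg by (simp add: emeasure_cell ennreal_mult[symmetric])
      qed simp
      also have "\<dots> = ennreal (((2 * 2 ^ j0) ^ d / 2 + 4 ^ d * osc_const * (2 * 2 ^ d)) * t) * emeasure lebesgue (\<Union> (cell a ` J n))"
        unfolding sum_distrib_left[symmetric] using finJ disj JM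
        by (subst sum_emeasure) (auto intro: disjoint_family_on_mono)
      also have "\<dots> \<le> ennreal (((2 * 2 ^ j0) ^ d / 2 + 4 ^ d * osc_const * (2 * 2 ^ d)) * t) * emeasure lebesgue (\<Union> (cell a ` MM))"
        using JM measurable_Union_cells by (intro mult_left_mono emeasure_mono) auto
      also have "\<dots> = ennreal ((2 * 2 ^ j0) ^ d / 2 + 4 ^ d * osc_const * (2 * 2 ^ d)) * (ennreal t * emeasure lebesgue (\<Union> (cell a ` MM)))"
        using t osc_const_nonneg by (simp add: ennreal_mult mult.assoc)
      also have "\<dots> \<le> ennreal ((2 * 2 ^ j0) ^ d / 2 + 4 ^ d * osc_const * (2 * 2 ^ d)) * ennreal I"
        by (intro mult_left_mono H_meas) auto
      finally have "2 * (ennreal (t / 2) * superlevel (T ?b) (t / 2))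
          \<le> 2 * (ennreal ((2 * 2 ^ j0) ^ d / 2 + 4 ^ d * osc_const * (2 * 2 ^ d)) * ennreal I)"
        by (intro mult_left_mono) auto
      also have "2 * (ennreal ((2 * 2 ^ j0) ^ d / 2 + 4 ^ d * osc_const * (2 * 2 ^ d)) * ennreal I)
          = ennreal (2 * (((2 * 2 ^ j0) ^ d / 2 + 4 ^ d * osc_const * (2 * 2 ^ d)) * I))"
        using I osc_const_nonneg by (simp add: ennreal_mult)
      also have "2 * (((2 * 2 ^ j0) ^ d / 2 + 4 ^ d * osc_const * (2 * 2 ^ d)) * I)
          = (2 * 2 ^ j0) ^ d * I + 2 * 4 ^ d * osc_const * (2 * 2 ^ d) * I"
        by (simp add: algebra_simps)
      also have "2 * (ennreal (t / 2) * superlevel (T ?b) (t / 2)) = ennreal t * superlevel (T ?b) (t / 2)"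
        unfolding mult.assoc[symmetric] ennreal_numeral[symmetric] using t by (subst ennreal_mult[symmetric]) auto
      finally show ?thesis .
    qed
    finally have "ennreal t * superlevel (T f) t \<le> ennreal (2 powr q * N powr q * ((2 ^ d) powr q + 2) * I)
        + ennreal ((2 * 2 ^ j0) ^ d * I + 2 * 4 ^ d * osc_const * (2 * 2 ^ d) * I)"
      by (simp add: add_mono)
    also have "\<dots> = ennreal (nice_const * I)"
      using I osc_const_nonneg
      by (subst ennreal_plus[symmetric]) (auto simp: nice_const_def d_def algebra_simps)
    also have "\<dots> = ennreal nice_const * ennreal I" using nice_const_nonneg by (rule ennreal_mult')
    finally show ?thesis unfolding I(1)[symmetric] h_def .
  qed
qed

end

section \<open>Convergence in measure and truncation\<close>

lemma power_integral_1: "power_integral 1 f = (\<integral>\<^sup>+x. ennreal (norm (f x)) \<partial>lebesgue)"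
  by (simp add: power_integral_def)

lemma integrable_iff_power_integral:
  "integrable lebesgue f \<longleftrightarrow> f \<in> borel_measurable lebesgue \<and> power_integral 1 f < \<infinity>"
  for f :: "real ^ 'n \<Rightarrow> complex"
  unfolding power_integral_1 integrable_iff_bounded by simp

lemma power_integral_1_triangle:
  fixes f g h :: "real ^ 'n \<Rightarrow> complex"
  assumes [measurable]: "f \<in> borel_measurable lebesgue" "g \<in> borel_measurable lebesgue"
    and le: "\<And>x. norm (h x) \<le> norm (f x) + norm (g x)"
  shows "power_integral 1 h \<le> power_integral 1 f + power_integral 1 g"
proof -
  have "power_integral 1 h \<le> (\<integral>\<^sup>+x. ennreal (norm (f x)) + ennreal (norm (g x)) \<partial>lebesgue)"
    unfolding power_integral_1 using le by (intro nn_integral_mono) (simp add: ennreal_plus[symmetric] ennreal_leI del: ennreal_plus)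
  also have "\<dots> = power_integral 1 f + power_integral 1 g"
    unfolding power_integral_1 by (rule nn_integral_add) measurable
  finally show ?thesis .
qed

lemma superlevel_cong_AE:
  assumes "AE x in lebesgue. f x = g x" "f \<in> borel_measurable lebesgue" "g \<in> borel_measurable lebesgue"
  shows "superlevel f t = superlevel g t"
  unfolding superlevel_def
  by (rule emeasure_eq_AE) (use assms in \<open>auto intro: sets_superlevel\<close>)

lemma superlevel_uminus: "superlevel (\<lambda>x. f x - g x) t = superlevel (\<lambda>x. g x - f x) t"
  by (simp add: superlevel_def norm_minus_commute)

lemma AE_eq_0_of_superlevel:
  fixes h :: "real ^ 'n \<Rightarrow> complex"
  assumes m: "h \<in> borel_measurable lebesgue" and z: "\<And>e. e > 0 \<Longrightarrow> superlevel h e = 0"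
  shows "AE x in lebesgue. h x = 0"
proof -
  have "AE x in lebesgue. \<not> 1 / real (Suc n) < norm (h x)" for n
  proof (rule AE_I')
    show "{x. 1 / real (Suc n) < norm (h x)} \<in> null_sets lebesgue"
      using z[of "1 / real (Suc n)"] sets_superlevel[OF m] by (auto simp: superlevel_def)
  qed auto
  then have "AE x in lebesgue. \<forall>n. \<not> 1 / real (Suc n) < norm (h x)" unfolding AE_all_countable by blast
  then show ?thesis
  proof eventually_elim
    case (elim x)
    show ?case
    proof (rule ccontr)
      assume "h x \<noteq> 0"
      then obtain n where "1 / real (Suc n) < norm (h x)" using nat_approx_posE[of "norm (h x)"] by auto
      then show False using elim by blast
    qed
  qed
qed

text \<open>Borel-Cantelli, with levels and measures of the exceptional sets both decreasing
  geometrically. It yields almost everywhere convergence in two places.\<close>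

lemma AE_eventually_small:
  fixes h :: "nat \<Rightarrow> real ^ 'n \<Rightarrow> complex"
  assumes m: "\<And>k. h k \<in> borel_measurable lebesgue" and C: "C \<ge> 0"
    and le: "\<And>k. superlevel (h k) ((1 / 2) ^ k) \<le> ennreal (C * (1 / 2) ^ k)"
  shows "AE x in lebesgue. \<forall>\<^sub>F k in sequentially. norm (h k x) \<le> (1 / 2) ^ k"
proof -
  let ?A = "\<lambda>k. {x. (1 / 2) ^ k < norm (h k x)}"
  have "AE x in lebesgue. \<forall>\<^sub>F k in sequentially. x \<in> space lebesgue - ?A k"
  proof (rule borel_cantelli_AE1)
    show "?A k \<in> sets lebesgue" for k by (rule sets_superlevel[OF m])
    show "emeasure lebesgue (?A k) < \<infinity>" for k
      using le[of k] by (auto simp: superlevel_def intro: le_less_trans)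
    have *: "measure lebesgue (?A k) \<le> C * (1 / 2) ^ k" for k
      using le[of k] C unfolding superlevel_def measure_def by (intro enn2real_leI) auto
    show "summable (\<lambda>k. measure lebesgue (?A k))"
      by (rule summable_comparison_test'[of "\<lambda>k. C * (1 / 2) ^ k" 0]) (use * in \<open>auto intro!: summable_mult summable_geometric\<close>)
  qed
  then show ?thesis
    by eventually_elim (auto simp: not_less elim: eventually_mono)
qed

lemma tendsto_of_eventually_small:
  fixes v :: "nat \<Rightarrow> complex"
  assumes "\<forall>\<^sub>F k in sequentially. norm (v k - z) \<le> (1 / 2) ^ k" shows "v \<longlonglongrightarrow> z"
proof -
  have "(\<lambda>k. v k - z) \<longlonglongrightarrow> 0"
    by (rule Lim_null_comparison[OF assms]) (intro LIMSEQ_realpow_zero, auto)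
  then show ?thesis by (simp add: LIM_zero_iff)
qed

lemma convergent_of_eventually_small:
  fixes v :: "nat \<Rightarrow> complex"
  assumes "\<forall>\<^sub>F k in sequentially. norm (v k - v (Suc k)) \<le> (1 / 2) ^ k" shows "convergent v"
proof -
  have "summable (\<lambda>k. v (Suc k) - v k)"
  proof (rule summable_comparison_test_ev)
    show "\<forall>\<^sub>F k in sequentially. norm (v (Suc k) - v k) \<le> (1 / 2) ^ k"
      using assms by (simp add: norm_minus_commute)
  qed (simp add: summable_geometric)
  then have "convergent (\<lambda>n. \<Sum>k<n. v (Suc k) - v k)" by (simp add: summable_iff_convergent)
  then have "convergent (\<lambda>n. v n - v 0)" by (simp add: sum_lessThan_telescope)
  then have "convergent (\<lambda>n. (v n - v 0) + v 0)" by (intro convergent_add convergent_const)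
  then show ?thesis by simp
qed

lemma tendsto_in_measure_iff: "tendsto_in_measure u g \<longleftrightarrow> (\<forall>e>0. (\<lambda>n. superlevel (\<lambda>x. u n x - g x) e) \<longlonglongrightarrow> 0)"
  by (simp add: tendsto_in_measure_def superlevel_def)

lemma tendsto_in_measure_subseq:
  assumes m: "\<And>n. u n \<in> borel_measurable lebesgue" "g \<in> borel_measurable lebesgue" and lim: "tendsto_in_measure u g"
  obtains r where "AE x in lebesgue. (\<lambda>k. u (r k) x) \<longlonglongrightarrow> g x"
proof -
  have "\<exists>n. superlevel (\<lambda>x. u n x - g x) ((1 / 2) ^ k) < ennreal (1 * (1 / 2) ^ k)" for k :: nat
  proof -
    have "(\<lambda>n. superlevel (\<lambda>x. u n x - g x) ((1 / 2) ^ k)) \<longlonglongrightarrow> 0" using lim by (simp add: tendsto_in_measure_iff)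
    then have "\<forall>\<^sub>F n in sequentially. superlevel (\<lambda>x. u n x - g x) ((1 / 2) ^ k) < ennreal (1 * (1 / 2) ^ k)"
      by (rule order_tendstoD) simp
    then show ?thesis by (auto simp: eventually_sequentially)
  qed
  then obtain r where r: "\<And>k. superlevel (\<lambda>x. u (r k) x - g x) ((1 / 2) ^ k) < ennreal (1 * (1 / 2) ^ k)" by metis
  have "AE x in lebesgue. \<forall>\<^sub>F k in sequentially. norm (u (r k) x - g x) \<le> (1 / 2) ^ k"
    by (rule AE_eventually_small[where C = 1]) (use m r in \<open>auto intro: less_imp_le\<close>)
  then have "AE x in lebesgue. (\<lambda>k. u (r k) x) \<longlonglongrightarrow> g x"
    by eventually_elim (rule tendsto_of_eventually_small)
  then show ?thesis using that by blast
qed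

text \<open>Cutting off height and location together gives one sequence of nice functions that
  converges to \<open>f\<close> in \<open>L^1\<close> and in \<open>L^q\<close>, in whichever of
  them \<open>f\<close> lies.\<close>

definition trunc :: "nat \<Rightarrow> (real ^ 'n \<Rightarrow> complex) \<Rightarrow> real ^ 'n \<Rightarrow> complex" where
  "trunc n f x = (if norm (f x) \<le> real n \<and> norm x \<le> real n then f x else 0)"

lemma norm_trunc_le: "norm (trunc n f x) \<le> norm (f x)"
  by (simp add: trunc_def)

lemma norm_trunc_diff_le: "norm (trunc n f x - f x) \<le> norm (f x)"
  by (simp add: trunc_def)

lemma nice_trunc:
  fixes f :: "real ^ 'n \<Rightarrow> complex"
  assumes [measurable]: "f \<in> borel_measurable lebesgue" shows "nice (trunc n f)"
  unfolding nice_def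
proof (intro conjI)
  have [measurable]: "(\<lambda>x :: real ^ 'n. x) \<in> borel_measurable lebesgue"
    by (rule measurable_completion) simp
  show "trunc n f \<in> borel_measurable lebesgue" unfolding trunc_def[abs_def] by measurable
  show "bounded (range (trunc n f))"
    unfolding bounded_iff by (intro exI[of _ "real n"]) (auto simp: trunc_def)
  show "bounded {y. trunc n f y \<noteq> 0}"
    unfolding bounded_iff by (intro exI[of _ "real n"]) (auto simp: trunc_def split: if_splits)
qed

lemma trunc_measurable [measurable (raw)]: "f \<in> borel_measurable lebesgue \<Longrightarrow> trunc n f \<in> borel_measurable lebesgue"
  using nice_trunc by (auto simp: nice_def)

lemma power_integral_trunc_tendsto:
  fixes f :: "real ^ 'n \<Rightarrow> complex"
  assumes [measurable]: "f \<in> borel_measurable lebesgue" and fin: "power_integral r f < \<infinity>" and r: "r > 0"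
  shows "(\<lambda>n. power_integral r (\<lambda>x. trunc n f x - f x)) \<longlonglongrightarrow> 0"
proof -
  have "(\<lambda>n. power_integral r (\<lambda>x. trunc n f x - f x)) \<longlonglongrightarrow> (\<integral>\<^sup>+x. 0 \<partial>(lebesgue :: (real ^ 'n) measure))"
    unfolding power_integral_def
  proof (rule nn_integral_dominated_convergence[where w = "\<lambda>x. ennreal (norm (f x) powr r)"])
    show "AE x in lebesgue. ennreal (norm (trunc n f x - f x) powr r) \<le> ennreal (norm (f x) powr r)" for n
      using r by (intro AE_I2 ennreal_leI powr_mono2 norm_trunc_diff_le) auto
    show "AE x in lebesgue. (\<lambda>n. ennreal (norm (trunc n f x - f x) powr r)) \<longlonglongrightarrow> 0"
    proof (rule AE_I2)
      fix x
      obtain m :: nat where m: "max (norm (f x)) (norm x) \<le> real m" using real_arch_simple by blast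
      have "\<forall>\<^sub>F n in sequentially. ennreal (norm (trunc n f x - f x) powr r) = 0"
        using eventually_ge_at_top[of m]
      proof eventually_elim
        case (elim n)
        then have "max (norm (f x)) (norm x) \<le> real n" using m by (meson of_nat_le_iff order_trans)
        then show ?case by (simp add: trunc_def)
      qed
      then show "(\<lambda>n. ennreal (norm (trunc n f x - f x) powr r)) \<longlonglongrightarrow> 0" by (rule tendsto_eventually)
    qed
    show "(\<integral>\<^sup>+x. ennreal (norm (f x) powr r) \<partial>lebesgue) < \<infinity>" using fin by (simp add: power_integral_def)
    have [measurable]: "trunc n f \<in> borel_measurable lebesgue" for n by (rule trunc_measurable) measurable
    show "(\<lambda>x. ennreal (norm (trunc n f x - f x) powr r)) \<in> borel_measurable lebesgue" for n by measurable
    show "(\<lambda>x. ennreal (norm (f x) powr r)) \<in> borel_measurable lebesgue" by measurable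
  qed simp
  then show ?thesis by simp
qed

section \<open>The extension of the operator to integrable functions\<close>

context cz_lq
begin

lemma q_pos: "q > 0"
  using q by simp

lemma trunc_Lq: "f \<in> borel_measurable lebesgue \<Longrightarrow> trunc n f \<in> Lq q"
  using nice_Lq[OF nice_trunc q_pos] .

lemma T_diff:
  assumes f: "f \<in> Lq q" and g: "g \<in> Lq q"
  shows "(\<lambda>y. f y - g y) \<in> Lq q" "AE x in lebesgue. T (\<lambda>y. f y - g y) x = T f x - T g x"
proof -
  have g': "(\<lambda>y. (- 1) * g y) \<in> Lq q" by (rule Lq_cmult[OF g])
  have eq: "(\<lambda>y. f y + (- 1) * g y) = (\<lambda>y. f y - g y)" by simp
  show "(\<lambda>y. f y - g y) \<in> Lq q" using Lq_add[OF f g' q_pos] unfolding eq .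
  have "AE x in lebesgue. T (\<lambda>y. f y - g y) x = T f x + T (\<lambda>y. (- 1) * g y) x"
    using T_add[OF f g'] unfolding eq .
  moreover have "AE x in lebesgue. T (\<lambda>y. (- 1) * g y) x = (- 1) * T g x" by (rule T_scale[OF g])
  ultimately show "AE x in lebesgue. T (\<lambda>y. f y - g y) x = T f x - T g x"
    by eventually_elim simp
qed

text \<open>Truncations converge to \<open>f\<close> in \<open>L^q\<close>, so by Chebyshev's
  inequality the part of \<open>T f\<close> that they miss disappears in the limit at any positive
  level. Halving the level for the two parts costs the factor 2.\<close>

lemma weak_type_Lq:
  assumes f: "f \<in> Lq q" and t: "t > 0"
  shows "ennreal t * superlevel (T f) t \<le> ennreal (2 * nice_const) * power_integral 1 f"
proof -
  have fm [measurable]: "f \<in> borel_measurable lebesgue" using f by (simp add: Lq_def)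
  define c where "c = t * (t / 2) powr (- q) * N powr q"
  have c0: "c \<ge> 0" unfolding c_def using t by simp
  define P where "P n = power_integral q (\<lambda>x. trunc n f x - f x)" for n
  have bound: "ennreal t * superlevel (T f) t \<le> ennreal (2 * nice_const) * power_integral 1 f + ennreal c * P n" for n
  proof -
    note fn = trunc_Lq[OF fm, of n]
    have dq: "(\<lambda>y. trunc n f y - f y) \<in> Lq q" by (rule T_diff(1)[OF fn f])
    have "AE x in lebesgue. T f x = T (trunc n f) x + (T f x - T (trunc n f) x)" by simp
    then have "superlevel (T f) (t / 2 + t / 2) \<le> superlevel (T (trunc n f)) (t / 2) + superlevel (\<lambda>x. T f x - T (trunc n f) x) (t / 2)"
      using T_measurable[OF f] T_measurable[OF fn] by (intro superlevel_add) auto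
    also have "superlevel (\<lambda>x. T f x - T (trunc n f) x) (t / 2) = superlevel (T (\<lambda>y. trunc n f y - f y)) (t / 2)"
      unfolding superlevel_uminus[of "T f"]
      using T_diff(2)[OF fn f] T_measurable[OF f] T_measurable[OF fn] T_measurable[OF dq]
      by (intro superlevel_cong_AE) auto
    finally have "ennreal t * superlevel (T f) t
        \<le> ennreal t * superlevel (T (trunc n f)) (t / 2) + ennreal t * superlevel (T (\<lambda>y. trunc n f y - f y)) (t / 2)"
      by (simp add: distrib_left[symmetric] mult_left_mono)
    also have "ennreal t * superlevel (T (trunc n f)) (t / 2) \<le> ennreal (2 * nice_const) * power_integral 1 f"
    proof -
      have "ennreal t * superlevel (T (trunc n f)) (t / 2) = 2 * (ennreal (t / 2) * superlevel (T (trunc n f)) (t / 2))"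
        unfolding mult.assoc[symmetric] ennreal_numeral[symmetric] using t by (subst ennreal_mult[symmetric]) auto
      also have "\<dots> \<le> 2 * (ennreal nice_const * power_integral 1 (trunc n f))"
        unfolding power_integral_1 using t by (intro mult_left_mono weak_type_nice nice_trunc) auto
      also have "\<dots> \<le> 2 * (ennreal nice_const * power_integral 1 f)"
        unfolding power_integral_1 by (intro mult_left_mono nn_integral_mono ennreal_leI norm_trunc_le) auto
      also have "\<dots> = ennreal (2 * nice_const) * power_integral 1 f"
        unfolding mult.assoc[symmetric] ennreal_numeral[symmetric]
        using nice_const_nonneg by (subst ennreal_mult[symmetric]) auto
      finally show ?thesis .
    qed
    also have "ennreal t * superlevel (T (\<lambda>y. trunc n f y - f y)) (t / 2) \<le> ennreal c * P n"
    proof -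
      have te: "t = t * (t / 2) powr (- q) * (t / 2) powr q" using t by (simp add: powr_add[symmetric])
      have "ennreal t * superlevel (T (\<lambda>y. trunc n f y - f y)) (t / 2)
          = ennreal (t * (t / 2) powr (- q)) * (ennreal ((t / 2) powr q) * superlevel (T (\<lambda>y. trunc n f y - f y)) (t / 2))"
        by (subst te) (use t in \<open>simp add: ennreal_mult mult.assoc\<close>)
      also have "\<dots> \<le> ennreal (t * (t / 2) powr (- q)) * (ennreal (N powr q) * P n)"
        unfolding P_def using t by (intro mult_left_mono superlevel_T_Lq dq) auto
      also have "\<dots> = ennreal c * P n" unfolding c_def using t by (simp add: ennreal_mult mult.assoc)
      finally show ?thesis .
    qed
    finally show ?thesis by (simp add: add_mono)
  qed
  show ?thesis
  proof (rule LIMSEQ_le_const)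
    have "P \<longlonglongrightarrow> 0" unfolding P_def[abs_def] using f by (intro power_integral_trunc_tendsto q_pos) (auto simp: Lq_iff)
    then have "(\<lambda>n. ennreal (2 * nice_const) * power_integral 1 f + ennreal c * P n)
        \<longlonglongrightarrow> ennreal (2 * nice_const) * power_integral 1 f + ennreal c * 0"
      by (intro tendsto_add tendsto_const ennreal_tendsto_cmult) auto
    then show "(\<lambda>n. ennreal (2 * nice_const) * power_integral 1 f + ennreal c * P n)
        \<longlonglongrightarrow> ennreal (2 * nice_const) * power_integral 1 f" by simp
    show "\<exists>M. \<forall>n\<ge>M. ennreal t * superlevel (T f) t \<le> ennreal (2 * nice_const) * power_integral 1 f + ennreal c * P n"
      using bound by blast
  qed
qed

lemma superlevel_T_diff:
  assumes f: "f \<in> Lq q" and g: "g \<in> Lq q" and t: "t > 0"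
  shows "ennreal t * superlevel (\<lambda>x. T f x - T g x) t \<le> ennreal (2 * nice_const) * power_integral 1 (\<lambda>y. f y - g y)"
proof -
  have "superlevel (\<lambda>x. T f x - T g x) t = superlevel (T (\<lambda>y. f y - g y)) t"
    using T_diff[OF f g] T_measurable f g by (intro superlevel_cong_AE) auto
  then show ?thesis using weak_type_Lq[OF T_diff(1)[OF f g] t] by simp
qed

text \<open>The property by which \<open>extend_L1\<close> chooses its value outside
  \<open>L^q\<close>, stated separately because \<open>T f\<close> has to satisfy it too when
  \<open>f\<close> lies in \<open>L^q\<close>.\<close>

definition extends_to :: "(real ^ 'n \<Rightarrow> complex) \<Rightarrow> (real ^ 'n \<Rightarrow> complex) \<Rightarrow> bool" where
  "extends_to f g \<longleftrightarrow> g \<in> borel_measurable lebesgue \<and>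
    (\<forall>u. (\<forall>n. u n \<in> Lq q \<and> integrable lebesgue (u n)) \<and>
       (\<lambda>n. LINT x|lebesgue. norm (u n x - f x)) \<longlonglongrightarrow> 0 \<longrightarrow> tendsto_in_measure (\<lambda>n. T (u n)) g)"

lemma tendsto_power_integral_1_iff:
  assumes "integrable lebesgue f" "\<And>n. integrable lebesgue (u n)"
  shows "(\<lambda>n. power_integral 1 (\<lambda>x. u n x - f x)) \<longlonglongrightarrow> 0 \<longleftrightarrow> (\<lambda>n. LINT x|lebesgue. norm (u n x - f x)) \<longlonglongrightarrow> 0"
proof -
  have "power_integral 1 (\<lambda>x. u n x - f x) = ennreal (LINT x|lebesgue. norm (u n x - f x))" for n
    unfolding power_integral_1 using assms by (intro nn_integral_eq_integral) auto
  then show ?thesis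
    using tendsto_ennreal_iff[of "\<lambda>n. LINT x|lebesgue. norm (u n x - f x)" sequentially 0]
    by (simp add: integral_nonneg_AE)
qed

text \<open>A weak type bound for the difference to \<open>g\<close>, uniform in the approximant, is
  continuity at \<open>f\<close> from the \<open>L^1\<close> norm to convergence in measure.\<close>

lemma extends_toI:
  assumes f: "integrable lebesgue f" and g: "g \<in> borel_measurable lebesgue"
    and le: "\<And>u t. u \<in> Lq q \<Longrightarrow> integrable lebesgue u \<Longrightarrow> t > 0 \<Longrightarrow>
      ennreal t * superlevel (\<lambda>x. T u x - g x) t \<le> ennreal (2 * nice_const) * power_integral 1 (\<lambda>y. u y - f y)"
  shows "extends_to f g"
  unfolding extends_to_def tendsto_in_measure_iff
proof (intro conjI g allI impI)
  fix u and e :: real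
  assume "(\<forall>n. u n \<in> Lq q \<and> integrable lebesgue (u n)) \<and> (\<lambda>n. LINT x|lebesgue. norm (u n x - f x)) \<longlonglongrightarrow> 0" and e: "e > 0"
  then have u: "\<And>n. u n \<in> Lq q" "\<And>n. integrable lebesgue (u n)"
    and lim: "(\<lambda>n. power_integral 1 (\<lambda>x. u n x - f x)) \<longlonglongrightarrow> 0"
    using tendsto_power_integral_1_iff[OF f] by auto
  have le_n: "superlevel (\<lambda>x. T (u n) x - g x) e \<le> ennreal (1 / e * (2 * nice_const)) * power_integral 1 (\<lambda>y. u n y - f y)" for n
  proof -
    have "superlevel (\<lambda>x. T (u n) x - g x) e = ennreal (1 / e) * (ennreal e * superlevel (\<lambda>x. T (u n) x - g x) e)"
      unfolding mult.assoc[symmetric] using e by (subst ennreal_mult[symmetric]) auto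
    also have "\<dots> \<le> ennreal (1 / e) * (ennreal (2 * nice_const) * power_integral 1 (\<lambda>y. u n y - f y))"
      by (intro mult_left_mono le u e) auto
    also have "\<dots> = ennreal (1 / e * (2 * nice_const)) * power_integral 1 (\<lambda>y. u n y - f y)"
      unfolding mult.assoc[symmetric] using e nice_const_nonneg by (subst ennreal_mult[symmetric]) auto
    finally show ?thesis .
  qed
  have "(\<lambda>n. ennreal (1 / e * (2 * nice_const)) * power_integral 1 (\<lambda>y. u n y - f y)) \<longlonglongrightarrow> ennreal (1 / e * (2 * nice_const)) * 0"
    by (intro ennreal_tendsto_cmult lim) auto
  then have lim0: "(\<lambda>n. ennreal (1 / e * (2 * nice_const)) * power_integral 1 (\<lambda>y. u n y - f y)) \<longlonglongrightarrow> 0"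
    by simp
  show "(\<lambda>n. superlevel (\<lambda>x. T (u n) x - g x) e) \<longlonglongrightarrow> 0"
  proof (rule tendsto_sandwich[OF always_eventually always_eventually tendsto_const lim0])
    show "\<forall>n. superlevel (\<lambda>x. T (u n) x - g x) e \<le> ennreal (1 / e * (2 * nice_const)) * power_integral 1 (\<lambda>y. u n y - f y)"
      using le_n by blast
  qed simp
qed

text \<open>Along rapidly converging truncations the images under \<open>T\<close> converge almost
  everywhere, by the weak type estimate and Borel-Cantelli. Fatou's lemma carries the weak type
  bound over to differences with the limit.\<close>

lemma extends_to_exists:
  assumes f: "integrable lebesgue f"
  obtains g where "extends_to f g"
proof -
  have fm [measurable]: "f \<in> borel_measurable lebesgue" using f by simp
  have Pf: "power_integral 1 f < \<infinity>" using f integrable_iff_power_integral by blast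
  have lim: "(\<lambda>n. power_integral 1 (\<lambda>x. trunc n f x - f x)) \<longlonglongrightarrow> 0"
    by (intro power_integral_trunc_tendsto fm Pf) simp
  \<comment> \<open>Of the rate \<open>(1 / 4) ^ k\<close>, one factor \<open>(1 / 2) ^ k\<close> is
    spent on the level and the other makes the measures of the exceptional sets summable.\<close>
  have "\<exists>n. power_integral 1 (\<lambda>x. trunc n f x - f x) < ennreal ((1 / 4) ^ k)" for k :: nat
    using order_tendstoD(2)[OF lim, of "ennreal ((1 / 4) ^ k)"] by (auto simp: eventually_sequentially)
  then obtain r where r: "\<And>k. power_integral 1 (\<lambda>x. trunc (r k) f x - f x) < ennreal ((1 / 4) ^ k)" by metis
  define w where "w k = trunc (r k) f" for k
  have wLq: "w k \<in> Lq q" for k unfolding w_def by (rule trunc_Lq[OF fm])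
  have wm [measurable]: "w k \<in> borel_measurable lebesgue" for k unfolding w_def by measurable
  define v where "v k = T (w k)" for k
  have vm [measurable]: "v k \<in> borel_measurable lebesgue" for k unfolding v_def by (rule T_measurable[OF wLq])
  have w_dist: "power_integral 1 (\<lambda>x. u x - w k x) \<le> power_integral 1 (\<lambda>x. u x - f x) + ennreal ((1 / 4) ^ k)"
    if [measurable]: "u \<in> borel_measurable lebesgue" for u :: "real ^ 'n \<Rightarrow> complex" and k
  proof -
    have "power_integral 1 (\<lambda>x. u x - w k x) \<le> power_integral 1 (\<lambda>x. u x - f x) + power_integral 1 (\<lambda>x. w k x - f x)"
    proof (rule power_integral_1_triangle)
      fix x show "norm (u x - w k x) \<le> norm (u x - f x) + norm (w k x - f x)"
        using norm_triangle_ineq4[of "u x - f x" "w k x - f x"] by simp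
    qed measurable
    also have "\<dots> \<le> power_integral 1 (\<lambda>x. u x - f x) + ennreal ((1 / 4) ^ k)"
      using r[of k] by (intro add_left_mono) (simp add: w_def less_imp_le)
    finally show ?thesis .
  qed
  have "AE x in lebesgue. \<forall>\<^sub>F k in sequentially. norm (v k x - v (Suc k) x) \<le> (1 / 2) ^ k"
  proof (rule AE_eventually_small)
    show "(\<lambda>x. v k x - v (Suc k) x) \<in> borel_measurable lebesgue" for k by measurable
    show "0 \<le> 2 * nice_const * 2" using nice_const_nonneg by simp
    fix k
    have "ennreal ((1 / 2) ^ k) * superlevel (\<lambda>x. v k x - v (Suc k) x) ((1 / 2) ^ k)
        \<le> ennreal (2 * nice_const) * power_integral 1 (\<lambda>y. w k y - w (Suc k) y)"
      unfolding v_def by (intro superlevel_T_diff wLq) simp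
    also have "\<dots> \<le> ennreal (2 * nice_const) * (ennreal ((1 / 4) ^ k) + ennreal ((1 / 4) ^ k))"
    proof (intro mult_left_mono)
      have "power_integral 1 (\<lambda>y. w k y - w (Suc k) y) \<le> power_integral 1 (\<lambda>x. w k x - f x) + ennreal ((1 / 4) ^ Suc k)"
        by (rule w_dist[OF wm])
      also have "\<dots> \<le> ennreal ((1 / 4) ^ k) + ennreal ((1 / 4) ^ k)"
        using r[of k] by (intro add_mono ennreal_leI) (auto simp: w_def less_imp_le)
      finally show "power_integral 1 (\<lambda>y. w k y - w (Suc k) y) \<le> ennreal ((1 / 4) ^ k) + ennreal ((1 / 4) ^ k)" .
    qed simp
    also have "\<dots> = ennreal (2 * nice_const * (2 * (1 / 4) ^ k))"
      using nice_const_nonneg by (simp add: ennreal_mult[symmetric] ennreal_plus[symmetric] del: ennreal_plus)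
    also have "2 * nice_const * (2 * (1 / 4) ^ k) = (1 / 2) ^ k * (2 * nice_const * 2 * (1 / 2) ^ k)"
    proof -
      have "(1 / 4 :: real) ^ k = (1 / 2) ^ k * (1 / 2) ^ k" by (simp add: power_mult_distrib[symmetric])
      then show ?thesis by (simp only: mult_ac)
    qed
    also have "ennreal ((1 / 2) ^ k * (2 * nice_const * 2 * (1 / 2) ^ k)) = ennreal ((1 / 2) ^ k) * ennreal (2 * nice_const * 2 * (1 / 2) ^ k)"
      using nice_const_nonneg by (intro ennreal_mult) auto
    finally show "superlevel (\<lambda>x. v k x - v (Suc k) x) ((1 / 2) ^ k) \<le> ennreal (2 * nice_const * 2 * (1 / 2) ^ k)"
      by (subst (asm) ennreal_mult_le_mult_iff) auto
  qed
  then have conv: "AE x in lebesgue. (\<lambda>k. v k x) \<longlonglongrightarrow> lim (\<lambda>k. v k x)"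
    by eventually_elim (simp add: convergent_of_eventually_small convergent_LIMSEQ_iff[symmetric])
  define g where "g x = lim (\<lambda>k. v k x)" for x
  have gm [measurable]: "g \<in> borel_measurable lebesgue"
    unfolding g_def[abs_def] by (rule borel_measurable_lim_metric) (rule vm)
  have "extends_to f g"
  proof (rule extends_toI[OF f gm])
    fix u :: "real ^ 'n \<Rightarrow> complex" and t :: real
    assume u: "u \<in> Lq q" "integrable lebesgue u" and t: "t > 0"
    have um [measurable]: "u \<in> borel_measurable lebesgue" "T u \<in> borel_measurable lebesgue" using u T_measurable by auto
    let ?A = "\<lambda>k. {x. t < norm (T u x - v k x)}"
    have A: "?A k \<in> sets lebesgue" for k by (intro sets_superlevel) measurable
    have G: "{x. t < norm (T u x - g x)} \<in> sets lebesgue" by (intro sets_superlevel) measurable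
    have "ennreal t * superlevel (\<lambda>x. T u x - g x) t = (\<integral>\<^sup>+x. ennreal t * indicator {x. t < norm (T u x - g x)} x \<partial>lebesgue)"
      unfolding superlevel_def using G by (subst nn_integral_cmult_indicator) auto
    \<comment> \<open>The inequality is strict, so if it holds for the limit it holds for all large
      \<open>k\<close>; this is what Fatou's lemma needs.\<close>
    also have "\<dots> \<le> (\<integral>\<^sup>+x. liminf (\<lambda>k. ennreal t * indicator (?A k) x) \<partial>lebesgue)"
    proof (rule nn_integral_mono_AE)
      show "AE x in lebesgue. ennreal t * indicator {x. t < norm (T u x - g x)} x \<le> liminf (\<lambda>k. ennreal t * indicator (?A k) x)"
        using conv
      proof eventually_elim
        case (elim x)
        show ?case
        proof (cases "t < norm (T u x - g x)")
          case True
          have "(\<lambda>k. norm (T u x - v k x)) \<longlonglongrightarrow> norm (T u x - g x)"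
            using elim unfolding g_def by (intro tendsto_intros)
          then have "\<forall>\<^sub>F k in sequentially. t < norm (T u x - v k x)" using True by (rule order_tendstoD)
          then have "\<forall>\<^sub>F k in sequentially. ennreal t \<le> ennreal t * indicator (?A k) x"
            by eventually_elim simp
          then have "ennreal t \<le> liminf (\<lambda>k. ennreal t * indicator (?A k) x)" by (rule Liminf_bounded)
          then show ?thesis using True by simp
        qed simp
      qed
    qed
    also have "\<dots> \<le> liminf (\<lambda>k. \<integral>\<^sup>+x. ennreal t * indicator (?A k) x \<partial>lebesgue)"
      using A by (intro nn_integral_liminf) auto
    also have "\<dots> \<le> liminf (\<lambda>k. ennreal (2 * nice_const) * (power_integral 1 (\<lambda>y. u y - f y) + ennreal ((1 / 4) ^ k)))"
    proof (intro Liminf_mono always_eventually allI)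
      fix k
      have "(\<integral>\<^sup>+x. ennreal t * indicator (?A k) x \<partial>lebesgue) = ennreal t * superlevel (\<lambda>x. T u x - T (w k) x) t"
        unfolding superlevel_def v_def[symmetric] using A by (subst nn_integral_cmult_indicator) auto
      also have "\<dots> \<le> ennreal (2 * nice_const) * power_integral 1 (\<lambda>y. u y - w k y)"
        by (rule superlevel_T_diff[OF u(1) wLq t])
      also have "\<dots> \<le> ennreal (2 * nice_const) * (power_integral 1 (\<lambda>y. u y - f y) + ennreal ((1 / 4) ^ k))"
        by (intro mult_left_mono w_dist um) simp
      finally show "(\<integral>\<^sup>+x. ennreal t * indicator (?A k) x \<partial>lebesgue)
        \<le> ennreal (2 * nice_const) * (power_integral 1 (\<lambda>y. u y - f y) + ennreal ((1 / 4) ^ k))" .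
    qed
    also have "\<dots> = ennreal (2 * nice_const) * (power_integral 1 (\<lambda>y. u y - f y) + 0)"
    proof (rule lim_imp_Liminf)
      have "(\<lambda>k. ennreal ((1 / 4) ^ k)) \<longlonglongrightarrow> ennreal 0" by (intro tendsto_ennrealI LIMSEQ_realpow_zero) auto
      then show "(\<lambda>k. ennreal (2 * nice_const) * (power_integral 1 (\<lambda>y. u y - f y) + ennreal ((1 / 4) ^ k)))
          \<longlonglongrightarrow> ennreal (2 * nice_const) * (power_integral 1 (\<lambda>y. u y - f y) + 0)"
        by (intro ennreal_tendsto_cmult tendsto_add tendsto_const) auto
    qed simp
    finally show "ennreal t * superlevel (\<lambda>x. T u x - g x) t \<le> ennreal (2 * nice_const) * power_integral 1 (\<lambda>y. u y - f y)" by simp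
  qed
  then show ?thesis using that by blast
qed

abbreviation "TE \<equiv> extend_L1 q T"

text \<open>The two branches of \<open>extend_L1\<close> are reconciled: on \<open>L^q\<close> the
  value \<open>T f\<close> has the extension property by the weak type estimate, elsewhere the
  choice has it because a value exists.\<close>

lemma extends_to_TE:
  assumes f: "integrable lebesgue f" shows "extends_to f (TE f)"
proof (cases "f \<in> Lq q")
  case True
  have "extends_to f (T f)"
    by (rule extends_toI[OF f T_measurable[OF True]]) (rule superlevel_T_diff[OF _ True])
  then show ?thesis using True by (simp add: extend_L1_def)
next
  case False
  obtain g where "extends_to f g" using extends_to_exists[OF f] .
  then have "extends_to f (SOME g. extends_to f g)" by (rule someI[of "extends_to f"])
  then show ?thesis using False by (simp add: extend_L1_def extends_to_def)
qed

lemma TE_measurable: "integrable lebesgue f \<Longrightarrow> TE f \<in> borel_measurable lebesgue"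
  using extends_to_TE by (simp add: extends_to_def)

lemma TE_limit:
  assumes "integrable lebesgue f" "\<And>n. u n \<in> Lq q" "\<And>n. integrable lebesgue (u n)"
    "(\<lambda>n. power_integral 1 (\<lambda>x. u n x - f x)) \<longlonglongrightarrow> 0"
  shows "tendsto_in_measure (\<lambda>n. T (u n)) (TE f)"
proof -
  have "(\<lambda>n. LINT x|lebesgue. norm (u n x - f x)) \<longlonglongrightarrow> 0"
    using assms(4) tendsto_power_integral_1_iff[of f u, OF assms(1,3)] by blast
  moreover have "\<forall>n. u n \<in> Lq q \<and> integrable lebesgue (u n)" using assms(2,3) by blast
  ultimately show ?thesis using extends_to_TE[OF assms(1)] unfolding extends_to_def by blast
qed

lemma trunc_L1:
  assumes "integrable lebesgue f"
  shows "integrable lebesgue (trunc n f)" "(\<lambda>n. power_integral 1 (\<lambda>x. trunc n f x - f x)) \<longlonglongrightarrow> 0"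
proof -
  have f: "f \<in> borel_measurable lebesgue" "power_integral 1 f < \<infinity>"
    using assms integrable_iff_power_integral by blast+
  show "integrable lebesgue (trunc n f)" by (rule nice_integrable[OF nice_trunc[OF f(1)]])
  show "(\<lambda>n. power_integral 1 (\<lambda>x. trunc n f x - f x)) \<longlonglongrightarrow> 0"
    by (rule power_integral_trunc_tendsto[OF f]) simp
qed

lemma TE_limit_trunc:
  assumes f: "integrable lebesgue f"
  shows "tendsto_in_measure (\<lambda>n. T (trunc n f)) (TE f)"
  by (rule TE_limit[OF f trunc_Lq trunc_L1(1)[OF f] trunc_L1(2)[OF f]])
    (rule borel_measurable_integrable[OF f])

text \<open>\<open>T\<close> of the truncations tends to the extension in measure, so again only the
  level has to be halved, which turns the factor 2 of \<open>weak_type_Lq\<close> into 4.\<close>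

lemma weak_type_TE:
  assumes f: "integrable lebesgue f" and t: "t > 0"
  shows "ennreal t * superlevel (TE f) t \<le> ennreal (4 * nice_const) * power_integral 1 f"
proof -
  have fm [measurable]: "f \<in> borel_measurable lebesgue" using f by simp
  define P where "P n = superlevel (\<lambda>x. T (trunc n f) x - TE f x) (t / 2)" for n
  have bound: "ennreal t * superlevel (TE f) t \<le> ennreal (4 * nice_const) * power_integral 1 f + ennreal t * P n" for n
  proof -
    note fn = trunc_Lq[OF fm, of n]
    have "AE x in lebesgue. TE f x = T (trunc n f) x + (TE f x - T (trunc n f) x)" by simp
    then have "superlevel (TE f) (t / 2 + t / 2) \<le> superlevel (T (trunc n f)) (t / 2) + superlevel (\<lambda>x. TE f x - T (trunc n f) x) (t / 2)"
      using TE_measurable[OF f] T_measurable[OF fn] by (intro superlevel_add) auto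
    then have "ennreal t * superlevel (TE f) t \<le> ennreal t * superlevel (T (trunc n f)) (t / 2) + ennreal t * P n"
      unfolding P_def superlevel_uminus[of "TE f"] by (simp add: distrib_left[symmetric] mult_left_mono)
    also have "ennreal t * superlevel (T (trunc n f)) (t / 2) \<le> ennreal (4 * nice_const) * power_integral 1 f"
    proof -
      have "ennreal t * superlevel (T (trunc n f)) (t / 2) = 2 * (ennreal (t / 2) * superlevel (T (trunc n f)) (t / 2))"
        unfolding mult.assoc[symmetric] ennreal_numeral[symmetric] using t by (subst ennreal_mult[symmetric]) auto
      also have "\<dots> \<le> 2 * (ennreal (2 * nice_const) * power_integral 1 (trunc n f))"
        using t by (intro mult_left_mono weak_type_Lq fn) auto
      also have "\<dots> \<le> 2 * (ennreal (2 * nice_const) * power_integral 1 f)"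
        unfolding power_integral_1 by (intro mult_left_mono nn_integral_mono ennreal_leI norm_trunc_le) auto
      also have "\<dots> = ennreal (4 * nice_const) * power_integral 1 f"
        unfolding mult.assoc[symmetric] ennreal_numeral[symmetric]
        using nice_const_nonneg by (subst ennreal_mult[symmetric]) auto
      finally show ?thesis .
    qed
    finally show ?thesis by (simp add: add_right_mono)
  qed
  show ?thesis
  proof (rule LIMSEQ_le_const)
    have "P \<longlonglongrightarrow> 0" unfolding P_def[abs_def] using TE_limit_trunc[OF f] t by (simp add: tendsto_in_measure_iff)
    then have "(\<lambda>n. ennreal (4 * nice_const) * power_integral 1 f + ennreal t * P n)
        \<longlonglongrightarrow> ennreal (4 * nice_const) * power_integral 1 f + ennreal t * 0"
      by (intro tendsto_add tendsto_const ennreal_tendsto_cmult) auto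
    then show "(\<lambda>n. ennreal (4 * nice_const) * power_integral 1 f + ennreal t * P n)
        \<longlonglongrightarrow> ennreal (4 * nice_const) * power_integral 1 f" by simp
    show "\<exists>M. \<forall>n\<ge>M. ennreal t * superlevel (TE f) t \<le> ennreal (4 * nice_const) * power_integral 1 f + ennreal t * P n"
      using bound by blast
  qed
qed

lemma TE_AE_0:
  assumes "integrable lebesgue f" "AE x in lebesgue. f x = 0"
  shows "AE x in lebesgue. TE f x = 0"
proof (rule AE_eq_0_of_superlevel[OF TE_measurable[OF assms(1)]])
  fix e :: real assume e: "e > 0"
  have "ennreal e * superlevel (TE f) e \<le> 0"
    using weak_type_TE[OF assms(1) e] power_integral_AE_0[OF assms(2)] by simp
  then show "superlevel (TE f) e = 0" using e by auto
qed

text \<open>The extension is a mere choice, so additivity has to be recovered in the limit from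
  approximants, on which \<open>T\<close> is additive. Three errors share the level
  \<open>e\<close>.\<close>

lemma TE_add:
  assumes f: "integrable lebesgue f" and g: "integrable lebesgue g"
  shows "AE x in lebesgue. TE (\<lambda>y. f y + g y) x = TE f x + TE g x"
proof -
  let ?s = "\<lambda>y. f y + g y"
  have s: "integrable lebesgue ?s" using f g by simp
  \<comment> \<open>The truncation of a sum is not the sum of the truncations; the extension
    property allows any approximating sequence, so the latter may be taken.\<close>
  define u where "u n y = trunc n f y + trunc n g y" for n y
  have m [measurable]: "f \<in> borel_measurable lebesgue" "g \<in> borel_measurable lebesgue" using f g by auto
  note TEm [measurable] = TE_measurable[OF f] TE_measurable[OF g] TE_measurable[OF s]
  have Tm [measurable]: "T (trunc n f) \<in> borel_measurable lebesgue" "T (trunc n g) \<in> borel_measurable lebesgue" for n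
    using T_measurable trunc_Lq m by blast+
  have uLq: "u n \<in> Lq q" for n unfolding u_def[abs_def] using m by (intro Lq_add trunc_Lq q_pos)
  have uint: "integrable lebesgue (u n)" for n unfolding u_def[abs_def] using f g trunc_L1 by auto
  have Tum [measurable]: "T (u n) \<in> borel_measurable lebesgue" for n using T_measurable[OF uLq] .
  have "(\<lambda>n. power_integral 1 (\<lambda>x. u n x - ?s x)) \<longlonglongrightarrow> 0"
  proof (rule tendsto_sandwich[OF _ _ tendsto_const])
    show "\<forall>\<^sub>F n in sequentially. power_integral 1 (\<lambda>x. u n x - ?s x)
        \<le> power_integral 1 (\<lambda>x. trunc n f x - f x) + power_integral 1 (\<lambda>x. trunc n g x - g x)"
    proof (intro always_eventually allI power_integral_1_triangle)
      fix n x
      show "norm (u n x - ?s x) \<le> norm (trunc n f x - f x) + norm (trunc n g x - g x)"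
        using norm_triangle_ineq[of "trunc n f x - f x" "trunc n g x - g x"] by (simp add: u_def algebra_simps)
    qed measurable
    show "(\<lambda>n. power_integral 1 (\<lambda>x. trunc n f x - f x) + power_integral 1 (\<lambda>x. trunc n g x - g x)) \<longlonglongrightarrow> 0"
      using tendsto_add[OF trunc_L1(2)[OF f] trunc_L1(2)[OF g]] by simp
  qed simp
  then have limu: "tendsto_in_measure (\<lambda>n. T (u n)) (TE ?s)" by (intro TE_limit s uLq uint)
  have "AE x in lebesgue. TE ?s x - (TE f x + TE g x) = 0"
  proof (rule AE_eq_0_of_superlevel)
    show "(\<lambda>x. TE ?s x - (TE f x + TE g x)) \<in> borel_measurable lebesgue" by measurable
    fix e :: real assume e: "e > 0"
    define e' where "e' = e / 3"
    have e': "e' > 0" "e = e' + (e' + e')" using e by (auto simp: e'_def)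
    have "superlevel (\<lambda>x. TE ?s x - (TE f x + TE g x)) e
      \<le> superlevel (\<lambda>x. T (u n) x - TE ?s x) e' + (superlevel (\<lambda>x. T (trunc n f) x - TE f x) e' + superlevel (\<lambda>x. T (trunc n g) x - TE g x) e')" for n
    proof -
      have "AE x in lebesgue. T (u n) x = T (trunc n f) x + T (trunc n g) x"
        unfolding u_def[abs_def] by (intro T_add trunc_Lq m)
      then have "AE x in lebesgue. TE ?s x - (TE f x + TE g x)
          = (TE ?s x - T (u n) x) + ((T (trunc n f) x - TE f x) + (T (trunc n g) x - TE g x))"
        by eventually_elim simp
      then have "superlevel (\<lambda>x. TE ?s x - (TE f x + TE g x)) (e' + (e' + e'))
        \<le> superlevel (\<lambda>x. TE ?s x - T (u n) x) e' + superlevel (\<lambda>x. (T (trunc n f) x - TE f x) + (T (trunc n g) x - TE g x)) (e' + e')"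
        by (intro superlevel_add) measurable
      also have "superlevel (\<lambda>x. (T (trunc n f) x - TE f x) + (T (trunc n g) x - TE g x)) (e' + e')
        \<le> superlevel (\<lambda>x. T (trunc n f) x - TE f x) e' + superlevel (\<lambda>x. T (trunc n g) x - TE g x) e'"
        by (intro superlevel_add AE_I2) auto
      finally show ?thesis unfolding e'(2)[symmetric] superlevel_uminus[of "TE ?s"] by (simp add: add_left_mono)
    qed
    moreover have "(\<lambda>n. superlevel (\<lambda>x. T (u n) x - TE ?s x) e' + (superlevel (\<lambda>x. T (trunc n f) x - TE f x) e' + superlevel (\<lambda>x. T (trunc n g) x - TE g x) e')) \<longlonglongrightarrow> 0 + (0 + 0)"
      using limu TE_limit_trunc[OF f] TE_limit_trunc[OF g] e'(1)
      by (intro tendsto_add) (auto simp: tendsto_in_measure_iff)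
    ultimately have "superlevel (\<lambda>x. TE ?s x - (TE f x + TE g x)) e \<le> 0 + (0 + 0)"
      by (intro LIMSEQ_le_const) auto
    then show "superlevel (\<lambda>x. TE ?s x - (TE f x + TE g x)) e = 0" by simp
  qed
  then show ?thesis by eventually_elim simp
qed

text \<open>The kernel formula holds for the truncations of \<open>f\<close>, whose averages are no
  larger, so \<open>oscillation_bound\<close> applies to them with the same constant. Countably many
  truncations and one almost everywhere convergent subsequence leave a single null set for all pairs
  of points.\<close>

lemma TE_oscillation:
  assumes f: "integrable lebesgue f" and l: "l > 0" and t: "t \<ge> 0"
    and Q: "\<And>x x' i. x \<in> Q \<Longrightarrow> x' \<in> Q \<Longrightarrow> \<bar>x $ i - x' $ i\<bar> \<le> l"
    and f0: "\<And>x y. x \<in> Q \<Longrightarrow> y \<in> near l x \<Longrightarrow> f y = 0"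
    and avg: "\<And>x (j::nat). x \<in> Q \<Longrightarrow>
      (\<integral>\<^sup>+y\<in>near (2 ^ j * l) x. ennreal (norm (f y)) \<partial>lebesgue) \<le> ennreal (t * (2 ^ j * l) ^ CARD('n))"
  obtains Z where "Z \<in> null_sets lebesgue"
    "\<And>x x'. x \<in> Q - Z \<Longrightarrow> x' \<in> Q - Z \<Longrightarrow> norm (TE f x - TE f x') \<le> 2 ^ CARD('n) * osc_const * t"
proof -
  have fm [measurable]: "f \<in> borel_measurable lebesgue" using f by simp
  obtain r where r: "AE x in lebesgue. (\<lambda>k. T (trunc (r k) f) x) \<longlonglongrightarrow> TE f x"
    using tendsto_in_measure_subseq[OF _ TE_measurable[OF f] TE_limit_trunc[OF f]] T_measurable[OF trunc_Lq[OF fm]] by blast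
  have "AE x in lebesgue. \<forall>n. x \<notin> closure {y. trunc n f y \<noteq> 0} \<longrightarrow>
      has_bochner_integral lebesgue (\<lambda>y. K x y * trunc n f y) (T (trunc n f) x)"
    unfolding AE_all_countable using T_repr[OF nice_trunc[OF fm]] by blast
  with r have "AE x in lebesgue. (\<lambda>k. T (trunc (r k) f) x) \<longlonglongrightarrow> TE f x \<and>
    (\<forall>n. x \<notin> closure {y. trunc n f y \<noteq> 0} \<longrightarrow>
      has_bochner_integral lebesgue (\<lambda>y. K x y * trunc n f y) (T (trunc n f) x))"
    by eventually_elim blast
  then obtain Z where Z: "Z \<in> null_sets lebesgue"
    and good: "\<And>x. x \<notin> Z \<Longrightarrow> (\<lambda>k. T (trunc (r k) f) x) \<longlonglongrightarrow> TE f x"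
      "\<And>x n. x \<notin> Z \<Longrightarrow> x \<notin> closure {y. trunc n f y \<noteq> 0} \<Longrightarrow>
        has_bochner_integral lebesgue (\<lambda>y. K x y * trunc n f y) (T (trunc n f) x)"
    unfolding eventually_ae_filter by auto
  \<comment> \<open>The open ball around \<open>x\<close> misses the support and therefore also its
    closure.\<close>
  have supp: "x \<notin> closure {y. trunc n f y \<noteq> 0}" if "x \<in> Q" for x n
  proof -
    have "near l x \<inter> {y. trunc n f y \<noteq> 0} = {}" using f0[OF that] by (auto simp: trunc_def)
    then have "near l x \<inter> closure {y. trunc n f y \<noteq> 0} = {}"
      using open_Int_closure_eq_empty[OF open_near] by blast
    then show ?thesis using mem_near_self[OF l, of x] by blast
  qed
  show ?thesis
  proof (rule that[OF Z])
    fix x x' assume x: "x \<in> Q - Z" and x': "x' \<in> Q - Z"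
    have "norm (T (trunc (r k) f) x - T (trunc (r k) f) x') \<le> 2 ^ CARD('n) * osc_const * t" for k
    proof (rule oscillation_bound[OF l _ t])
      show "\<bar>x $ i - x' $ i\<bar> \<le> l" for i using Q x x' by blast
      show "trunc (r k) f \<in> borel_measurable lebesgue" by measurable
      show "trunc (r k) f y = 0" if "y \<in> near l x \<union> near l x'" for y
        using that f0 x x' by (auto simp: trunc_def)
      show "has_bochner_integral lebesgue (\<lambda>y. K x y * trunc (r k) f y) (T (trunc (r k) f) x)"
        using good(2) supp x by blast
      show "has_bochner_integral lebesgue (\<lambda>y. K x' y * trunc (r k) f y) (T (trunc (r k) f) x')"
        using good(2) supp x' by blast
      fix j :: nat
      have "(\<integral>\<^sup>+y\<in>near (2 ^ j * l) x. ennreal (norm (trunc (r k) f y)) \<partial>lebesgue)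
          \<le> (\<integral>\<^sup>+y\<in>near (2 ^ j * l) x. ennreal (norm (f y)) \<partial>lebesgue)"
        by (intro nn_integral_mono mult_right_mono ennreal_leI norm_trunc_le) auto
      also have "\<dots> \<le> ennreal (t * (2 ^ j * l) ^ CARD('n))" using avg x by blast
      finally show "(\<integral>\<^sup>+y\<in>near (2 ^ j * l) x. ennreal (norm (trunc (r k) f y)) \<partial>lebesgue)
          \<le> ennreal (t * (2 ^ j * l) ^ CARD('n))" .
    qed
    moreover have "(\<lambda>k. norm (T (trunc (r k) f) x - T (trunc (r k) f) x')) \<longlonglongrightarrow> norm (TE f x - TE f x')"
      using good(1) x x' by (intro tendsto_norm tendsto_diff) auto
    ultimately show "norm (TE f x - TE f x') \<le> 2 ^ CARD('n) * osc_const * t"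
      by (intro LIMSEQ_le_const2) auto
  qed
qed

end

section \<open>Sparse domination\<close>

text \<open>Divided by the volume of the cell and not of the triple, hence
  \<open>3 ^ CARD('n)\<close> times the average over the triple.\<close>

definition density_triple :: "(int \<Rightarrow> real ^ 'n) \<Rightarrow> (real ^ 'n \<Rightarrow> complex) \<Rightarrow> int \<times> ('n \<Rightarrow> int) \<Rightarrow> real" where
  "density_triple a f p = (LINT y:triple a p|lebesgue. norm (f y)) / vol p"

definition local_part :: "(int \<Rightarrow> real ^ 'n) \<Rightarrow> (real ^ 'n \<Rightarrow> complex) \<Rightarrow> int \<times> ('n \<Rightarrow> int) \<Rightarrow> real ^ 'n \<Rightarrow> complex" where
  "local_part a f p y = indicator (triple a p) y *\<^sub>R f y"

lemma density_triple_nonneg: "density_triple a f p \<ge> 0"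
  unfolding density_triple_def set_lebesgue_integral_def by (intro divide_nonneg_nonneg integral_nonneg_AE) auto

lemma nn_integral_triple:
  assumes "integrable lebesgue f"
  shows "(\<integral>\<^sup>+y\<in>triple a p. ennreal (norm (f y)) \<partial>lebesgue) = ennreal (density_triple a f p * vol p)"
proof -
  have "(\<integral>\<^sup>+y\<in>triple a p. ennreal (norm (f y)) \<partial>lebesgue)
      = (\<integral>\<^sup>+y. ennreal (indicator (triple a p) y *\<^sub>R norm (f y)) \<partial>lebesgue)"
    by (rule nn_integral_cong) (auto simp: indicator_def)
  also have "\<dots> = ennreal (LINT y:triple a p|lebesgue. norm (f y))"
    unfolding set_lebesgue_integral_def
    using integrable_mult_indicator[OF sets_triple integrable_norm[OF assms]]
    by (intro nn_integral_eq_integral) auto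
  finally show ?thesis by (simp add: density_triple_def)
qed

lemma integrable_local_part: "integrable lebesgue f \<Longrightarrow> integrable lebesgue (local_part a f p)"
  unfolding local_part_def[abs_def] by (rule integrable_mult_indicator[OF sets_triple])

lemma power_integral_local_part:
  assumes "integrable lebesgue f"
  shows "power_integral 1 (local_part a f p) = ennreal (density_triple a f p * vol p)"
proof -
  have "power_integral 1 (local_part a f p) = (\<integral>\<^sup>+y\<in>triple a p. ennreal (norm (f y)) \<partial>lebesgue)"
    unfolding power_integral_1 by (rule nn_integral_cong) (auto simp: local_part_def indicator_def)
  then show ?thesis using nn_integral_triple[OF assms] by simp
qed

context cz_lq
begin

definition weak_const :: real where "weak_const = 4 * nice_const"

text \<open>Makes the exceptional set of \<open>local_step\<close> as small as
  \<open>stopping_cells\<close> demands. The summand \<open>2 ^ CARD('n) * 16 ^ CARD('n)\<close>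
  counts the shifted grids and the volume ratio of the one-third trick.\<close>

definition stop_const :: real where
  "stop_const = 2 * (weak_const + 2 ^ CARD('n) * 16 ^ CARD('n)) * 2 ^ (CARD('n) + 1)"

text \<open>In units of \<open>stop_const\<close> times the density: the bound off the exceptional
  set, the bound for the local part at the comparison point, and the oscillation.\<close>

definition step_const :: real where
  "step_const = stop_const * (1 + 4 * (weak_const + 1) + 2 ^ CARD('n) * osc_const)"

lemma weak_const_nonneg: "weak_const \<ge> 0"
  using nice_const_nonneg by (simp add: weak_const_def)

lemma stop_const_ge: "stop_const \<ge> 1"
proof -
  have "(1::real) * 1 \<le> 2 ^ CARD('n) * 16 ^ CARD('n)" by (intro mult_mono one_le_power) auto
  then have "1 * 1 \<le> (2 * (weak_const + 2 ^ CARD('n) * 16 ^ CARD('n))) * 2 ^ (CARD('n) + 1)"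
    using weak_const_nonneg by (intro mult_mono one_le_power) auto
  then show ?thesis by (simp add: stop_const_def)
qed

lemma step_const_ge: "step_const \<ge> stop_const"
proof -
  have "stop_const * 1 \<le> step_const"
    unfolding step_const_def using stop_const_ge weak_const_nonneg osc_const_nonneg
    by (intro mult_left_mono) auto
  then show ?thesis by simp
qed

text \<open>Outside the exceptional set \<open>B\<close> both \<open>TE\<close> and the averages over all larger cells are under
  control.  A stopping cell \<open>q\<close> contains a point \<open>z\<close> outside \<open>B\<close> where moreover the part of \<open>f\<close> on
  the triple of \<open>q\<close> contributes little; the part off that triple hardly varies on \<open>q\<close>.\<close>

lemma local_step:
  fixes c0 :: "real ^ 'n" and f :: "real ^ 'n \<Rightarrow> complex" and p :: "int \<times> ('n \<Rightarrow> int)"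
  defines "a \<equiv> (\<lambda>_. c0)"
  assumes f: "integrable lebesgue f"
  shows "\<exists>ch. (\<forall>q\<in>ch. fst q < fst p \<and> cell a q \<subseteq> cell a p) \<and> disjoint_family_on (cell a) ch \<and>
    emeasure lebesgue (\<Union> (cell a ` ch)) \<le> ennreal (vol p / 2) \<and>
    (AE x in lebesgue. x \<in> cell a p \<longrightarrow>
      ((\<forall>q\<in>ch. x \<notin> cell a q) \<longrightarrow> norm (TE (local_part a f p) x) \<le> step_const * density_triple a f p) \<and>
      (\<forall>q\<in>ch. x \<in> cell a q \<longrightarrow>
        norm (TE (local_part a f p) x) \<le> step_const * density_triple a f p + norm (TE (local_part a f q) x)))"
proof -
  interpret grid a unfolding a_def by (rule grid_const)
  define den where "den = density_triple a f"
  define F where "F q = local_part a f q" for q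
  have Fint: "integrable lebesgue (F q)" for q unfolding F_def by (rule integrable_local_part[OF f])
  have fm [measurable]: "f \<in> borel_measurable lebesgue" using f by simp
  have TEm [measurable]: "TE (F q) \<in> borel_measurable lebesgue" for q by (rule TE_measurable[OF Fint])
  define la where "la = den p"
  have la0: "la \<ge> 0" unfolding la_def den_def by (rule density_triple_nonneg)
  \<comment> \<open>If the density vanishes there is no positive level to stop at, but the local
    part of \<open>f\<close> is then zero almost everywhere and so is its image.\<close>
  show ?thesis
  proof (cases "la = 0")
    case True
    have "power_integral 1 (F p) = 0"
      using power_integral_local_part[OF f, of a p] True by (simp add: F_def la_def den_def)
    then have "AE x in lebesgue. F p x = 0"
      unfolding power_integral_1 using Fint[of p] by (subst (asm) nn_integral_0_iff_AE) auto
    then have "AE x in lebesgue. TE (F p) x = 0" by (rule TE_AE_0[OF Fint])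
    then have "AE x in lebesgue. norm (TE (local_part a f p) x) \<le> step_const * density_triple a f p"
      by eventually_elim (use True in \<open>simp add: F_def la_def den_def\<close>)
    then have "AE x in lebesgue. x \<in> cell a p \<longrightarrow>
      ((\<forall>q\<in>{}. x \<notin> cell a q) \<longrightarrow> norm (TE (local_part a f p) x) \<le> step_const * density_triple a f p) \<and>
      (\<forall>q\<in>{}. x \<in> cell a q \<longrightarrow>
        norm (TE (local_part a f p) x) \<le> step_const * density_triple a f p + norm (TE (local_part a f q) x))"
      by eventually_elim simp
    then show ?thesis by (intro exI[of _ "{}"]) (simp add: disjoint_family_on_def)
  next
    case False
    then have la: "la > 0" using la0 by simp
    define al where "al = stop_const * la"
    have al: "al > 0" "la \<le> al" unfolding al_def using la stop_const_ge mult_right_mono[of 1 stop_const la] by auto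
    \<comment> \<open>Their union is a superlevel set of a maximal function over triples. With it
      inside \<open>B\<close>, a point outside \<open>B\<close> bounds the densities of all cells
      through it inside \<open>p\<close>.\<close>
    define big where "big = {q. cell a q \<subseteq> cell a p \<and> al < den q}"
    define B where "B = {x. al < norm (TE (F p) x)} \<union> \<Union> (cell a ` big)"
    have B1: "{x. al < norm (TE (F p) x)} \<in> sets lebesgue" by (rule sets_superlevel) measurable
    have B2: "\<Union> (cell a ` big) \<in> sets lebesgue" by (rule measurable_Union_cells)
    have Bm: "B \<in> sets lebesgue" unfolding B_def using B1 B2 by (rule sets.Un)
    define h where "h y = ennreal (norm (F p y))" for y
    have hm [measurable]: "h \<in> borel_measurable lebesgue" unfolding h_def[abs_def] using Fint[of p] by measurable
    have hI: "(\<integral>\<^sup>+y. h y \<partial>lebesgue) = ennreal (la * vol p)"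
      using power_integral_local_part[OF f, of a p] by (simp add: h_def F_def power_integral_1 la_def den_def)
    have m1: "ennreal al * superlevel (TE (F p)) al \<le> ennreal (weak_const * (la * vol p))"
    proof -
      have "ennreal al * superlevel (TE (F p)) al \<le> ennreal (4 * nice_const) * power_integral 1 (F p)"
        by (rule weak_type_TE[OF Fint al(1)])
      also have "\<dots> = ennreal (weak_const * (la * vol p))"
        using weak_const_nonneg by (simp add: power_integral_local_part[OF f] F_def la_def den_def ennreal_mult' weak_const_def)
      finally show ?thesis .
    qed
    \<comment> \<open>A triple of large density lies in a shifted cell with
      \<open>16 ^ CARD('n)\<close> times the volume, so the union is covered by the heavy cells of
      the shifted grids at the correspondingly reduced level.\<close>
    have m2: "ennreal al * emeasure lebesgue (\<Union> (cell a ` big)) \<le> ennreal (2 ^ CARD('n) * 16 ^ CARD('n) * (la * vol p))"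
    proof -
      define t where "t = al / 16 ^ CARD('n)"
      have t: "t > 0" using al by (simp add: t_def)
      define HH where "HH s = grid.heavy (shift c0 s) h (ennreal t)" for s
      have HHm: "\<Union> (cell (shift c0 s) ` HH s) \<in> sets lebesgue" for s by (rule measurable_Union_cells)
      have sub: "\<Union> (cell a ` big) \<subseteq> (\<Union>s\<in>UNIV. \<Union> (cell (shift c0 s) ` HH s))"
      proof
        fix x assume "x \<in> \<Union> (cell a ` big)"
        then obtain q where q: "q \<in> big" "x \<in> cell a q" by blast
        obtain s r where r: "fst r = fst q + 4" "triple (\<lambda>_. c0) q \<subseteq> cell (shift c0 s) r"
          by (rule one_third_trick)
        \<comment> \<open>Triples of subcells stay inside the triple of \<open>p\<close>, so only
          the local part of \<open>f\<close> and its total mass matter.\<close>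
        have tq: "triple a q \<subseteq> triple a p" using q by (intro triple_mono) (simp add: big_def)
        have vr: "vol r = 16 ^ CARD('n) * vol q"
          by (simp add: vol_def r(1) power_int_add power_mult_distrib)
        have "ennreal t * emeasure lebesgue (cell (shift c0 s) r) = ennreal (al * vol q)"
          using t al unfolding emeasure_cell by (simp add: ennreal_mult[symmetric] vr t_def)
        also have "\<dots> < ennreal (den q * vol q)"
          using q al by (intro ennreal_lessI) (auto simp: big_def intro!: mult_pos_pos)
        also have "\<dots> = (\<integral>\<^sup>+y\<in>triple a q. ennreal (norm (f y)) \<partial>lebesgue)"
          unfolding den_def by (rule nn_integral_triple[OF f, symmetric])
        also have "\<dots> \<le> (\<integral>\<^sup>+y\<in>cell (shift c0 s) r. h y \<partial>lebesgue)"
        proof (rule nn_integral_mono)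
          fix y
          show "ennreal (norm (f y)) * indicator (triple a q) y \<le> h y * indicator (cell (shift c0 s) r) y"
            using tq r(2) by (auto simp: h_def F_def local_part_def a_def indicator_def)
        qed
        finally have "r \<in> HH s" by (simp add: HH_def grid.heavy_def[OF grid_shift])
        moreover have "x \<in> cell (shift c0 s) r" using q r cell_subset_triple[of a q] by (auto simp: a_def)
        ultimately show "x \<in> (\<Union>s\<in>UNIV. \<Union> (cell (shift c0 s) ` HH s))" by blast
      qed
      have "emeasure lebesgue (\<Union> (cell a ` big)) \<le> emeasure lebesgue (\<Union>s\<in>UNIV. \<Union> (cell (shift c0 s) ` HH s))"
        by (rule emeasure_mono[OF sub]) (rule sets.finite_UN[OF finite HHm])
      also have "\<dots> \<le> (\<Sum>s\<in>UNIV. emeasure lebesgue (\<Union> (cell (shift c0 s) ` HH s)))"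
        using HHm by (intro emeasure_subadditive_finite) auto
      finally have "ennreal t * emeasure lebesgue (\<Union> (cell a ` big))
          \<le> ennreal t * (\<Sum>s\<in>UNIV. emeasure lebesgue (\<Union> (cell (shift c0 s) ` HH s)))"
        by (intro mult_left_mono) auto
      also have "\<dots> = (\<Sum>s\<in>UNIV. ennreal t * emeasure lebesgue (\<Union> (cell (shift c0 s) ` HH s)))"
        by (rule sum_distrib_left)
      also have "\<dots> \<le> (\<Sum>s\<in>(UNIV :: ('n \<Rightarrow> bool) set). ennreal (la * vol p))"
        unfolding HH_def hI[symmetric]
        by (intro sum_mono grid.emeasure_heavy grid_shift hm t) (simp add: hI)
      also have "\<dots> = ennreal (2 ^ CARD('n) * (la * vol p))"
        using la by (simp add: card_fun ennreal_mult ennreal_of_nat_eq_real_of_nat)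
      finally have "ennreal (16 ^ CARD('n)) * (ennreal t * emeasure lebesgue (\<Union> (cell a ` big)))
          \<le> ennreal (16 ^ CARD('n)) * ennreal (2 ^ CARD('n) * (la * vol p))"
        by (intro mult_left_mono) auto
      moreover have "ennreal (16 ^ CARD('n)) * (ennreal t * emeasure lebesgue (\<Union> (cell a ` big)))
          = ennreal al * emeasure lebesgue (\<Union> (cell a ` big))"
        unfolding mult.assoc[symmetric] using t by (subst ennreal_mult[symmetric]) (auto simp: t_def)
      moreover have "ennreal (16 ^ CARD('n)) * ennreal (2 ^ CARD('n) * (la * vol p)) = ennreal (2 ^ CARD('n) * 16 ^ CARD('n) * (la * vol p))"
        using la by (subst ennreal_mult[symmetric]) (auto simp: mult_ac)
      ultimately show ?thesis by simp
    qed
    have small: "emeasure lebesgue (B \<inter> cell a p) \<le> ennreal ((1 / 2) ^ (CARD('n) + 1) / 2 * vol p)"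
    proof -
      have "ennreal al * emeasure lebesgue (B \<inter> cell a p) \<le> ennreal al * emeasure lebesgue B"
        using Bm by (intro mult_left_mono emeasure_mono) auto
      also have "\<dots> \<le> ennreal al * (superlevel (TE (F p)) al + emeasure lebesgue (\<Union> (cell a ` big)))"
        unfolding B_def superlevel_def using B1 B2 by (intro mult_left_mono emeasure_subadditive) auto
      also have "\<dots> = ennreal al * superlevel (TE (F p)) al + ennreal al * emeasure lebesgue (\<Union> (cell a ` big))"
        by (rule distrib_left)
      also have "\<dots> \<le> ennreal (weak_const * (la * vol p)) + ennreal (2 ^ CARD('n) * 16 ^ CARD('n) * (la * vol p))"
        by (intro add_mono m1 m2)
      also have "\<dots> = ennreal ((weak_const + 2 ^ CARD('n) * 16 ^ CARD('n)) * (la * vol p))"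
        using weak_const_nonneg la by (subst ennreal_plus[symmetric]) (auto simp: distrib_right)
      also have "(weak_const + 2 ^ CARD('n) * 16 ^ CARD('n)) * (la * vol p) = al * ((1 / 2) ^ (CARD('n) + 1) / 2 * vol p)"
        unfolding al_def stop_const_def by (simp add: power_one_over)
      also have "ennreal (al * ((1 / 2) ^ (CARD('n) + 1) / 2 * vol p)) = ennreal al * ennreal ((1 / 2) ^ (CARD('n) + 1) / 2 * vol p)"
        using al by (intro ennreal_mult) auto
      finally show ?thesis using al by (subst (asm) ennreal_mult_le_mult_iff) auto
    qed
    obtain ch where ch: "\<And>q. q \<in> ch \<Longrightarrow> fst q < fst p \<and> cell a q \<subseteq> cell a p"
      "disjoint_family_on (cell a) ch"
      "emeasure lebesgue (\<Union> (cell a ` ch)) \<le> ennreal (vol p / 2)"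
      "\<And>q. q \<in> ch \<Longrightarrow> emeasure lebesgue (B \<inter> cell a q) \<le> ennreal (vol q / 2)"
      "AE x in lebesgue. x \<in> cell a p - \<Union> (cell a ` ch) \<longrightarrow> x \<notin> B"
      using stopping_cells[OF Bm small] by blast
    have child: "AE x in lebesgue. x \<in> cell a q \<longrightarrow>
        norm (TE (F p) x) \<le> step_const * la + norm (TE (F q) x)" if q: "q \<in> ch" for q
    proof -
      \<comment> \<open>The part of \<open>f\<close> on the triple of \<open>p\<close> that lies off
        the triple of \<open>q\<close>.\<close>
      define G where "G y = F p y - F q y" for y
      have Gint: "integrable lebesgue G" unfolding G_def[abs_def] using Fint by simp
      have qp: "cell a q \<subseteq> cell a p" using ch(1)[OF q] by blast
      have tqp: "triple a q \<subseteq> triple a p" by (rule triple_mono[OF qp])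
      have G_le: "norm (G y) \<le> norm (F p y)" for y using tqp by (auto simp: G_def F_def local_part_def indicator_def)
      have G_0: "G y = 0" if "y \<in> triple a q" for y using tqp that by (auto simp: G_def F_def local_part_def)
      \<comment> \<open>Large enough for the weak type estimate to confine the superlevel set of
        \<open>TE (F q)\<close> to a quarter of the volume of \<open>q\<close>, less than what
        \<open>B\<close> leaves free. The added 1 keeps it positive.\<close>
      define mu where "mu = 4 * (weak_const + 1) * al"
      have mu: "mu > 0" unfolding mu_def using weak_const_nonneg al by simp
      have not_null: "\<not> emeasure lebesgue (cell a q - B) \<le> ennreal (vol q / 4)"
      proof
        assume le: "emeasure lebesgue (cell a q - B) \<le> ennreal (vol q / 4)"
        have "ennreal (vol q) = emeasure lebesgue ((B \<inter> cell a q) \<union> (cell a q - B))"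
          unfolding emeasure_cell[of a q, symmetric] by (rule arg_cong[where f = "emeasure lebesgue"]) blast
        also have "\<dots> \<le> emeasure lebesgue (B \<inter> cell a q) + emeasure lebesgue (cell a q - B)"
          using Bm by (intro emeasure_subadditive) auto
        also have "\<dots> \<le> ennreal (vol q / 2) + ennreal (vol q / 4)" by (intro add_mono ch(4)[OF q] le)
        also have "\<dots> = ennreal (vol q / 2 + vol q / 4)" by (subst ennreal_plus[symmetric]) auto
        finally have "vol q \<le> vol q / 2 + vol q / 4" by (subst (asm) ennreal_le_iff) auto
        then show False using vol_pos[of q] by linarith
      qed
      have "cell a q - B \<noteq> {}"
      proof
        assume empty: "cell a q - B = {}"
        show False using not_null unfolding empty by simp
      qed
      then obtain z0 where z0: "z0 \<in> cell a q" "z0 \<notin> B" by blast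
      \<comment> \<open>Every cell between \<open>q\<close> and \<open>p\<close> contains
        \<open>z0\<close>, which lies outside \<open>B\<close>, so none of them is in
        \<open>big\<close>. The comparison point \<open>z\<close> has to satisfy more and can be
        found only with the help of this bound.\<close>
      have den_le: "den r \<le> al" if "z0 \<in> cell a r" "cell a r \<subseteq> cell a p" for r
      proof (rule ccontr)
        assume "\<not> den r \<le> al"
        then have "r \<in> big" using that by (simp add: big_def)
        then have "z0 \<in> B" using that unfolding B_def by blast
        then show False using z0 by blast
      qed
      have mq: "superlevel (TE (F q)) mu \<le> ennreal (vol q / 4)"
      proof -
        have "ennreal mu * superlevel (TE (F q)) mu \<le> ennreal (4 * nice_const) * power_integral 1 (F q)"
          by (rule weak_type_TE[OF Fint mu])
        also have "\<dots> = ennreal (weak_const * (den q * vol q))"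
          using weak_const_nonneg by (simp add: power_integral_local_part[OF f] F_def den_def ennreal_mult' weak_const_def)
        also have "\<dots> \<le> ennreal (mu * (vol q / 4))"
        proof (rule ennreal_leI)
          have "weak_const * (den q * vol q) \<le> (weak_const + 1) * (al * vol q)"
            using weak_const_nonneg den_le[OF z0(1) qp] al density_triple_nonneg[of a f q]
            by (intro mult_mono) (auto simp: den_def)
          also have "\<dots> = mu * (vol q / 4)" by (simp add: mu_def)
          finally show "weak_const * (den q * vol q) \<le> mu * (vol q / 4)" .
        qed
        also have "\<dots> = ennreal mu * ennreal (vol q / 4)" using mu by (intro ennreal_mult) auto
        finally show ?thesis using mu by (subst (asm) ennreal_mult_le_mult_iff) auto
      qed
      obtain Z where Z: "Z \<in> null_sets lebesgue"
        and osc: "\<And>x x'. x \<in> cell a q - Z \<Longrightarrow> x' \<in> cell a q - Z \<Longrightarrow> norm (TE G x - TE G x') \<le> 2 ^ CARD('n) * osc_const * al"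
      proof (rule TE_oscillation[OF Gint, of "2 powi fst q" al "cell a q"])
        show "\<bar>x $ i - x' $ i\<bar> \<le> 2 powi fst q" if "x \<in> cell a q" "x' \<in> cell a q" for x x' i
          using cell_dist[OF that] by (rule less_imp_le)
        show "G y = 0" if "x \<in> cell a q" "y \<in> near (2 powi fst q) x" for x y
          using that by (intro G_0 mem_triple_of_dist[of x]) (auto simp: near_def)
        fix x and j :: nat assume x: "x \<in> cell a q"
        \<comment> \<open>The ancestor of \<open>q\<close> that is \<open>j\<close> generations up;
          the ball in question lies in its triple.\<close>
        define r where "r = index a (fst q + int j) x"
        have l: "2 ^ j * (2::real) powi fst q = 2 powi fst r"
          unfolding r_def fst_index by (subst power_int_add) (auto simp: mult.commute)
        have volr: "(2 ^ j * (2::real) powi fst q) ^ CARD('n) = vol r" unfolding l vol_def ..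
        have xr: "x \<in> cell a r" unfolding r_def by simp
        have qr: "cell a q \<subseteq> cell a r" using x xr by (intro cell_subset[of x]) (auto simp: r_def)
        have "(\<integral>\<^sup>+y\<in>near (2 ^ j * 2 powi fst q) x. ennreal (norm (G y)) \<partial>lebesgue) \<le> ennreal (al * vol r)"
        proof (cases "fst r \<le> fst p")
          case True
          have "cell a r \<subseteq> cell a p" using x qp xr True by (intro cell_subset[of x]) auto
          then have "den r \<le> al" using den_le qr z0 by blast
          have "(\<integral>\<^sup>+y\<in>near (2 ^ j * 2 powi fst q) x. ennreal (norm (G y)) \<partial>lebesgue)
              \<le> (\<integral>\<^sup>+y\<in>triple a r. ennreal (norm (f y)) \<partial>lebesgue)"
          proof (rule nn_integral_mono)
            fix y
            have "norm (F p y) \<le> norm (f y)" by (simp add: F_def local_part_def indicator_def)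
            then have "norm (G y) \<le> norm (f y)" using G_le[of y] by linarith
            moreover have "y \<in> near (2 ^ j * 2 powi fst q) x \<Longrightarrow> y \<in> triple a r"
              unfolding l using xr by (intro mem_triple_of_dist[of x]) (auto simp: near_def)
            ultimately show "ennreal (norm (G y)) * indicator (near (2 ^ j * 2 powi fst q) x) y
              \<le> ennreal (norm (f y)) * indicator (triple a r) y"
              by (auto simp: indicator_def ennreal_leI)
          qed
          also have "\<dots> = ennreal (den r * vol r)" unfolding den_def by (rule nn_integral_triple[OF f])
          also have "\<dots> \<le> ennreal (al * vol r)" using \<open>den r \<le> al\<close> by (intro ennreal_leI mult_right_mono) auto
          finally show ?thesis .
        next
          case False
          \<comment> \<open>Ancestors beyond \<open>p\<close> are not covered by
            \<open>den_le\<close>; for them the total mass suffices, since their volume is at least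
            that of \<open>p\<close>.\<close>
          have "(\<integral>\<^sup>+y\<in>near (2 ^ j * 2 powi fst q) x. ennreal (norm (G y)) \<partial>lebesgue) \<le> (\<integral>\<^sup>+y. h y \<partial>lebesgue)"
            using G_le by (intro nn_integral_mono) (auto simp: h_def indicator_def ennreal_leI)
          also have "\<dots> = ennreal (la * vol p)" by (rule hI)
          also have "\<dots> \<le> ennreal (al * vol r)"
            using False al vol_mono[of p r] by (intro ennreal_leI mult_mono) auto
          finally show ?thesis .
        qed
        then show "(\<integral>\<^sup>+y\<in>near (2 ^ j * 2 powi fst q) x. ennreal (norm (G y)) \<partial>lebesgue)
            \<le> ennreal (al * (2 ^ j * 2 powi fst q) ^ CARD('n))"
          unfolding volr .
      next
        show "0 < (2::real) powi fst q" "0 \<le> al" using al by auto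
      next
        fix Z assume "Z \<in> null_sets lebesgue"
          "\<And>x x'. x \<in> cell a q - Z \<Longrightarrow> x' \<in> cell a q - Z \<Longrightarrow> norm (TE G x - TE G x') \<le> 2 ^ CARD('n) * osc_const * al"
        then show thesis by (rule that)
      qed
      have "AE x in lebesgue. TE (\<lambda>y. F q y + G y) x = TE (F q) x + TE G x" by (rule TE_add[OF Fint Gint])
      moreover have "(\<lambda>y. F q y + G y) = F p" by (simp add: G_def fun_eq_iff)
      ultimately have split: "AE x in lebesgue. TE (F p) x = TE (F q) x + TE G x" by simp
      have "AE x in lebesgue. x \<notin> Z" by (rule AE_not_in[OF Z])
      with split have ae: "AE x in lebesgue. TE (F p) x = TE (F q) x + TE G x \<and> x \<notin> Z" by eventually_elim simp
      \<comment> \<open>Otherwise almost all of \<open>cell a q - B\<close> would lie in the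
        superlevel set of \<open>TE (F q)\<close>, which is too small for that by \<open>mq\<close>
        and \<open>not_null\<close>.\<close>
      obtain z where z: "z \<in> cell a q" "z \<notin> B" "\<not> mu < norm (TE (F q) z)"
        "TE (F p) z = TE (F q) z + TE G z" "z \<notin> Z"
      proof (rule ccontr)
        assume "\<not> thesis"
        then have none: "\<And>z. z \<in> cell a q \<Longrightarrow> z \<notin> B \<Longrightarrow> TE (F p) z = TE (F q) z + TE G z \<Longrightarrow> z \<notin> Z \<Longrightarrow> mu < norm (TE (F q) z)"
          using that by blast
        have "emeasure lebesgue (cell a q - B) \<le> superlevel (TE (F q)) mu"
          unfolding superlevel_def
        proof (rule emeasure_mono_AE)
          show "AE x in lebesgue. x \<in> cell a q - B \<longrightarrow> x \<in> {x. mu < norm (TE (F q) x)}"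
            using ae by eventually_elim (use none in blast)
          show "{x. mu < norm (TE (F q) x)} \<in> sets lebesgue" by (rule sets_superlevel[OF TEm])
        qed
        then show False using mq not_null by (meson order_trans)
      qed
      have "norm (TE (F p) z) \<le> al" using z(2) by (auto simp: B_def not_less)
      moreover have "norm (TE G z) \<le> norm (TE (F p) z) + norm (TE (F q) z)"
        using z(4) norm_triangle_ineq4[of "TE (F p) z" "TE (F q) z"] by simp
      ultimately have Gz: "norm (TE G z) \<le> al + mu" using z(3) by linarith
      show ?thesis
        using ae
      proof eventually_elim
        case (elim x)
        show ?case
        proof
          assume x: "x \<in> cell a q"
          have "norm (TE G x - TE G z) \<le> 2 ^ CARD('n) * osc_const * al" using osc x z elim by blast
          then have "norm (TE G x) \<le> 2 ^ CARD('n) * osc_const * al + (al + mu)"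
            using Gz norm_triangle_ineq2[of "TE G x" "TE G z"] by linarith
          moreover have "norm (TE (F p) x) \<le> norm (TE (F q) x) + norm (TE G x)"
            using elim norm_triangle_ineq[of "TE (F q) x" "TE G x"] by simp
          moreover have "step_const * la = 2 ^ CARD('n) * osc_const * al + (al + mu)"
            by (simp add: step_const_def al_def mu_def algebra_simps)
          ultimately show "norm (TE (F p) x) \<le> step_const * la + norm (TE (F q) x)" by linarith
        qed
      qed
    qed
    have "AE x in lebesgue. \<forall>q\<in>ch. x \<in> cell a q \<longrightarrow> norm (TE (F p) x) \<le> step_const * la + norm (TE (F q) x)"
      using child by (subst AE_ball_countable) auto
    moreover note ch(5)
    ultimately have "AE x in lebesgue. x \<in> cell a p \<longrightarrow>
      ((\<forall>q\<in>ch. x \<notin> cell a q) \<longrightarrow> norm (TE (local_part a f p) x) \<le> step_const * density_triple a f p) \<and>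
      (\<forall>q\<in>ch. x \<in> cell a q \<longrightarrow>
        norm (TE (local_part a f p) x) \<le> step_const * density_triple a f p + norm (TE (local_part a f q) x))"
    proof eventually_elim
      case (elim x)
      have "norm (TE (F p) x) \<le> step_const * la" if "x \<in> cell a p" "\<forall>q\<in>ch. x \<notin> cell a q"
      proof -
        have "x \<notin> B" using elim(2) that by blast
        then have "norm (TE (F p) x) \<le> al" by (auto simp: B_def not_less)
        also have "\<dots> \<le> step_const * la" unfolding al_def using la step_const_ge by (intro mult_right_mono) auto
        finally show ?thesis .
      qed
      then show ?case using elim(1) by (simp add: F_def la_def den_def)
    qed
    then show ?thesis using ch(1-3) by (intro exI[of _ ch]) auto
  qed
qed

end

section \<open>Transfer of the domination to the shifted grids\<close>

lemma infsum_le_sum_fibres: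
  fixes h :: "'a \<Rightarrow> ennreal" and s :: "'a \<Rightarrow> 'b::finite"
  shows "infsum h F \<le> (\<Sum>\<sigma>\<in>UNIV. infsum h {p \<in> F. s p = \<sigma>})"
proof (rule infsum_le_finite_sums)
  fix G assume G: "finite G" "G \<subseteq> F"
  have "sum h G = (\<Sum>\<sigma>\<in>UNIV. sum h {p \<in> G. s p = \<sigma>})"
    using G(1) by (intro sum.group[symmetric]) auto
  also have "\<dots> \<le> (\<Sum>\<sigma>\<in>UNIV. infsum h {p \<in> F. s p = \<sigma>})"
  proof (rule sum_mono)
    fix \<sigma>
    have "sum h {p \<in> G. s p = \<sigma>} = infsum h {p \<in> G. s p = \<sigma>}" using G by simp
    also have "\<dots> \<le> infsum h {p \<in> F. s p = \<sigma>}" using G by (intro infsum_ennreal_mono) auto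
    finally show "sum h {p \<in> G. s p = \<sigma>} \<le> infsum h {p \<in> F. s p = \<sigma>}" .
  qed
  finally show "sum h G \<le> (\<Sum>\<sigma>\<in>UNIV. infsum h {p \<in> F. s p = \<sigma>})" .
qed simp

lemma sparse_collection_empty:
  fixes D :: "(real ^ 'n) set set"
  assumes "dyadic_grid D" shows "sparse_collection ({} :: (real ^ 'n) set set)"
  unfolding sparse_collection_def using assms by (auto simp: disjoint_family_on_def)

context cz_lq
begin

text \<open>The first power of 16 compares the density of a triple with the average over the shifted
  cell around it. The last factor is that of \<open>sparse_of_carleson\<close>: the sets
  \<open>E\<close> fill the share \<open>1 / (2 * 16 ^ CARD('n))\<close> of the shifted cells, so
  \<open>N = 8 * 16 ^ CARD('n)\<close> is the least admissible choice.\<close>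

definition domination_const :: real where
  "domination_const = step_const * 16 ^ CARD('n) * (4 * real (8 * 16 ^ CARD('n)))"

lemma domination_const_pos: "domination_const > 0"
  using step_const_ge stop_const_ge by (simp add: domination_const_def)

lemma domination_by_shifts:
  fixes c0 :: "real ^ 'n" and f :: "real ^ 'n \<Rightarrow> complex" and k :: int
  defines "P \<equiv> cube c0 (2 powi k)"
  assumes f: "integrable lebesgue f" and supp: "AE x in lebesgue. x \<notin> P \<longrightarrow> f x = 0"
  obtains S :: "('n \<Rightarrow> bool) \<Rightarrow> (real ^ 'n) set set" where "\<And>\<sigma>. sparse_collection (S \<sigma>)"
    "AE x in lebesgue. x \<in> P \<longrightarrow> ennreal (norm (TE f x))
      \<le> ennreal domination_const * (\<Sum>\<sigma>\<in>UNIV. sparse_operator (S \<sigma>) (\<lambda>y. norm (f y)) x)"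
proof -
  define a :: "int \<Rightarrow> real ^ 'n" where "a = (\<lambda>_. c0)"
  interpret grid a unfolding a_def by (rule grid_const)
  \<comment> \<open>All generations are anchored at the corner of \<open>P\<close>, so that
    \<open>P\<close> is the cell of index 0.\<close>
  define p0 :: "int \<times> ('n \<Rightarrow> int)" where "p0 = (k, \<lambda>_. 0)"
  have P: "P = cell a p0" by (simp add: P_def cell_eq_cube p0_def a_def vec_eq_iff)
  define den where "den = density_triple a f"
  have den_nonneg: "den p \<ge> 0" for p unfolding den_def by (rule density_triple_nonneg)
  define g where "g y = norm (f y)" for y
  have g: "integrable lebesgue g" "\<And>y. g y \<ge> 0" unfolding g_def[abs_def] using f by auto
  have sc: "step_const \<ge> 0" using step_const_ge stop_const_ge by linarith
  define good where "good p A \<longleftrightarrow> (\<forall>q\<in>A. fst q < fst p \<and> cell a q \<subseteq> cell a p) \<and> disjoint_family_on (cell a) A \<and>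
    emeasure lebesgue (\<Union> (cell a ` A)) \<le> ennreal (vol p / 2) \<and>
    (AE x in lebesgue. x \<in> cell a p \<longrightarrow>
      ((\<forall>q\<in>A. x \<notin> cell a q) \<longrightarrow> norm (TE (local_part a f p) x) \<le> step_const * den p) \<and>
      (\<forall>q\<in>A. x \<in> cell a q \<longrightarrow>
        norm (TE (local_part a f p) x) \<le> step_const * den p + norm (TE (local_part a f q) x)))" for p A
  have "\<forall>p. \<exists>A. good p A"
  proof
    show "\<exists>A. good p A" for p
      unfolding good_def den_def a_def by (rule local_step[OF f])
  qed
  then obtain ch where good: "\<And>p. good p (ch p)" by metis
  have ch_sub: "cell a q \<subseteq> cell a p" and ch_level: "fst q < fst p" if "q \<in> ch p" for p q
    using good[of p] that by (auto simp: good_def)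
  have ch_disj: "disjoint_family_on (cell a) (ch p)"
    and ch_half: "emeasure lebesgue (\<Union> (cell a ` ch p)) \<le> ennreal (vol p / 2)" for p
    using good[of p] by (auto simp: good_def)
  define u where "u p x = ennreal (norm (TE (local_part a f p) x))" for p x
  define c where "c p = ennreal (step_const * den p)" for p
  have "AE x in lebesgue. \<forall>p. x \<in> cell a p \<longrightarrow>
      ((\<forall>q\<in>ch p. x \<notin> cell a q) \<longrightarrow> norm (TE (local_part a f p) x) \<le> step_const * den p) \<and>
      (\<forall>q\<in>ch p. x \<in> cell a q \<longrightarrow>
        norm (TE (local_part a f p) x) \<le> step_const * den p + norm (TE (local_part a f q) x))"
    unfolding AE_all_countable using good unfolding good_def by simp
  then have est: "AE x in lebesgue. \<forall>p\<in>UNIV. x \<in> cell a p \<longrightarrow>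
      ((\<forall>q\<in>ch p. x \<notin> cell a q) \<longrightarrow> u p x \<le> c p) \<and> (\<forall>q\<in>ch p. x \<in> cell a q \<longrightarrow> u p x \<le> c p + u q x)"
  proof eventually_elim
    case (elim x)
    show ?case
    proof (intro ballI impI conjI)
      fix p assume "x \<in> cell a p" "\<forall>q\<in>ch p. x \<notin> cell a q"
      then show "u p x \<le> c p" using elim unfolding u_def c_def by (intro ennreal_leI) blast
    next
      fix p q assume "x \<in> cell a p" "q \<in> ch p" "x \<in> cell a q"
      then have "norm (TE (local_part a f p) x) \<le> step_const * den p + norm (TE (local_part a f q) x)"
        using elim by blast
      then have "u p x \<le> ennreal (step_const * den p + norm (TE (local_part a f q) x))"
        unfolding u_def by (rule ennreal_leI)
      also have "\<dots> = c p + u q x" unfolding u_def c_def using sc den_nonneg by (intro ennreal_plus) auto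
      finally show "u p x \<le> c p + u q x" .
    qed
  qed
  obtain F E where FE: "\<And>p. p \<in> F \<Longrightarrow> E p \<in> sets lebesgue \<and> E p \<subseteq> cell a p \<and> vol p / 2 \<le> measure lebesgue (E p)"
    "disjoint_family_on E F" "\<And>p. p \<in> F \<Longrightarrow> cell a p \<subseteq> \<Union> (cell a ` {p0})"
    "AE x in lebesgue. \<forall>r\<in>{p0}. x \<in> cell a r \<longrightarrow> u r x \<le> (\<Sum>\<^sub>\<infinity>p\<in>F. c p * indicator (cell a p) x)"
  proof (rule stopping_tree[of "{p0}" UNIV ch u c, OF _ _ _ _ _ _ _ _ est])
    show "emeasure lebesgue (\<Union> (cell a ` {p0})) < \<infinity>" by (simp add: emeasure_cell)
    show "cell a q \<subseteq> cell a p" "fst q < fst p" if "q \<in> ch p" for p q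
      using ch_sub[OF that] ch_level[OF that] by simp_all
    show "disjoint_family_on (cell a) (ch p)" "emeasure lebesgue (\<Union> (cell a ` ch p)) \<le> ennreal (vol p / 2)" for p
      by (rule ch_disj, rule ch_half)
  next
    fix F E
    assume "\<And>p. p \<in> F \<Longrightarrow> E p \<in> sets lebesgue \<and> E p \<subseteq> cell a p \<and> vol p / 2 \<le> measure lebesgue (E p)"
      "disjoint_family_on E F" "\<And>p. p \<in> F \<Longrightarrow> cell a p \<subseteq> \<Union> (cell a ` {p0})"
      "AE x in lebesgue. \<forall>r\<in>{p0}. x \<in> cell a r \<longrightarrow> u r x \<le> (\<Sum>\<^sub>\<infinity>p\<in>F. c p * indicator (cell a p) x)"
    then show thesis by (rule that)
  qed (auto simp: disjoint_family_on_def)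
  have F_sub: "cell a p \<subseteq> cell a p0" if "p \<in> F" for p using FE(3)[OF that] by simp
  have "\<exists>s r. fst r = fst p + 4 \<and> triple a p \<subseteq> cell (shift c0 s) r" for p :: "int \<times> ('n \<Rightarrow> int)"
    unfolding a_def by (rule one_third_trick) blast
  then obtain s r where "\<And>p :: int \<times> ('n \<Rightarrow> int). fst (r p) = fst p + 4 \<and> triple a p \<subseteq> cell (shift c0 (s p)) (r p)"
    by metis
  then have sr: "\<And>p. fst (r p) = fst p + 4" "\<And>p. triple a p \<subseteq> cell (shift c0 (s p)) (r p)" by auto
  have vr: "vol (r p) = 16 ^ CARD('n) * vol p" for p
    by (simp add: vol_def sr(1) power_int_add power_mult_distrib)
  have cr: "cell a p \<subseteq> cell (shift c0 (s p)) (r p)" for p using cell_subset_triple sr(2) by blast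
  have den_le: "den p \<le> 16 ^ CARD('n) * average g (cell (shift c0 (s p)) (r p))" for p
  proof -
    have "ennreal (den p * vol p) = (\<integral>\<^sup>+y\<in>triple a p. ennreal (g y) \<partial>lebesgue)"
      unfolding den_def g_def by (rule nn_integral_triple[OF f, symmetric])
    also have "\<dots> \<le> (\<integral>\<^sup>+y\<in>cell (shift c0 (s p)) (r p). ennreal (g y) \<partial>lebesgue)"
      by (rule nn_set_integral_set_mono[OF sr(2)])
    also have "\<dots> = ennreal (average g (cell (shift c0 (s p)) (r p)) * vol (r p))"
      by (rule nn_integral_eq_average[OF g])
    finally have "den p * vol p \<le> average g (cell (shift c0 (s p)) (r p)) * vol (r p)"
      using average_nonneg[of g] g(2) by (subst (asm) ennreal_le_iff) auto
    then have "den p * vol p \<le> (16 ^ CARD('n) * average g (cell (shift c0 (s p)) (r p))) * vol p"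
      unfolding vr by (simp add: mult_ac)
    then show ?thesis using vol_pos[of p] by (rule mult_right_le_imp_le)
  qed
  define Fs where "Fs \<sigma> = {p \<in> F. s p = \<sigma>}" for \<sigma>
  define N where "N = (8 * 16 ^ CARD('n) :: nat)"
  obtain z0 where z0: "z0 \<in> cell a p0" using cell_nonempty by blast
  define dominates where "dominates \<sigma> F' \<longleftrightarrow> sparse_collection (cell (shift c0 \<sigma>) ` F') \<and>
    (AE x in lebesgue. (\<Sum>\<^sub>\<infinity>p\<in>r ` Fs \<sigma>. ennreal (average g (cell (shift c0 \<sigma>) p)) * indicator (cell (shift c0 \<sigma>) p) x)
      \<le> ennreal (4 * real N) * sparse_operator (cell (shift c0 \<sigma>) ` F') g x)" for \<sigma> F'
  have "\<exists>F'. dominates \<sigma> F'" for \<sigma>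
  proof -
    \<comment> \<open>Several cells of the family may have the same image under \<open>r\<close>;
      one of them supplies the set \<open>E\<close> for the image.\<close>
    define pick where "pick p = (SOME q. q \<in> Fs \<sigma> \<and> r q = p)" for p
    have pick: "pick p \<in> Fs \<sigma>" "r (pick p) = p" if "p \<in> r ` Fs \<sigma>" for p
    proof -
      have "\<exists>q. q \<in> Fs \<sigma> \<and> r q = p" using that by blast
      then have "pick p \<in> Fs \<sigma> \<and> r (pick p) = p" unfolding pick_def by (rule someI_ex)
      then show "pick p \<in> Fs \<sigma>" "r (pick p) = p" by auto
    qed
    obtain F' where "sparse_collection (cell (shift c0 \<sigma>) ` F')"
      "AE x in lebesgue. (\<Sum>\<^sub>\<infinity>p\<in>r ` Fs \<sigma>. ennreal (average g (cell (shift c0 \<sigma>) p)) * indicator (cell (shift c0 \<sigma>) p) x)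
        \<le> ennreal (4 * real N) * sparse_operator (cell (shift c0 \<sigma>) ` F') g x"
    proof (rule grid.sparse_of_carleson[OF grid_shift g])
      show "fst p \<le> k + 4" if p: "p \<in> r ` Fs \<sigma>" for p
      proof -
        obtain q where q: "q \<in> F" "p = r q" using p unfolding Fs_def by blast
        have "fst q \<le> k" using cell_subset_level[OF F_sub[OF q(1)]] by (simp add: p0_def)
        then show ?thesis using q sr(1) by simp
      qed
      show "E (pick p) \<in> sets lebesgue \<and> E (pick p) \<subseteq> cell (shift c0 \<sigma>) p \<and>
          ennreal (1 / (2 * 16 ^ CARD('n)) * vol p) \<le> emeasure lebesgue (E (pick p))" if "p \<in> r ` Fs \<sigma>" for p
      proof -
        have q: "pick p \<in> F" "s (pick p) = \<sigma>" "r (pick p) = p" using pick[OF that] by (auto simp: Fs_def)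
        have v: "1 / (2 * 16 ^ CARD('n)) * vol p = vol (pick p) / 2"
          using vr[of "pick p"] unfolding q(3) by simp
        have "E (pick p) \<in> lmeasurable"
          using FE(1)[OF q(1)] by (intro fmeasurableI2[OF cell_lmeasurable]) auto
        then have "ennreal (vol (pick p) / 2) \<le> emeasure lebesgue (E (pick p))"
          using FE(1)[OF q(1)] by (simp add: emeasure_eq_measure2 ennreal_leI)
        then show ?thesis using FE(1)[OF q(1)] cr[of "pick p"] unfolding v q by auto
      qed
      show "disjoint_family_on (\<lambda>p. E (pick p)) (r ` Fs \<sigma>)"
        unfolding disjoint_family_on_def
      proof (intro ballI impI)
        fix p q assume pq: "p \<in> r ` Fs \<sigma>" "q \<in> r ` Fs \<sigma>" "p \<noteq> q"
        then have "pick p \<noteq> pick q" using pick(2) by metis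
        moreover have "pick p \<in> F" "pick q \<in> F" using pick(1) pq by (auto simp: Fs_def)
        ultimately show "E (pick p) \<inter> E (pick q) = {}" using FE(2) by (auto simp: disjoint_family_on_def)
      qed
      \<comment> \<open>Each shifted cell contains a cell inside \<open>P\<close> and has a side of
        at most 16 times that of \<open>P\<close>, so all of them lie in one ball.\<close>
      show "emeasure lebesgue (\<Union> (cell (shift c0 \<sigma>) ` (r ` Fs \<sigma>))) < \<infinity>"
      proof -
        have "\<Union> (cell (shift c0 \<sigma>) ` (r ` Fs \<sigma>)) \<subseteq> near (2 powi (k + 4) + 2 powi k) z0"
        proof
          fix y assume "y \<in> \<Union> (cell (shift c0 \<sigma>) ` (r ` Fs \<sigma>))"
          then obtain q where q: "q \<in> F" "s q = \<sigma>" "y \<in> cell (shift c0 \<sigma>) (r q)" unfolding Fs_def by blast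
          obtain x where x: "x \<in> cell a q" using cell_nonempty by blast
          have "fst q \<le> k" using cell_subset_level[OF F_sub[OF q(1)]] by (simp add: p0_def)
          then have lev: "(2::real) powi fst (r q) \<le> 2 powi (k + 4)"
            by (intro power_int_increasing) (auto simp: sr(1))
          have "x \<in> cell (shift c0 \<sigma>) (r q)" using cr x q by blast
          then have yx: "\<bar>y $ i - x $ i\<bar> < 2 powi (k + 4)" for i using cell_dist[OF q(3), of x i] lev by linarith
          have xz: "\<bar>x $ i - z0 $ i\<bar> < 2 powi k" for i
            using cell_dist[of x a p0 z0 i] F_sub[OF q(1)] x z0 by (auto simp: p0_def)
          have "\<bar>y $ i - z0 $ i\<bar> < 2 powi (k + 4) + 2 powi k" for i
            using yx[of i] xz[of i] by linarith
          then show "y \<in> near (2 powi (k + 4) + 2 powi k) z0" by (simp add: near_def)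
        qed
        then have "emeasure lebesgue (\<Union> (cell (shift c0 \<sigma>) ` (r ` Fs \<sigma>))) \<le> emeasure lebesgue (near (2 powi (k + 4) + 2 powi k) z0)"
          by (intro emeasure_mono) auto
        also have "\<dots> \<le> ennreal ((2 * (2 powi (k + 4) + 2 powi k)) ^ CARD('n))" by (rule emeasure_near) simp
        also have "\<dots> < \<infinity>" by simp
        finally show ?thesis .
      qed
      show "(0::real) < 1 / (2 * 16 ^ CARD('n))" by simp
      show "4 \<le> real N * (1 / (2 * 16 ^ CARD('n)))" by (simp add: N_def)
    next
      fix F' assume "sparse_collection (cell (shift c0 \<sigma>) ` F')"
        "AE x in lebesgue. (\<Sum>\<^sub>\<infinity>p\<in>r ` Fs \<sigma>. ennreal (average g (cell (shift c0 \<sigma>) p)) * indicator (cell (shift c0 \<sigma>) p) x)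
          \<le> ennreal (4 * real N) * sparse_operator (cell (shift c0 \<sigma>) ` F') g x"
      then show thesis by (rule that)
    qed
    then show ?thesis unfolding dominates_def by blast
  qed
  then obtain F' where dom: "\<And>\<sigma>. dominates \<sigma> (F' \<sigma>)" by metis
  then have F': "\<And>\<sigma>. sparse_collection (cell (shift c0 \<sigma>) ` F' \<sigma>)"
    "\<And>\<sigma>. AE x in lebesgue. (\<Sum>\<^sub>\<infinity>p\<in>r ` Fs \<sigma>. ennreal (average g (cell (shift c0 \<sigma>) p)) * indicator (cell (shift c0 \<sigma>) p) x)
      \<le> ennreal (4 * real N) * sparse_operator (cell (shift c0 \<sigma>) ` F' \<sigma>) g x"
    unfolding dominates_def by auto
  have ptw: "(\<Sum>\<^sub>\<infinity>p\<in>Fs \<sigma>. c p * indicator (cell a p) x) \<le> ennreal (step_const * 16 ^ CARD('n)) *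
      (\<Sum>\<^sub>\<infinity>p\<in>r ` Fs \<sigma>. ennreal (average g (cell (shift c0 \<sigma>) p)) * indicator (cell (shift c0 \<sigma>) p) x)" for \<sigma> x
  proof -
    \<comment> \<open>At a fixed point the passage to images under \<open>r\<close> loses no term:
      the generation of \<open>r p\<close> gives that of \<open>p\<close>, and \<open>x\<close> then
      determines \<open>p\<close>.\<close>
    define H where "H = {p \<in> Fs \<sigma>. x \<in> cell a p}"
    have inj: "inj_on r H"
    proof (rule inj_onI)
      fix p q assume pq: "p \<in> H" "q \<in> H" "r p = r q"
      then have "fst p = fst q" using sr(1)[of p] sr(1)[of q] by simp
      then show "p = q" using cell_eq_of_level[of x p q] pq by (simp add: H_def)
    qed
    let ?av = "\<lambda>p. ennreal (average g (cell (shift c0 \<sigma>) p))"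
    have "(\<Sum>\<^sub>\<infinity>p\<in>Fs \<sigma>. c p * indicator (cell a p) x) \<le> (\<Sum>\<^sub>\<infinity>p\<in>H. ennreal (step_const * 16 ^ CARD('n)) * ?av (r p))"
    proof (rule infsum_ennreal_mono)
      fix p assume p: "p \<in> Fs \<sigma>" "c p * indicator (cell a p) x \<noteq> 0"
      have "step_const * den p \<le> step_const * (16 ^ CARD('n) * average g (cell (shift c0 \<sigma>) (r p)))"
        using den_le[of p] p sc by (intro mult_left_mono) (auto simp: Fs_def)
      then have "c p \<le> ennreal (step_const * 16 ^ CARD('n)) * ?av (r p)"
        unfolding c_def using sc average_nonneg[of g] g(2) by (subst ennreal_mult[symmetric]) (auto intro!: ennreal_leI simp: mult.assoc)
      moreover have "x \<in> cell a p" using p(2) by (auto simp: indicator_def split: if_splits)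
      ultimately show "p \<in> H \<and> c p * indicator (cell a p) x \<le> ennreal (step_const * 16 ^ CARD('n)) * ?av (r p)"
        using p by (simp add: H_def)
    qed
    also have "\<dots> \<le> ennreal (step_const * 16 ^ CARD('n)) * (\<Sum>\<^sub>\<infinity>p\<in>H. ?av (r p))"
      by (rule infsum_ennreal_cmult_le)
    also have "(\<Sum>\<^sub>\<infinity>p\<in>H. ?av (r p)) = (\<Sum>\<^sub>\<infinity>p\<in>r ` H. ?av p)"
      using infsum_reindex[OF inj, of ?av] by (simp add: o_def)
    also have "\<dots> \<le> (\<Sum>\<^sub>\<infinity>p\<in>r ` Fs \<sigma>. ?av p * indicator (cell (shift c0 \<sigma>) p) x)"
    proof (rule infsum_ennreal_mono)
      fix p assume "p \<in> r ` H"
      then obtain q where q: "q \<in> Fs \<sigma>" "x \<in> cell a q" "p = r q" by (auto simp: H_def)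
      then have "x \<in> cell (shift c0 \<sigma>) p" using cr[of q] by (auto simp: Fs_def)
      then show "p \<in> r ` Fs \<sigma> \<and> ?av p \<le> ?av p * indicator (cell (shift c0 \<sigma>) p) x" using q by simp
    qed
    finally show ?thesis by (simp add: mult_left_mono)
  qed
  \<comment> \<open>The tree starts from the local part of \<open>f\<close> on the triple of
    \<open>P\<close>, which differs from \<open>f\<close> only on a null set by the support
    condition.\<close>
  have TEf: "AE x in lebesgue. TE f x = TE (local_part a f p0) x"
  proof -
    define b where "b y = f y - local_part a f p0 y" for y
    have b: "integrable lebesgue b" unfolding b_def[abs_def] using f integrable_local_part[OF f] by simp
    have "AE x in lebesgue. b x = 0"
      using supp
    proof eventually_elim
      case (elim x)
      then show ?case using cell_subset_triple[of a p0] by (auto simp: b_def local_part_def P indicator_def)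
    qed
    then have b0: "AE x in lebesgue. TE b x = 0" by (rule TE_AE_0[OF b])
    have "AE x in lebesgue. TE (\<lambda>y. local_part a f p0 y + b y) x = TE (local_part a f p0) x + TE b x"
      by (rule TE_add[OF integrable_local_part[OF f] b])
    moreover have "(\<lambda>y. local_part a f p0 y + b y) = f" by (simp add: b_def fun_eq_iff)
    ultimately have "AE x in lebesgue. TE f x = TE (local_part a f p0) x + TE b x" by simp
    with b0 show ?thesis by eventually_elim simp
  qed
  have all: "AE x in lebesgue. \<forall>\<sigma>. (\<Sum>\<^sub>\<infinity>p\<in>r ` Fs \<sigma>. ennreal (average g (cell (shift c0 \<sigma>) p)) * indicator (cell (shift c0 \<sigma>) p) x)
      \<le> ennreal (4 * real N) * sparse_operator (cell (shift c0 \<sigma>) ` F' \<sigma>) g x"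
    using AE_finite_allI[OF finite F'(2), of UNIV] by simp
  show ?thesis
  proof (rule that[of "\<lambda>\<sigma>. cell (shift c0 \<sigma>) ` F' \<sigma>"])
    show "sparse_collection (cell (shift c0 \<sigma>) ` F' \<sigma>)" for \<sigma> by (rule F'(1))
    show "AE x in lebesgue. x \<in> P \<longrightarrow> ennreal (norm (TE f x))
      \<le> ennreal domination_const * (\<Sum>\<sigma>\<in>UNIV. sparse_operator (cell (shift c0 \<sigma>) ` F' \<sigma>) (\<lambda>y. norm (f y)) x)"
      using TEf all FE(4)
    proof eventually_elim
      case (elim x)
      show ?case
      proof
        assume x: "x \<in> P"
        have "ennreal (norm (TE f x)) = u p0 x" using elim(1) by (simp add: u_def)
        also have "\<dots> \<le> (\<Sum>\<^sub>\<infinity>p\<in>F. c p * indicator (cell a p) x)" using elim(3) x P by blast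
        also have "\<dots> \<le> (\<Sum>\<sigma>\<in>UNIV. \<Sum>\<^sub>\<infinity>p\<in>Fs \<sigma>. c p * indicator (cell a p) x)"
          unfolding Fs_def by (rule infsum_le_sum_fibres)
        also have "\<dots> \<le> (\<Sum>\<sigma>\<in>UNIV. ennreal (step_const * 16 ^ CARD('n)) *
            (ennreal (4 * real N) * sparse_operator (cell (shift c0 \<sigma>) ` F' \<sigma>) g x))"
          using elim(2) by (intro sum_mono order_trans[OF ptw] mult_left_mono) auto
        also have "\<dots> = ennreal domination_const * (\<Sum>\<sigma>\<in>UNIV. sparse_operator (cell (shift c0 \<sigma>) ` F' \<sigma>) g x)"
        proof -
          have "ennreal domination_const = ennreal (step_const * 16 ^ CARD('n)) * ennreal (4 * real N)"
            unfolding domination_const_def N_def using sc by (intro ennreal_mult) auto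
          then show ?thesis by (simp only: sum_distrib_left mult.assoc)
        qed
        finally show "ennreal (norm (TE f x))
          \<le> ennreal domination_const * (\<Sum>\<sigma>\<in>UNIV. sparse_operator (cell (shift c0 \<sigma>) ` F' \<sigma>) (\<lambda>y. norm (f y)) x)"
          unfolding g_def[abs_def] .
      qed
    qed
  qed
qed

lemma sparse_domination:
  fixes D :: "(real ^ 'n) set set" and f :: "real ^ 'n \<Rightarrow> complex"
  assumes D: "dyadic_grid D" "P \<in> D" and f: "integrable lebesgue f"
    and supp: "AE x in lebesgue. x \<notin> P \<longrightarrow> f x = 0"
  obtains S :: "nat \<Rightarrow> (real ^ 'n) set set" where "\<And>i. sparse_collection (S i)"
    "AE x in lebesgue. x \<in> P \<longrightarrow> ennreal (norm (TE f x))
      \<le> ennreal domination_const * (\<Sum>i = 1..3 ^ CARD('n). sparse_operator (S i) (\<lambda>y. norm (f y)) x)"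
proof -
  obtain c0 k where P: "P = cube c0 (2 powi k)" using D by (auto simp: dyadic_grid_def)
  obtain S0 :: "('n \<Rightarrow> bool) \<Rightarrow> (real ^ 'n) set set" where S0: "\<And>\<sigma>. sparse_collection (S0 \<sigma>)"
    "AE x in lebesgue. x \<in> P \<longrightarrow> ennreal (norm (TE f x))
      \<le> ennreal domination_const * (\<Sum>\<sigma>\<in>UNIV. sparse_operator (S0 \<sigma>) (\<lambda>y. norm (f y)) x)"
  proof (rule domination_by_shifts[OF f supp[unfolded P]])
    fix S :: "('n \<Rightarrow> bool) \<Rightarrow> (real ^ 'n) set set"
    assume "\<And>\<sigma>. sparse_collection (S \<sigma>)" "AE x in lebesgue. x \<in> cube c0 (2 powi k) \<longrightarrow> ennreal (norm (TE f x))
      \<le> ennreal domination_const * (\<Sum>\<sigma>\<in>UNIV. sparse_operator (S \<sigma>) (\<lambda>y. norm (f y)) x)"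
    then show thesis by (intro that[of S]) (simp_all add: P)
  qed
  obtain h where h: "bij_betw h {1..card (UNIV :: ('n \<Rightarrow> bool) set)} (UNIV :: ('n \<Rightarrow> bool) set)"
    using ex_bij_betw_nat_finite_1[OF finite] by blast
  have card: "card (UNIV :: ('n \<Rightarrow> bool) set) = 2 ^ CARD('n)" by (simp add: card_fun)
  \<comment> \<open>Two positions per coordinate give \<open>2 ^ CARD('n)\<close> families; the
    remaining indices up to \<open>3 ^ CARD('n)\<close> get the empty family.\<close>
  define S where "S i = (if i \<in> {1..2 ^ CARD('n)} then S0 (h i) else {})" for i
  show ?thesis
  proof (rule that[of S])
    show "sparse_collection (S i)" for i
      using S0(1) sparse_collection_empty[OF D(1)] by (simp add: S_def)
    show "AE x in lebesgue. x \<in> P \<longrightarrow> ennreal (norm (TE f x))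
      \<le> ennreal domination_const * (\<Sum>i = 1..3 ^ CARD('n). sparse_operator (S i) (\<lambda>y. norm (f y)) x)"
      using S0(2)
    proof eventually_elim
      case (elim x)
      have "(\<Sum>\<sigma>\<in>UNIV. sparse_operator (S0 \<sigma>) (\<lambda>y. norm (f y)) x)
          = (\<Sum>i = 1..2 ^ CARD('n). sparse_operator (S0 (h i)) (\<lambda>y. norm (f y)) x)"
        using sum.reindex_bij_betw[OF h, of "\<lambda>\<sigma>. sparse_operator (S0 \<sigma>) (\<lambda>y. norm (f y)) x"] by (simp add: card)
      also have "\<dots> = (\<Sum>i = 1..2 ^ CARD('n). sparse_operator (S i) (\<lambda>y. norm (f y)) x)"
        by (rule sum.cong) (auto simp: S_def)
      also have "\<dots> \<le> (\<Sum>i = 1..3 ^ CARD('n). sparse_operator (S i) (\<lambda>y. norm (f y)) x)"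
      proof (rule sum_mono2)
        have "(2::nat) ^ CARD('n) \<le> 3 ^ CARD('n)" by (intro power_mono) auto
        then show "{1..(2::nat) ^ CARD('n)} \<subseteq> {1..3 ^ CARD('n)}" by auto
      qed auto
      finally show ?case using elim by (meson mult_left_mono order_trans zero_le)
    qed
  qed
qed

end

section \<open>The Dini condition\<close>

text \<open>Half-open, so that these intervals partition the half-open unit interval over which the
  Dini integral extends.\<close>

definition dyadic_interval :: "nat \<Rightarrow> real set" where
  "dyadic_interval m = {(1 / 2) ^ (m + 1)<..(1 / 2) ^ m}"

lemma disjoint_dyadic_intervals: "disjoint_family dyadic_interval"
  unfolding disjoint_family_on_def
proof (intro ballI impI)
  have less: "dyadic_interval m \<inter> dyadic_interval n = {}" if "m < n" for m n
  proof -
    have "(1 / 2 :: real) ^ n \<le> (1 / 2) ^ (m + 1)" using that by (intro power_decreasing) auto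
    then show ?thesis by (auto simp: dyadic_interval_def)
  qed
  fix m n :: nat assume "m \<noteq> n"
  then show "dyadic_interval m \<inter> dyadic_interval n = {}"
    using less[of m n] less[of n m] by (auto simp: neq_iff)
qed

lemma sets_dyadic_interval [measurable]: "dyadic_interval m \<in> sets borel"
  by (simp add: dyadic_interval_def)

lemma emeasure_dyadic_interval: "emeasure lborel (dyadic_interval m) = ennreal ((1 / 2) ^ (m + 1))"
  unfolding dyadic_interval_def by (subst emeasure_lborel_Ioc) auto

lemma dyadic_interval_exists:
  assumes "0 < t" "t \<le> 1" obtains m where "t \<in> dyadic_interval m"
proof -
  let ?P = "\<lambda>n. (1 / 2) ^ n < t"
  have "\<exists>n. ?P n" using assms by (intro real_arch_pow_inv) auto
  then have P: "?P (LEAST n. ?P n)" by (rule LeastI_ex)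
  then have "(LEAST n. ?P n) \<noteq> 0" using assms by (metis not_less power_0)
  then obtain m where m: "(LEAST n. ?P n) = Suc m" using not0_implies_Suc by blast
  then have "\<not> ?P m" using not_less_Least[of m ?P] by simp
  then show ?thesis using that[of m] P m by (simp add: dyadic_interval_def)
qed

lemma dyadic_interval_bounds:
  assumes "t \<in> dyadic_interval m"
  shows "0 < t" "t \<le> 1" "2 ^ m \<le> 1 / t" "1 / t \<le> 2 ^ (m + 1)" "0 \<le> ln (1 / t)" "ln (1 / t) \<le> real m + 1"
proof -
  have t: "(1 / 2) ^ (m + 1) < t" "t \<le> (1 / 2) ^ m" using assms by (auto simp: dyadic_interval_def)
  show pos: "0 < t" using t(1) by (rule less_trans[rotated]) simp
  show one: "t \<le> 1" using t(2) power_le_one[of "1 / 2 :: real" m] by linarith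
  show "2 ^ m \<le> 1 / t" using t(2) pos by (simp add: field_simps power_one_over)
  show ub: "1 / t \<le> 2 ^ (m + 1)" using t(1) pos by (simp add: field_simps power_one_over)
  show "0 \<le> ln (1 / t)" using pos one by simp
  have "ln (1 / t) \<le> ln (2 ^ (m + 1))" using ub pos by (subst ln_le_cancel_iff) auto
  also have "\<dots> = (real m + 1) * ln 2" by (subst ln_realpow) auto
  also have "\<dots> \<le> (real m + 1) * 1" using ln_le_minus_one[of 2] by (intro mult_left_mono) auto
  finally show "ln (1 / t) \<le> real m + 1" by simp
qed

lemma powi_minus_nat: "(2::real) powi (- int m) = (1 / 2) ^ m"
  by (simp add: power_int_minus power_one_over inverse_eq_divide)

context
  fixes \<omega> :: "real \<Rightarrow> real"
  assumes \<omega>: "modulus_of_continuity \<omega>"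
begin

lemma modulus_mono: "0 \<le> s \<Longrightarrow> s \<le> t \<Longrightarrow> \<omega> s \<le> \<omega> t"
  using \<omega> by (auto simp: modulus_of_continuity_def mono_on_def)

lemma modulus_pos: "0 < t \<Longrightarrow> 0 < \<omega> t"
  using \<omega> by (auto simp: modulus_of_continuity_def)

lemma modulus_nonneg: "0 \<le> t \<Longrightarrow> 0 \<le> \<omega> t"
  using \<omega> by (cases "t = 0") (auto simp: modulus_of_continuity_def intro: less_imp_le)

text \<open>On the \<open>m\<close>-th dyadic interval the integrand is at least
  \<open>\<omega> ((1 / 2) ^ (m + 1)) * 2 ^ m\<close>, because the logarithm is nonnegative.
  Multiplied by the length of the interval this is half a term of the series.\<close>

lemma summable_of_log_dini:
  assumes "log_dini \<omega>" shows "summable (\<lambda>j. \<omega> ((1 / 2) ^ j))"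
proof -
  have "(\<Sum>m. ennreal (\<omega> ((1 / 2) ^ (m + 1)) / 2)) = (\<Sum>m. ennreal (\<omega> ((1 / 2) ^ (m + 1)) * 2 ^ m) * emeasure lborel (dyadic_interval m))"
  proof (rule suminf_cong)
    fix m
    have "\<omega> ((1 / 2) ^ (m + 1)) / 2 = \<omega> ((1 / 2) ^ (m + 1)) * 2 ^ m * (1 / 2) ^ (m + 1)"
      by (simp add: power_one_over)
    then show "ennreal (\<omega> ((1 / 2) ^ (m + 1)) / 2) = ennreal (\<omega> ((1 / 2) ^ (m + 1)) * 2 ^ m) * emeasure lborel (dyadic_interval m)"
      unfolding emeasure_dyadic_interval using modulus_nonneg[of "(1 / 2) ^ (m + 1)"]
      by (subst ennreal_mult[symmetric]) auto
  qed
  also have "\<dots> = (\<integral>\<^sup>+t. (\<Sum>m. ennreal (\<omega> ((1 / 2) ^ (m + 1)) * 2 ^ m) * indicator (dyadic_interval m) t) \<partial>lborel)"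
    by (subst nn_integral_suminf) (auto simp: nn_integral_cmult_indicator)
  also have "\<dots> \<le> (\<integral>\<^sup>+t\<in>{0<..1}. ennreal (\<omega> t * (1 + ln (1 / t)) / t) \<partial>lborel)"
  proof (rule nn_integral_mono)
    fix t :: real
    show "(\<Sum>m. ennreal (\<omega> ((1 / 2) ^ (m + 1)) * 2 ^ m) * indicator (dyadic_interval m) t)
        \<le> ennreal (\<omega> t * (1 + ln (1 / t)) / t) * indicator {0<..1} t"
    proof (cases "\<exists>m. t \<in> dyadic_interval m")
      case True
      then obtain m where m: "t \<in> dyadic_interval m" by blast
      note b = dyadic_interval_bounds[OF m]
      have "\<omega> ((1 / 2) ^ (m + 1)) \<le> \<omega> t"
        using m by (intro modulus_mono) (auto simp: dyadic_interval_def)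
      then have "\<omega> ((1 / 2) ^ (m + 1)) * 1 * 2 ^ m \<le> \<omega> t * (1 + ln (1 / t)) * (1 / t)"
        using b modulus_nonneg[of t] by (intro mult_mono) auto
      then show ?thesis
        unfolding suminf_cmult_indicator[OF disjoint_dyadic_intervals m] using b by (simp add: ennreal_leI)
    next
      case False
      then have "(\<Sum>m. ennreal (\<omega> ((1 / 2) ^ (m + 1)) * 2 ^ m) * indicator (dyadic_interval m) t) = 0" by simp
      then show ?thesis by simp
    qed
  qed
  also have "\<dots> < \<infinity>" using assms by (simp add: log_dini_def)
  finally have "summable (\<lambda>m. \<omega> ((1 / 2) ^ (m + 1)) / 2)"
    using modulus_nonneg by (intro summable_suminf_not_top) auto
  then have "summable (\<lambda>m. \<omega> ((1 / 2) ^ (m + 1)) / 2 * 2)" by (rule summable_mult2)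
  then have "summable (\<lambda>m. \<omega> ((1 / 2) ^ (m + 1)))" by simp
  then show ?thesis by (subst (asm) summable_iff_shift)
qed

text \<open>On the \<open>m\<close>-th dyadic interval the integrand is at most
  \<open>\<omega> ((1 / 2) ^ m) * (real m + 2) * 2 ^ (m + 1)\<close>. The length of the interval
  cancels the power of 2, and \<open>m + 2 \<le> 2 * (m + 1)\<close> leaves twice the term of the
  series, so a finite sum would force a finite integral.\<close>

lemma suminf_eq_top_of_not_log_dini:
  assumes "\<not> log_dini \<omega>" shows "(\<Sum>m. ennreal (\<omega> ((1 / 2) ^ m) * (real m + 1))) = top"
proof (rule ccontr)
  assume fin: "(\<Sum>m. ennreal (\<omega> ((1 / 2) ^ m) * (real m + 1))) \<noteq> top"
  have "(\<integral>\<^sup>+t\<in>{0<..1}. ennreal (\<omega> t * (1 + ln (1 / t)) / t) \<partial>lborel)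
      \<le> (\<integral>\<^sup>+t. (\<Sum>m. ennreal (\<omega> ((1 / 2) ^ m) * (real m + 2) * 2 ^ (m + 1)) * indicator (dyadic_interval m) t) \<partial>lborel)"
  proof (rule nn_integral_mono)
    fix t :: real
    show "ennreal (\<omega> t * (1 + ln (1 / t)) / t) * indicator {0<..1} t
      \<le> (\<Sum>m. ennreal (\<omega> ((1 / 2) ^ m) * (real m + 2) * 2 ^ (m + 1)) * indicator (dyadic_interval m) t)"
    proof (cases "t \<in> {0<..1}")
      case True
      then obtain m where m: "t \<in> dyadic_interval m" using dyadic_interval_exists[of t] by auto
      note b = dyadic_interval_bounds[OF m]
      have "\<omega> t \<le> \<omega> ((1 / 2) ^ m)" using m b by (intro modulus_mono) (auto simp: dyadic_interval_def)
      then have "\<omega> t * (1 + ln (1 / t)) * (1 / t) \<le> \<omega> ((1 / 2) ^ m) * (real m + 2) * 2 ^ (m + 1)"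
        using b modulus_nonneg[of t] modulus_nonneg[of "(1 / 2) ^ m"] by (intro mult_mono) auto
      then show ?thesis
        unfolding suminf_cmult_indicator[OF disjoint_dyadic_intervals m] using True by (simp add: ennreal_leI)
    qed simp
  qed
  also have "\<dots> = (\<Sum>m. ennreal (\<omega> ((1 / 2) ^ m) * (real m + 2) * 2 ^ (m + 1)) * emeasure lborel (dyadic_interval m))"
    by (subst nn_integral_suminf) (auto simp: nn_integral_cmult_indicator)
  also have "\<dots> \<le> (\<Sum>m. 2 * ennreal (\<omega> ((1 / 2) ^ m) * (real m + 1)))"
  proof (intro suminf_le allI)
    fix m
    have "ennreal (\<omega> ((1 / 2) ^ m) * (real m + 2) * 2 ^ (m + 1)) * emeasure lborel (dyadic_interval m)
        = ennreal (\<omega> ((1 / 2) ^ m) * (real m + 2) * 2 ^ (m + 1) * (1 / 2) ^ (m + 1))"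
      unfolding emeasure_dyadic_interval using modulus_nonneg[of "(1 / 2) ^ m"]
      by (intro ennreal_mult[symmetric] mult_nonneg_nonneg) auto
    also have "\<omega> ((1 / 2) ^ m) * (real m + 2) * 2 ^ (m + 1) * (1 / 2) ^ (m + 1) = \<omega> ((1 / 2) ^ m) * (real m + 2)"
      by (simp add: power_one_over)
    also have "\<dots> \<le> \<omega> ((1 / 2) ^ m) * (2 * (real m + 1))"
      using modulus_nonneg[of "(1 / 2) ^ m"] by (intro mult_left_mono) auto
    also have "\<dots> = 2 * (\<omega> ((1 / 2) ^ m) * (real m + 1))" by simp
    also have "ennreal \<dots> = 2 * ennreal (\<omega> ((1 / 2) ^ m) * (real m + 1))"
      using modulus_nonneg[of "(1 / 2) ^ m"] by (subst ennreal_mult) auto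
    finally show "ennreal (\<omega> ((1 / 2) ^ m) * (real m + 2) * 2 ^ (m + 1)) * emeasure lborel (dyadic_interval m)
        \<le> 2 * ennreal (\<omega> ((1 / 2) ^ m) * (real m + 1))" by (simp add: ennreal_leI)
  qed auto
  also have "\<dots> < \<infinity>" using fin by (simp add: ennreal_suminf_cmult ennreal_mult_less_top less_top)
  finally show False using assms by (simp add: log_dini_def)
qed

end

section \<open>Sparse domination of Calderon-Zygmund operators\<close>

lemma cz_lq_of_cz_operator:
  assumes cz: "cz_operator q \<omega> T" and sum: "summable (\<lambda>j. \<omega> ((1 / 2) ^ j))"
  obtains K A B N where "cz_lq K A B \<omega> T q N"
proof -
  have q: "1 \<le> q" and \<omega>: "modulus_of_continuity \<omega>" and T: "bounded_linear_Lq q T"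
    using cz by (auto simp: cz_operator_def)
  obtain K where K: "cz_kernel \<omega> K" and repr: "\<And>f. f \<in> borel_measurable lebesgue \<Longrightarrow> bounded (range f) \<Longrightarrow>
      compact (closure {y. f y \<noteq> 0}) \<Longrightarrow> AE x in lebesgue. x \<notin> closure {y. f y \<noteq> 0} \<longrightarrow>
              has_bochner_integral lebesgue (\<lambda>y. K x y * f y) (T f x)"
    using cz by (auto simp: cz_operator_def)
  obtain A0 B0 where size: "\<And>x y. x \<noteq> y \<Longrightarrow> norm (K x y) \<le> A0 / norm (x - y) ^ CARD('a)"
    and s1: "\<And>x x' y. x \<noteq> y \<Longrightarrow> norm (x - x') \<le> 1 / 2 * norm (x - y) \<Longrightarrow>
      norm (K x y - K x' y) \<le> B0 * \<omega> (norm (x - x') / norm (x - y)) / norm (x - y) ^ CARD('a)"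
    and s2: "\<And>x y y'. x \<noteq> y \<Longrightarrow> norm (y - y') \<le> 1 / 2 * norm (x - y) \<Longrightarrow>
      norm (K x y - K x y') \<le> B0 * \<omega> (norm (y - y') / norm (x - y)) / norm (x - y) ^ CARD('a)"
    using K unfolding cz_kernel_def by blast
  obtain N0 where "\<forall>f\<in>Lq q. Lq_norm q (T f) \<le> N0 * Lq_norm q f"
    using T unfolding bounded_linear_Lq_def by blast
  then have N0: "\<And>f. f \<in> Lq q \<Longrightarrow> Lq_norm q (T f) \<le> N0 * Lq_norm q f" by blast
  \<comment> \<open>The definitions do not fix the sign of the constants; their positive parts
    satisfy the same estimates.\<close>
  have "cz_lq K (max A0 0) (max B0 0) \<omega> T q (max N0 0)"
  proof
    show "norm (K x y) \<le> max A0 0 / norm (x - y) ^ CARD('a)" if "x \<noteq> y" for x y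
      by (rule order_trans[OF size[OF that]]) (simp add: divide_right_mono)
    show "norm (K x y - K x' y) \<le> max B0 0 * \<omega> (norm (x - x') / norm (x - y)) / norm (x - y) ^ CARD('a)"
      if "x \<noteq> y" "norm (x - x') \<le> 1 / 2 * norm (x - y)" for x x' y
      by (rule order_trans[OF s1[OF that]]) (simp add: divide_right_mono mult_right_mono modulus_nonneg[OF \<omega>])
    show "norm (K x y - K x y') \<le> max B0 0 * \<omega> (norm (y - y') / norm (x - y)) / norm (x - y) ^ CARD('a)"
      if "x \<noteq> y" "norm (y - y') \<le> 1 / 2 * norm (x - y)" for x y y'
      by (rule order_trans[OF s2[OF that]]) (simp add: divide_right_mono mult_right_mono modulus_nonneg[OF \<omega>])
    show "\<omega> s \<le> \<omega> t" if "0 \<le> s" "s \<le> t" for s t using modulus_mono[OF \<omega>] that .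
    show "0 \<le> \<omega> s" if "0 \<le> s" for s using modulus_nonneg[OF \<omega>] that .
    show "Lq_norm q (T f) \<le> max N0 0 * Lq_norm q f" if "f \<in> Lq q" for f
      by (rule order_trans[OF N0[OF that]]) (simp add: mult_right_mono Lq_norm_def)
    show "AE x in lebesgue. x \<notin> closure {y. f y \<noteq> 0} \<longrightarrow> has_bochner_integral lebesgue (\<lambda>y. K x y * f y) (T f x)"
      if "nice f" for f
      using repr compact_closure_support[OF that] that by (auto simp: nice_def)
    show "T f \<in> Lq q" if "f \<in> Lq q" for f using T that by (auto simp: bounded_linear_Lq_def)
    show "AE x in lebesgue. T (\<lambda>y. f y + g y) x = T f x + T g x" if "f \<in> Lq q" "g \<in> Lq q" for f g
      using T that by (auto simp: bounded_linear_Lq_def)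
    show "AE x in lebesgue. T (\<lambda>y. c * f y) x = c * T f x" if "f \<in> Lq q" for f c
      using T that by (auto simp: bounded_linear_Lq_def)
  qed (use q sum in auto)
  then show ?thesis by (rule that)
qed

text \<open>For the case without the logarithmic Dini condition, where no weak type estimate is at
  hand: a function that vanishes almost everywhere lies in \<open>L^q\<close>, and boundedness there
  is enough.\<close>

lemma extend_L1_AE_0:
  fixes f :: "real ^ 'n \<Rightarrow> complex"
  assumes T: "bounded_linear_Lq q T" and q: "1 \<le> q"
    and f: "f \<in> borel_measurable lebesgue" "AE x in lebesgue. f x = 0"
  shows "AE x in lebesgue. extend_L1 q T f x = 0"
proof -
  have fLq: "f \<in> Lq q" using f power_integral_AE_0[OF f(2)] by (simp add: Lq_iff)
  then have TLq: "T f \<in> Lq q" using T by (auto simp: bounded_linear_Lq_def)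
  obtain N where "Lq_norm q (T f) \<le> N * Lq_norm q f" using T fLq by (auto simp: bounded_linear_Lq_def)
  moreover have "Lq_norm q f = 0"
  proof -
    have "(LINT x|lebesgue. norm (f x) powr q) = 0"
      using f(2) by (intro integral_eq_zero_AE) (auto elim: eventually_mono)
    then show ?thesis using q by (simp add: Lq_norm_def)
  qed
  ultimately have "(LINT x|lebesgue. norm (T f x) powr q) powr (1 / q) \<le> 0" by (simp add: Lq_norm_def)
  then have "(LINT x|lebesgue. norm (T f x) powr q) = 0"
    by (metis order_antisym powr_eq_0_iff powr_ge_zero)
  then have "AE x in lebesgue. norm (T f x) powr q = 0"
    using TLq by (subst (asm) integral_nonneg_eq_0_iff_AE) (auto simp: Lq_def)
  then show ?thesis using fLq by (simp add: extend_L1_def)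
qed

lemma dyadic_grid_cube_measure:
  fixes P :: "(real ^ 'n) set"
  assumes "dyadic_grid D" "P \<in> D"
  shows "P \<in> sets lebesgue" "measure lebesgue P > 0"
proof -
  obtain c and k :: int where P: "P = cube c (2 powi k)" using assms by (auto simp: dyadic_grid_def)
  show "P \<in> sets lebesgue" unfolding P by (rule sets_lebesgue_cube)
  show "measure lebesgue P > 0" unfolding P by (subst measure_cube) auto
qed

lemma AE_0_of_average_0:
  fixes P :: "(real ^ 'n) set" and f :: "real ^ 'n \<Rightarrow> complex"
  assumes P: "P \<in> sets lebesgue" "measure lebesgue P > 0" and f: "integrable lebesgue f"
    and supp: "AE x in lebesgue. x \<notin> P \<longrightarrow> f x = 0" and avg: "average (\<lambda>y. norm (f y)) P = 0"
  shows "AE x in lebesgue. f x = 0"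
proof -
  have "(LINT y|lebesgue. indicator P y *\<^sub>R norm (f y)) = 0"
    using avg P(2) by (simp add: average_def set_lebesgue_integral_def)
  then have "AE y in lebesgue. indicator P y *\<^sub>R norm (f y) = 0"
    using integrable_mult_indicator[OF P(1) integrable_norm[OF f]]
    by (subst (asm) integral_nonneg_eq_0_iff_AE) auto
  with supp show ?thesis
    by eventually_elim (auto simp: indicator_def split: if_splits)
qed

theorem corollaryA1:
  fixes T :: "(real ^ 'n \<Rightarrow> complex) \<Rightarrow> (real ^ 'n \<Rightarrow> complex)"
    and \<omega> :: "real \<Rightarrow> real" and q :: real
  assumes "cz_operator q \<omega> T"
  shows "\<exists>C::real. C > 0 \<and>
    (\<forall>D (P :: (real ^ 'n) set) (f :: real ^ 'n \<Rightarrow> complex).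
      dyadic_grid D \<and> P \<in> D \<and> integrable lebesgue f \<and> (AE x in lebesgue. x \<notin> P \<longrightarrow> f x = 0) \<longrightarrow>
      (\<exists>(S :: nat \<Rightarrow> (real ^ 'n) set set) G.
         (\<forall>m. sparse_collection (S m)) \<and>
         finite G \<and> card G \<le> 3 ^ CARD('n) \<and> (\<forall>D'\<in>G. dyadic_grid D') \<and> (\<forall>m. \<exists>D'\<in>G. S m \<subseteq> D') \<and>
         (AE x in lebesgue. x \<in> P \<longrightarrow>
            ennreal (norm (extend_L1 q T f x))
              \<le> ennreal C * (\<Sum>m. ennreal (\<omega> (2 powi (- int m)) * (real m + 1)) *
                               sparse_operator (S m) (\<lambda>y. norm (f y)) x))) \<and>
      (log_dini \<omega> \<longrightarrow>
        (\<exists>S' :: nat \<Rightarrow> (real ^ 'n) set set.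
           (\<forall>i\<in>{1..3 ^ CARD('n)}. sparse_collection (S' i)) \<and>
           (AE x in lebesgue. x \<in> P \<longrightarrow>
              ennreal (norm (extend_L1 q T f x))
                \<le> ennreal C * (\<Sum>i = 1..3 ^ CARD('n).
                                 sparse_operator (S' i) (\<lambda>y. norm (f y)) x)))))"
proof -
  have q: "1 \<le> q" and \<omega>: "modulus_of_continuity \<omega>" and T: "bounded_linear_Lq q T"
    using assms by (auto simp: cz_operator_def)
  define w where "w m = \<omega> (2 powi (- int m)) * (real m + 1)" for m
  have w_pos: "w m > 0" for m
    unfolding w_def powi_minus_nat using modulus_pos[OF \<omega>, of "(1 / 2) ^ m"] by (intro mult_pos_pos) auto
  show ?thesis
  proof (cases "log_dini \<omega>")
    case True
    obtain K A B N where "cz_lq K A B \<omega> T q N"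
      using cz_lq_of_cz_operator[OF assms summable_of_log_dini[OF \<omega> True]] .
    then interpret cz_lq K A B \<omega> T q N .
    \<comment> \<open>The leading weights are finitely many and positive. The inserted 1 gives
      \<open>w0 \<le> 1\<close>, so that the constant \<open>C\<close> below serves both
      assertions.\<close>
    define w0 where "w0 = Min (insert 1 (w ` {..<3 ^ CARD('n)}))"
    have w0: "w0 > 0" "w0 \<le> 1" and w0_le: "\<And>m. m < 3 ^ CARD('n) \<Longrightarrow> w0 \<le> w m"
      unfolding w0_def using w_pos by (auto intro!: Min_le)
    define C where "C = domination_const / w0"
    have C: "C > 0" "domination_const \<le> C" "domination_const = C * w0"
      unfolding C_def using domination_const_pos w0 by (auto simp: field_simps)
    show ?thesis
    proof (intro exI[of _ C] conjI allI impI C(1))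
      fix D and P :: "(real ^ 'n) set" and f :: "real ^ 'n \<Rightarrow> complex"
      assume H: "dyadic_grid D \<and> P \<in> D \<and> integrable lebesgue f \<and> (AE x in lebesgue. x \<notin> P \<longrightarrow> f x = 0)"
      let ?g = "\<lambda>y. norm (f y)"
      obtain S' :: "nat \<Rightarrow> (real ^ 'n) set set" where S': "\<And>i. sparse_collection (S' i)" "AE x in lebesgue. x \<in> P \<longrightarrow> ennreal (norm (TE f x))
          \<le> ennreal domination_const * (\<Sum>i = 1..3 ^ CARD('n). sparse_operator (S' i) ?g x)"
        using sparse_domination[of D P f] H by blast
      have "\<forall>i. \<exists>D'. dyadic_grid D' \<and> S' i \<subseteq> D'" using S'(1) by (auto simp: sparse_collection_def)
      then obtain Di where Di: "\<And>i. dyadic_grid (Di i)" "\<And>i. S' i \<subseteq> Di i" by metis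
      \<comment> \<open>The collections of (ii) are indexed from 1, those of (i) from 0.\<close>
      define S where "S m = (if m < 3 ^ CARD('n) then S' (Suc m) else {})" for m
      show "\<exists>S G. (\<forall>m. sparse_collection (S m)) \<and>
         finite G \<and> card G \<le> 3 ^ CARD('n) \<and> (\<forall>D'\<in>G. dyadic_grid D') \<and> (\<forall>m. \<exists>D'\<in>G. S m \<subseteq> D') \<and>
         (AE x in lebesgue. x \<in> P \<longrightarrow> ennreal (norm (TE f x))
              \<le> ennreal C * (\<Sum>m. ennreal (\<omega> (2 powi (- int m)) * (real m + 1)) * sparse_operator (S m) ?g x))"
      proof (intro exI[of _ S] exI[of _ "Di ` {1..3 ^ CARD('n)}"] conjI allI ballI)
        show "sparse_collection (S m)" for m
          using S'(1) sparse_collection_empty[of D] H by (auto simp: S_def)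
        show "card (Di ` {1..3 ^ CARD('n)}) \<le> 3 ^ CARD('n)" using card_image_le[of "{1..3 ^ CARD('n)}" Di] by simp
        show "dyadic_grid D'" if "D' \<in> Di ` {1..3 ^ CARD('n)}" for D' using that Di(1) by blast
        show "\<exists>D'\<in>Di ` {1..3 ^ CARD('n)}. S m \<subseteq> D'" for m
        proof (cases "m < 3 ^ CARD('n)")
          case True
          then have "Suc m \<in> {1..3 ^ CARD('n)}" by auto
          then show ?thesis using Di(2)[of "Suc m"] True by (auto simp: S_def)
        next
          case False
          have "1 \<in> {1..(3::nat) ^ CARD('n)}" by simp
          then show ?thesis using False unfolding S_def by (metis empty_subsetI imageI)
        qed
        show "AE x in lebesgue. x \<in> P \<longrightarrow> ennreal (norm (TE f x))
              \<le> ennreal C * (\<Sum>m. ennreal (\<omega> (2 powi (- int m)) * (real m + 1)) * sparse_operator (S m) ?g x)"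
          using S'(2)
        proof eventually_elim
          case (elim x)
          have "ennreal domination_const * (\<Sum>i = 1..3 ^ CARD('n). sparse_operator (S' i) ?g x)
              = ennreal C * (ennreal w0 * (\<Sum>m<3 ^ CARD('n). sparse_operator (S' (Suc m)) ?g x))"
            using C w0 by (simp add: ennreal_mult mult.assoc sum.atLeast1_atMost_eq)
          also have "ennreal w0 * (\<Sum>m<3 ^ CARD('n). sparse_operator (S' (Suc m)) ?g x)
              = (\<Sum>m<3 ^ CARD('n). ennreal w0 * sparse_operator (S' (Suc m)) ?g x)"
            by (rule sum_distrib_left)
          also have "\<dots> \<le> (\<Sum>m<3 ^ CARD('n). ennreal (w m) * sparse_operator (S m) ?g x)"
            using w0_le by (intro sum_mono) (auto simp: S_def intro!: mult_right_mono ennreal_leI)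
          also have "\<dots> \<le> (\<Sum>m. ennreal (w m) * sparse_operator (S m) ?g x)" by (rule sum_le_suminf) auto
          finally have "ennreal domination_const * (\<Sum>i = 1..3 ^ CARD('n). sparse_operator (S' i) ?g x)
              \<le> ennreal C * (\<Sum>m. ennreal (w m) * sparse_operator (S m) ?g x)" by (simp add: mult_left_mono)
          then show ?case using elim unfolding w_def by (meson order_trans)
        qed
      qed simp
      show "\<exists>S' :: nat \<Rightarrow> (real ^ 'n) set set. (\<forall>i\<in>{1..3 ^ CARD('n)}. sparse_collection (S' i)) \<and>
           (AE x in lebesgue. x \<in> P \<longrightarrow> ennreal (norm (TE f x))
                \<le> ennreal C * (\<Sum>i = 1..3 ^ CARD('n). sparse_operator (S' i) ?g x))"
      proof (intro exI[of _ S'] conjI ballI S'(1))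
        show "AE x in lebesgue. x \<in> P \<longrightarrow> ennreal (norm (TE f x))
                \<le> ennreal C * (\<Sum>i = 1..3 ^ CARD('n). sparse_operator (S' i) ?g x)"
          using S'(2)
        proof eventually_elim
          case (elim x)
          have "ennreal domination_const * (\<Sum>i = 1..3 ^ CARD('n). sparse_operator (S' i) ?g x)
              \<le> ennreal C * (\<Sum>i = 1..3 ^ CARD('n). sparse_operator (S' i) ?g x)"
            using C(2) by (intro mult_right_mono ennreal_leI) auto
          then show ?case using elim by (meson order_trans)
        qed
      qed
    qed
  next
    case False
    \<comment> \<open>Any positive constant would do, as the right-hand side is infinite on
      \<open>P\<close> unless \<open>f\<close> vanishes almost everywhere.\<close>
    show ?thesis
    proof (intro exI[of _ 1] conjI allI impI)
      fix D and P :: "(real ^ 'n) set" and f :: "real ^ 'n \<Rightarrow> complex"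
      assume H: "dyadic_grid D \<and> P \<in> D \<and> integrable lebesgue f \<and> (AE x in lebesgue. x \<notin> P \<longrightarrow> f x = 0)"
      let ?g = "\<lambda>y. norm (f y)"
      have P: "P \<in> sets lebesgue" "measure lebesgue P > 0" using dyadic_grid_cube_measure[of D P] H by auto
      show "\<exists>S G. (\<forall>m. sparse_collection (S m)) \<and>
         finite G \<and> card G \<le> 3 ^ CARD('n) \<and> (\<forall>D'\<in>G. dyadic_grid D') \<and> (\<forall>m. \<exists>D'\<in>G. S m \<subseteq> D') \<and>
         (AE x in lebesgue. x \<in> P \<longrightarrow> ennreal (norm (extend_L1 q T f x))
              \<le> ennreal 1 * (\<Sum>m. ennreal (\<omega> (2 powi (- int m)) * (real m + 1)) * sparse_operator (S m) ?g x))"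
      proof (intro exI[of _ "\<lambda>_::nat. {P}"] exI[of _ "{D}"] conjI allI ballI)
        show "sparse_collection {P}"
          unfolding sparse_collection_def
        proof (intro conjI)
          show "\<exists>D. dyadic_grid D \<and> {P} \<subseteq> D" using H by blast
          show "\<exists>E. (\<forall>Q\<in>{P}. E Q \<in> sets lebesgue \<and> E Q \<subseteq> Q \<and> 1 / 2 * measure lebesgue Q \<le> measure lebesgue (E Q)) \<and> disjoint_family_on E {P}"
            using P by (intro exI[of _ "\<lambda>Q. Q"]) (auto simp: disjoint_family_on_def)
        qed
        show "card {D} \<le> 3 ^ CARD('n)" by simp
        show "dyadic_grid D'" if "D' \<in> {D}" for D' using that H by simp
        show "\<exists>D'\<in>{D}. {P} \<subseteq> D'" using H by simp
        show "AE x in lebesgue. x \<in> P \<longrightarrow> ennreal (norm (extend_L1 q T f x))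
              \<le> ennreal 1 * (\<Sum>m. ennreal (\<omega> (2 powi (- int m)) * (real m + 1)) * sparse_operator {P} ?g x)"
        proof (cases "average ?g P = 0")
          case True
          \<comment> \<open>Here the divergent weights do not help, since every term on the right is
            multiplied by the average 0; the left-hand side must vanish as well.\<close>
          have "AE x in lebesgue. f x = 0" using AE_0_of_average_0[OF P _ _ True] H by blast
          then have "AE x in lebesgue. extend_L1 q T f x = 0"
            using H by (intro extend_L1_AE_0[OF T q]) auto
          then show ?thesis by eventually_elim simp
        next
          case False
          then have pos: "average ?g P > 0" using average_nonneg[of ?g P] by (simp add: less_le)
          have "ennreal 1 * (\<Sum>m. ennreal (\<omega> (2 powi (- int m)) * (real m + 1)) * sparse_operator {P} ?g x) = top"
            if x: "x \<in> P" for x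
          proof -
            have "sparse_operator {P} ?g x = ennreal (average ?g P)" using x by (simp add: sparse_operator_def)
            then have "(\<Sum>m. ennreal (\<omega> (2 powi (- int m)) * (real m + 1)) * sparse_operator {P} ?g x)
                = ennreal (average ?g P) * (\<Sum>m. ennreal (\<omega> ((1 / 2) ^ m) * (real m + 1)))"
              unfolding powi_minus_nat by (simp add: mult.commute flip: ennreal_suminf_cmult)
            also have "\<dots> = top"
              using suminf_eq_top_of_not_log_dini[OF \<omega> \<open>\<not> log_dini \<omega>\<close>] pos by (simp add: ennreal_mult_top)
            finally show ?thesis by simp
          qed
          then show ?thesis by simp
        qed
      qed simp
    qed (use False in auto)
  qed
qed

end
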